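(* Let $\mathcal{R}=(X,\Phi,\check X,\check\Phi)$ be a semisimple root datum, $K\subseteq X$ a submodule containing $\Phi$, $A=X/K$, and $\mathcal{T}=(T,\emptyset,\check T,\emptyset)$ a torus admitting a surjective homomorphism $T\to A$. Fix surjective homomorphisms $h:X\to A$ with $\ker(h)=K$ and $f:T\to A$. Then the map $\mathrm{Aut}(A)\to\mathscr{R}$, $\psi\mapsto$ (isomorphism class of) $\mathcal{R}\oplus_{(A,h,\psi\circ f)}\mathcal{T}$, induces a bijection $$\mathrm{Aut}_{(\mathcal{R},h)}(A)\backslash\mathrm{Aut}(A)/\mathrm{Aut}_{(\mathcal{T},f)}(A)\longrightarrow\mathscr{R}[\mathcal{R},\mathcal{T},K].$$
   Context: Root data are reduced quadruples $(X,\Phi,\check X,\check\Phi)$ with perfect pairing; torus = no roots; semisimple means $\mathbb{Q}\Phi=\mathbb{Q}\otimes X$; $\mathscr{R}$ denotes the set of isomorphism classes of root data. For $S\subseteq X$: $S^\top=\{x\in X: nx\in\mathbb{Z}S$ for some $n>0\}$, $S^\perp=\{y\in\check X:\langle x,y\rangle=0\ \forall x\in S\}$; similarly for subsets of $\check X$. $\mathcal{R}_{\mathrm{rad}}=(X/\Phi^\top,\emptyset,\check\Phi^\perp,\emptyset)$, $\mathcal{R}_{\mathrm{der}}=(X/\check\Phi^\perp,\Phi,\check\Phi^\top,\check\Phi)$. Central product $\mathcal{R}\oplus_{(A,h,f')}\mathcal{T}$ for surjections $h:X\to A$ (killing $\Phi$), $f':T\to A$: the root datum induced from $\mathcal{R}\oplus\mathcal{T}$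 by the submodule $\{(x,t)\in X\oplus T:h(x)=f'(t)\}$ (lattice this submodule, roots $(\alpha,0)$, dual lattice its $\mathbb{Z}$-dual, coroots the restrictions of $(\check\alpha,0)$). $\mathscr{R}[\mathcal{R},\mathcal{T},K]$ is the set of isomorphism classes of root data $\mathcal{R}'=(X',\Phi',\check X',\check\Phi')$ for which there exist isomorphisms $\varphi:\mathcal{R}'_{\mathrm{der}}\to\mathcal{R}$ and $\mathcal{R}'_{\mathrm{rad}}\cong\mathcal{T}$ such that $\varphi((\Phi'^\top\oplus\check\Phi'^\perp)/\check\Phi'^\perp)=K$. Tame automorphisms: for a root datum $\mathcal{S}$ with lattice $Y$ and roots $\Psi$ and a surjection $g:Y\to A$ with $\Psi\subseteq\ker g$, $\mathrm{Aut}_{(\mathcal{S},g)}(A)$ is the group of $\psi\in\mathrm{Aut}(A)$ for which there exists an automorphism $\tilde\psi$ of the root datum $\mathcal{S}$ with $\psi\circ g=g\circ\tilde\psi$ (for a torus this is any $\mathbb{Z}$-module automorphism of $Y$). *)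

theory Defs
  imports "HOL-Algebra.Algebra"
begin

section \<open>Lattices (free Z-modules of finite rank), written multiplicatively as HOL-Algebra groups\<close>

definition Zlat :: "nat \<Rightarrow> (nat \<Rightarrow> int) monoid" where
  "Zlat n = \<lparr>carrier = {v. \<forall>i\<ge>n. v i = 0}, monoid.mult = (\<lambda>u v i. u i + v i), one = (\<lambda>i. 0)\<rparr>"

definition lattice :: "'a monoid \<Rightarrow> bool" where
  "lattice G \<longleftrightarrow> comm_group G \<and> (\<exists>n \<phi>. \<phi> \<in> iso G (Zlat n))"

definition dual_group :: "'a monoid \<Rightarrow> ('a \<Rightarrow> int) monoid" where
  "dual_group G = \<lparr>carrier = hom G integer_group \<inter> extensional (carrier G),
     monoid.mult = (\<lambda>\<phi> \<psi>. \<lambda>x\<in>carrier G. \<phi> x + \<psi> x), one = (\<lambda>x\<in>carrier G. 0)\<rparr>"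

record ('a, 'b) rdatum =
  lat :: "'a monoid"
  roots :: "'a set"
  dlat :: "'b monoid"
  coroots :: "'b set"
  pairing :: "'a \<Rightarrow> 'b \<Rightarrow> int"

definition root_datum :: "('a, 'b) rdatum \<Rightarrow> bool" where
  "root_datum R \<longleftrightarrow>
     lattice (lat R) \<and> lattice (dlat R) \<and>
     (\<forall>x\<in>carrier (lat R). (\<lambda>y. pairing R x y) \<in> hom (dlat R) integer_group) \<and>
     (\<forall>y\<in>carrier (dlat R). (\<lambda>x. pairing R x y) \<in> hom (lat R) integer_group) \<and>
     (\<forall>\<phi>\<in>hom (lat R) integer_group.
        \<exists>!y. y \<in> carrier (dlat R) \<and> (\<forall>x\<in>carrier (lat R). pairing R x y = \<phi> x)) \<and>
     (\<forall>\<phi>\<in>hom (dlat R) integer_group.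
        \<exists>!x. x \<in> carrier (lat R) \<and> (\<forall>y\<in>carrier (dlat R). pairing R x y = \<phi> y)) \<and>
     roots R \<subseteq> carrier (lat R) \<and> finite (roots R) \<and> coroots R \<subseteq> carrier (dlat R) \<and>
     (\<exists>c. bij_betw c (roots R) (coroots R) \<and>
        (\<forall>\<alpha>\<in>roots R.
           pairing R \<alpha> (c \<alpha>) = 2 \<and>
           (\<lambda>x. x \<otimes>\<^bsub>lat R\<^esub> inv\<^bsub>lat R\<^esub> (\<alpha> [^]\<^bsub>lat R\<^esub> pairing R x (c \<alpha>))) ` roots R = roots R \<and>
           (\<lambda>y. y \<otimes>\<^bsub>dlat R\<^esub> inv\<^bsub>dlat R\<^esub> (c \<alpha> [^]\<^bsub>dlat R\<^esub> pairing R \<alpha> y)) ` coroots R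
              = coroots R)) \<and>
     (\<forall>\<alpha>\<in>roots R. \<alpha> [^]\<^bsub>lat R\<^esub> (2::int) \<notin> roots R)"

definition satur :: "'a monoid \<Rightarrow> 'a set \<Rightarrow> 'a set" where
  "satur G S = {x \<in> carrier G. \<exists>n::nat. n > 0 \<and> x [^]\<^bsub>G\<^esub> n \<in> generate G S}"

definition perpL :: "('a, 'b) rdatum \<Rightarrow> 'a set \<Rightarrow> 'b set" where
  "perpL R S = {y \<in> carrier (dlat R). \<forall>x\<in>S. pairing R x y = 0}"

definition perpD :: "('a, 'b) rdatum \<Rightarrow> 'b set \<Rightarrow> 'a set" where
  "perpD R S = {x \<in> carrier (lat R). \<forall>y\<in>S. pairing R x y = 0}"

definition semisimple :: "('a, 'b) rdatum \<Rightarrow> bool" where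
  "semisimple R \<longleftrightarrow> satur (lat R) (roots R) = carrier (lat R)"

definition rd_rad :: "('a, 'b) rdatum \<Rightarrow> ('a set, 'b) rdatum" where
  "rd_rad R = \<lparr>lat = lat R Mod satur (lat R) (roots R), roots = {},
     dlat = (dlat R)\<lparr>carrier := perpL R (roots R)\<rparr>, coroots = {},
     pairing = (\<lambda>C y. pairing R (SOME x. x \<in> C) y)\<rparr>"

definition rd_der :: "('a, 'b) rdatum \<Rightarrow> ('a set, 'b) rdatum" where
  "rd_der R = \<lparr>lat = lat R Mod perpD R (coroots R),
     roots = (\<lambda>\<alpha>. perpD R (coroots R) #>\<^bsub>lat R\<^esub> \<alpha>) ` roots R,
     dlat = (dlat R)\<lparr>carrier := satur (dlat R) (coroots R)\<rparr>, coroots = coroots R,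
     pairing = (\<lambda>C y. pairing R (SOME x. x \<in> C) y)\<rparr>"

definition rd_iso :: "('a, 'b) rdatum \<Rightarrow> ('c, 'd) rdatum \<Rightarrow> ('a \<Rightarrow> 'c) \<Rightarrow> ('b \<Rightarrow> 'd) \<Rightarrow> bool" where
  "rd_iso R S \<phi> \<psi> \<longleftrightarrow> \<phi> \<in> iso (lat R) (lat S) \<and> \<psi> \<in> iso (dlat R) (dlat S) \<and>
     (\<forall>x\<in>carrier (lat R). \<forall>y\<in>carrier (dlat R). pairing S (\<phi> x) (\<psi> y) = pairing R x y) \<and>
     \<phi> ` roots R = roots S \<and> \<psi> ` coroots R = coroots S"

definition rd_isomorphic :: "('a, 'b) rdatum \<Rightarrow> ('c, 'd) rdatum \<Rightarrow> bool" where
  "rd_isomorphic R S \<longleftrightarrow> (\<exists>\<phi> \<psi>. rd_iso R S \<phi> \<psi>)"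

section \<open>Isomorphism classes: represented by the set of all isomorphic root data on
  a fixed universal carrier type (every root datum is isomorphic to one on Z^n)\<close>

type_synonym crd = "(nat \<Rightarrow> int, nat \<Rightarrow> int) rdatum"

definition rd_class :: "('a, 'b) rdatum \<Rightarrow> crd set" where
  "rd_class R = {S :: crd. root_datum S \<and> rd_isomorphic S R}"

definition rd_classes :: "crd set set" where
  "rd_classes = {rd_class S | S :: crd. root_datum S}"

definition rd_RTK :: "('a, 'b) rdatum \<Rightarrow> ('c, 'd) rdatum \<Rightarrow> 'a set \<Rightarrow> crd set set" where
  "rd_RTK R T K = {rd_class R' | R' :: crd. root_datum R' \<and>
     (\<exists>\<phi> \<psi>. rd_iso (rd_der R') R \<phi> \<psi> \<and>
        \<phi> ` ((\<lambda>z. perpD R' (coroots R') #>\<^bsub>lat R'\<^esub> z) `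
               (satur (lat R') (roots R') <#>\<^bsub>lat R'\<^esub> perpD R' (coroots R'))) = K) \<and>
     rd_isomorphic (rd_rad R') T}"

definition rd_dsum :: "('a, 'b) rdatum \<Rightarrow> ('c, 'd) rdatum \<Rightarrow> ('a \<times> 'c, 'b \<times> 'd) rdatum" where
  "rd_dsum R T = \<lparr>lat = lat R \<times>\<times> lat T,
     roots = (\<lambda>\<alpha>. (\<alpha>, \<one>\<^bsub>lat T\<^esub>)) ` roots R \<union> (\<lambda>\<beta>. (\<one>\<^bsub>lat R\<^esub>, \<beta>)) ` roots T,
     dlat = dlat R \<times>\<times> dlat T,
     coroots = (\<lambda>\<alpha>. (\<alpha>, \<one>\<^bsub>dlat T\<^esub>)) ` coroots R \<union> (\<lambda>\<beta>. (\<one>\<^bsub>dlat R\<^esub>, \<beta>)) ` coroots T,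
     pairing = (\<lambda>(x, t) (y, s). pairing R x y + pairing T t s)\<rparr>"

definition rd_induced :: "('a, 'b) rdatum \<Rightarrow> 'a set \<Rightarrow> ('a, 'a \<Rightarrow> int) rdatum" where
  "rd_induced S M = \<lparr>lat = (lat S)\<lparr>carrier := M\<rparr>, roots = roots S,
     dlat = dual_group ((lat S)\<lparr>carrier := M\<rparr>),
     coroots = (\<lambda>c. \<lambda>m\<in>M. pairing S m c) ` coroots S,
     pairing = (\<lambda>m \<phi>. \<phi> m)\<rparr>"

definition cprod :: "('a, 'b) rdatum \<Rightarrow> ('c, 'd) rdatum \<Rightarrow> ('a \<Rightarrow> 'e) \<Rightarrow> ('c \<Rightarrow> 'e)
    \<Rightarrow> ('a \<times> 'c, 'a \<times> 'c \<Rightarrow> int) rdatum" where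
  "cprod R T h f' = rd_induced (rd_dsum R T)
     {(x, t). x \<in> carrier (lat R) \<and> t \<in> carrier (lat T) \<and> h x = f' t}"

definition tame_aut :: "('a, 'b) rdatum \<Rightarrow> ('a \<Rightarrow> 'e) \<Rightarrow> 'e monoid \<Rightarrow> ('e \<Rightarrow> 'e) set" where
  "tame_aut S g A = {\<psi> \<in> auto A. \<exists>u v. rd_iso S S u v \<and>
      (\<forall>y\<in>carrier (lat S). \<psi> (g y) = g (u y))}"

end

theory Submission
  imports Defs
begin

text \<open>
  For a root datum \<open>R'\<close> the invariant form \<open>\<Sum>\<^sub>\<alpha> \<langle>\<alpha>,y\<rangle>\<langle>\<alpha>,w\<rangle>\<close> shows that \<open>\<Phi>'\<^sup>\<top>\<close> and the annihilator of the coroots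
  meet trivially, and that the saturation of the coroots is its double annihilator. So the lattice of \<open>R'\<close> embeds into
  the product of the lattices of its derived datum and its radical as a fibre product over a finite group:
  \<open>R'\<close> is a central product \<open>R \<oplus>\<^bsub>(A,h,g)\<^esub> T\<close> for some surjection \<open>g : T \<rightarrow> A\<close>. Any two surjections of a free module
  onto the same torsion group have kernels conjugate under an automorphism of the free module
  (existence and uniqueness of the Smith normal form), so \<open>g\<close> may be taken to be \<open>\<psi> \<circ> f\<close>.
  Since both kernels of the projections of the fibre product are intrinsic to the root datum, an isomorphism of two
  central products is a pair of automorphisms of \<open>R\<close> and \<open>T\<close>, whose effects on \<open>A\<close> are the tame automorphisms.
\<close>

section \<open>Equivalence of epimorphisms from a lattice onto a torsion group\<close>

text \<open>Isomorphism classes consist of root data on Z^n, while a central product lives on a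
  sublattice of a product and has functionals as its dual lattice. The comparison therefore runs
  through a concrete datum \<open>S\<close> on Z^n with two maps \<open>p\<close>, \<open>q\<close>
  out of its lattice. Coroots are treated throughout as functionals on the lattice. One-sided
  perfectness (\<open>left_perfect\<close>) recovers the dual half of an isomorphism from its
  lattice half, so the relation \<open>coroots_match\<close> replaces explicit dual maps, and
  quotients and central products need not be shown to be root data before they are compared.
  Semisimplicity enters in two ways: it makes A a torsion group, which bounds the invariant factors
  of a surjection onto A, and it forces the kernel of \<open>p\<close> to be the whole annihilator
  of the coroots. Conjugating kernels leaves an automorphism of A undetermined; this is the \<psi>
  in the parametrisation. Changes of the factor R act on A through \<open>h\<close>, changes of T
  through \<open>f\<close>, hence on opposite sides of \<psi>.\<close>

lemma carrier_Zlat: "carrier (Zlat n) = {v. \<forall>i\<ge>n. v i = 0}"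
  and mult_Zlat: "u \<otimes>\<^bsub>Zlat n\<^esub> v = (\<lambda>i. u i + v i)"
  and one_Zlat: "\<one>\<^bsub>Zlat n\<^esub> = (\<lambda>i. 0)"
  by (simp_all add: Zlat_def)

lemma comm_group_Zlat: "comm_group (Zlat n)"
proof (rule comm_groupI)
  fix x assume "x \<in> carrier (Zlat n)"
  then show "\<exists>y\<in>carrier (Zlat n). y \<otimes>\<^bsub>Zlat n\<^esub> x = \<one>\<^bsub>Zlat n\<^esub>"
    by (intro bexI[of _ "\<lambda>i. - x i"]) (auto simp: carrier_Zlat mult_Zlat one_Zlat)
qed (auto simp: carrier_Zlat mult_Zlat one_Zlat)

lemma group_Zlat: "group (Zlat n)"
  using comm_group_Zlat comm_group.axioms(2) by blast

lemma inv_Zlat: "v \<in> carrier (Zlat n) \<Longrightarrow> inv\<^bsub>Zlat n\<^esub> v = (\<lambda>i. - v i)"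
  by (rule group.inv_equality[OF group_Zlat]) (auto simp: carrier_Zlat mult_Zlat one_Zlat)

lemma nat_pow_Zlat: "v [^]\<^bsub>Zlat n\<^esub> (k::nat) = (\<lambda>i. int k * v i)"
  by (induction k) (auto simp: mult_Zlat one_Zlat algebra_simps)

lemma int_pow_Zlat: "v \<in> carrier (Zlat n) \<Longrightarrow> v [^]\<^bsub>Zlat n\<^esub> (k::int) = (\<lambda>i. k * v i)"
  by (auto simp: int_pow_def2 nat_pow_Zlat inv_Zlat carrier_Zlat)

lemma hom_int_pow_eq:
  assumes "group G" "group H" "\<phi> \<in> hom G H" "x \<in> carrier G"
  shows "\<phi> (x [^]\<^bsub>G\<^esub> (k::int)) = \<phi> x [^]\<^bsub>H\<^esub> k"
  using assms by (metis group_hom.hom_int_pow group_hom.intro group_hom_axioms.intro)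

lemma hom_nat_pow_eq:
  assumes "group G" "group H" "\<phi> \<in> hom G H" "x \<in> carrier G"
  shows "\<phi> (x [^]\<^bsub>G\<^esub> (k::nat)) = \<phi> x [^]\<^bsub>H\<^esub> k"
  using assms by (metis group_hom.hom_nat_pow group_hom.intro group_hom_axioms.intro)

lemma hom_inv_eq:
  assumes "group G" "group H" "\<phi> \<in> hom G H" "x \<in> carrier G"
  shows "\<phi> (inv\<^bsub>G\<^esub> x) = inv\<^bsub>H\<^esub> \<phi> x"
  using assms by (metis group_hom.hom_inv group_hom.intro group_hom_axioms.intro)

section \<open>Elementary automorphisms of Z^n and primitive vectors\<close>

definition shear :: "nat \<Rightarrow> (nat \<Rightarrow> int) \<Rightarrow> (nat \<Rightarrow> int) \<Rightarrow> nat \<Rightarrow> int" where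
  "shear i c w = (\<lambda>j. if j = i then w j else w j + c j * w i)"

lemma shear_iso:
  assumes "c \<in> carrier (Zlat n)"
  shows "shear i c \<in> iso (Zlat n) (Zlat n)"
proof (rule isoI)
  show "shear i c \<in> hom (Zlat n) (Zlat n)"
    using assms by (auto simp: hom_def carrier_Zlat mult_Zlat shear_def fun_eq_iff algebra_simps)
  \<comment> \<open>Coordinate \<open>i\<close> is never altered, whatever \<open>c i\<close> is, so
    shearing by the negated vector undoes the map.\<close>
  show "bij_betw (shear i c) (carrier (Zlat n)) (carrier (Zlat n))"
    by (rule bij_betw_byWitness[where f' = "shear i (\<lambda>j. - c j)"])
      (use assms in \<open>auto simp: carrier_Zlat shear_def fun_eq_iff\<close>)
qed

lemma transpose_iso:
  assumes "i < n" "k < n"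
  shows "(\<lambda>w. w \<circ> transpose i k) \<in> iso (Zlat n) (Zlat n)"
proof (rule isoI)
  have *: "\<And>j. n \<le> j \<Longrightarrow> transpose i k j = j" using assms by (auto simp: transpose_def)
  show "(\<lambda>w. w \<circ> transpose i k) \<in> hom (Zlat n) (Zlat n)"
    using * by (auto simp: hom_def carrier_Zlat mult_Zlat fun_eq_iff)
  show "bij_betw (\<lambda>w. w \<circ> transpose i k) (carrier (Zlat n)) (carrier (Zlat n))"
    by (rule bij_betw_byWitness[where f' = "\<lambda>w. w \<circ> transpose i k"])
      (use * in \<open>auto simp: carrier_Zlat fun_eq_iff\<close>)
qed

definition unit_vec :: "nat \<Rightarrow> nat \<Rightarrow> int" where
  "unit_vec j = (\<lambda>i. if i = j then 1 else 0)"

lemma iso_comp: "u \<in> iso G H \<Longrightarrow> v \<in> iso H I \<Longrightarrow> (\<lambda>x. v (u x)) \<in> iso G I"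
  using iso_set_trans[of u G H v I] by (simp add: comp_def compose_def)

lemma iso_inverse:
  assumes k: "k \<in> iso G H" and "group G"
  obtains k' where "k' \<in> iso H G" "\<And>x. x \<in> carrier G \<Longrightarrow> k' (k x) = x"
    "\<And>y. y \<in> carrier H \<Longrightarrow> k' y \<in> carrier G \<and> k (k' y) = y"
proof (rule that)
  show "inv_into (carrier G) k \<in> iso H G" using group.iso_set_sym assms by blast
  have "bij_betw k (carrier G) (carrier H)" using k by (simp add: iso_def)
  then show "inv_into (carrier G) k (k x) = x" if "x \<in> carrier G" for x
    using that by (rule bij_betw_inv_into_left)
  show "inv_into (carrier G) k y \<in> carrier G \<and> k (inv_into (carrier G) k y) = y" if "y \<in> carrier H" for y
    using that k by (auto simp: iso_def bij_betw_def inv_into_into f_inv_into_f)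
qed

text \<open>This produces a first pivot as in the Smith normal form. Among the nonzero coordinates
  of all images of elements of \<open>L\<close> under automorphisms, one of least absolute value
  divides every coordinate; the content hypothesis makes it 1, and then the other coordinates can be
  cleared.\<close>

lemma content_one_unit_vec:
  assumes L: "subgroup L (Zlat n)"
    and content: "\<And>d::int. d > 1 \<Longrightarrow> \<exists>x\<in>L. \<exists>i. \<not> d dvd x i"
    and "k < n"
  shows "\<exists>u\<in>iso (Zlat n) (Zlat n). u (unit_vec k) \<in> L"
proof -
  let ?G = "Zlat n"
  interpret G: comm_group ?G by (rule comm_group_Zlat)
  have LG: "x \<in> L \<Longrightarrow> x \<in> carrier ?G" for x using L subgroup.subset by blast
  have lin: "(\<lambda>i. x i + q * y i) \<in> L" if "x \<in> L" "y \<in> L" for x y q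
  proof -
    have "x \<otimes>\<^bsub>?G\<^esub> (y [^]\<^bsub>?G\<^esub> q) \<in> L"
      using L that by (simp add: subgroup.m_closed G.subgroup_int_pow_closed)
    then show ?thesis using LG that by (simp add: mult_Zlat int_pow_Zlat)
  qed
  have ulin: "u (\<lambda>i. x i + q * y i) = (\<lambda>i. u x i + q * u y i)"
    if u: "u \<in> iso ?G ?G" and "x \<in> carrier ?G" "y \<in> carrier ?G" for u x y q
  proof -
    have h: "u \<in> hom ?G ?G" using u by (simp add: iso_def)
    have uy: "u y \<in> carrier ?G" using h that by (auto simp: hom_def)
    have "u (x \<otimes>\<^bsub>?G\<^esub> (y [^]\<^bsub>?G\<^esub> q)) = u x \<otimes>\<^bsub>?G\<^esub> (u y [^]\<^bsub>?G\<^esub> q)"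
      using h that by (simp add: hom_mult hom_int_pow_eq[OF G.is_group G.is_group h])
    then show ?thesis using uy that by (simp add: mult_Zlat int_pow_Zlat)
  qed
  have u0: "u x i = 0" if "u \<in> iso ?G ?G" "x \<in> carrier ?G" "i \<ge> n" for u x i
    using that by (auto simp: iso_def hom_def carrier_Zlat)
  \<comment> \<open>The minimum is taken over all automorphisms at once, so a further elementary
    move that left a smaller nonzero remainder would contradict it.\<close>
  define P where "P m \<longleftrightarrow> m > 0 \<and> (\<exists>u\<in>iso ?G ?G. \<exists>x\<in>L. \<exists>i<n. nat \<bar>u x i\<bar> = m)" for m
  obtain x0 i0 where x0: "x0 \<in> L" "\<not> 2 dvd x0 i0" using content[of 2] by auto
  have "i0 < n" using x0 LG by (metis (mono_tags, lifting) carrier_Zlat dvd_0_right linorder_not_le mem_Collect_eq)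
  have "id \<in> iso ?G ?G" by (rule iso_set_refl[unfolded id_def[symmetric]])
  then have "P (nat \<bar>x0 i0\<bar>)" unfolding P_def using x0 \<open>i0 < n\<close>
    by (intro conjI bexI[of _ id] bexI[of _ x0] exI[of _ i0]) (auto intro: ccontr)
  then have "\<exists>m. P m" by blast
  define m where "m = (LEAST m. P m)"
  have "P m" unfolding m_def by (rule LeastI_ex) fact
  have least: "int m \<le> \<bar>u x i\<bar>" if "u \<in> iso ?G ?G" "x \<in> L" "i < n" "u x i \<noteq> 0" for u x i
  proof -
    have "P (nat \<bar>u x i\<bar>)" unfolding P_def using that by auto
    then have "m \<le> nat \<bar>u x i\<bar>" unfolding m_def by (rule Least_le)
    then show ?thesis by linarith
  qed
  obtain u x' i where u: "u \<in> iso ?G ?G" and x': "x' \<in> L" "i < n" "\<bar>u x' i\<bar> = int m" and "m > 0"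
    using \<open>P m\<close> unfolding P_def by force
  obtain x where x: "x \<in> L" "u x i = int m"
  proof (cases "u x' i \<ge> 0")
    case True then show ?thesis using that x' by auto
  next
    case False
    \<comment> \<open>This is the negative of \<open>x'\<close>, written in the shape that
      \<open>lin\<close> and \<open>ulin\<close> handle.\<close>
    have "(\<lambda>j. x' j + (-2) * x' j) \<in> L" using lin x' by blast
    moreover have "u (\<lambda>j. x' j + (-2) * x' j) i = int m"
      using ulin[OF u, of x' x' "-2"] LG x' False by simp
    ultimately show ?thesis using that by blast
  qed
  \<comment> \<open>Division with remainder by the pivot: a shear replaces coordinate
    \<open>j\<close> by its residue modulo \<open>m\<close>, and minimality forces the residue to
    vanish.\<close>
  have claim: "int m dvd u y j" if "y \<in> L" "u y i = int m" for y j
  proof (cases "j = i \<or> j \<ge> n")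
    case True then show ?thesis using that u0[OF u] LG by auto
  next
    case False
    define c where "c = (\<lambda>l. if l = j then - (u y j div int m) else 0)"
    have "c \<in> carrier ?G" using False by (auto simp: c_def carrier_Zlat)
    then have "(\<lambda>z. shear i c (u z)) \<in> iso ?G ?G" using u shear_iso iso_comp by blast
    moreover have "shear i c (u y) j = u y j mod int m"
      using False that by (simp add: shear_def c_def minus_div_mult_eq_mod)
    ultimately have "u y j mod int m = 0"
      using least[of "\<lambda>z. shear i c (u z)" y j] that False \<open>m > 0\<close>
      by (smt (verit) leI of_nat_0_less_iff pos_mod_bound pos_mod_sign)
    then show ?thesis by auto
  qed
  \<comment> \<open>An element with arbitrary pivot coordinate is first reduced to \<open>y'\<close>
    with pivot coordinate 0; adding \<open>x\<close> restores the value \<open>m\<close> there, so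
    that \<open>claim\<close> applies.\<close>
  have all: "int m dvd u y j" if y: "y \<in> L" for y j
  proof -
    define q where "q = u y i div int m"
    define y' where "y' = (\<lambda>l. y l + (-q) * x l)"
    have y': "y' \<in> L" unfolding y'_def using lin that x by blast
    have uy': "u y' = (\<lambda>l. u y l + (-q) * u x l)"
      unfolding y'_def using ulin[OF u] LG that x by blast
    have "u y' i = u y i mod int m" using x by (simp add: uy' q_def minus_div_mult_eq_mod)
    then have 0: "u y' i = 0" using least[OF u y' x'(2)] \<open>m > 0\<close>
      by (smt (verit) of_nat_0_less_iff pos_mod_bound pos_mod_sign)
    have s: "(\<lambda>l. x l + 1 * y' l) \<in> L" using lin x y' by blast
    have us: "u (\<lambda>l. x l + 1 * y' l) = (\<lambda>l. u x l + 1 * u y' l)" using ulin[OF u] LG y' x by blast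
    have "int m dvd u x j + 1 * u y' j" using claim[OF s] us 0 x by simp
    then have "int m dvd u y' j" using claim[OF x] by (simp add: dvd_add_right_iff)
    then have "int m dvd u y j + (-q) * u x j" using uy' by simp
    moreover have "int m dvd (-q) * u x j" using claim[OF x] by simp
    ultimately show ?thesis using dvd_add_left_iff by blast
  qed
  \<comment> \<open>Otherwise all of \<open>L\<close> would be divisible by \<open>m\<close> after
    applying \<open>u\<close>, hence also before, since an automorphism preserves divisibility of
    vectors.\<close>
  have "m = 1"
  proof (rule ccontr)
    assume "m \<noteq> 1"
    then obtain y j where y: "y \<in> L" "\<not> int m dvd y j" using content[of "int m"] \<open>m > 0\<close> by auto
    define w where "w = (\<lambda>j. u y j div int m)"
    have "w \<in> carrier ?G" using u0[OF u] LG y by (auto simp: carrier_Zlat w_def)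
    moreover have "u ` carrier ?G = carrier ?G" using u by (simp add: iso_def bij_betw_def)
    ultimately obtain v where v: "v \<in> carrier ?G" "u v = w" by (metis imageE)
    have "(\<lambda>i. 0) \<in> carrier ?G" by (simp add: carrier_Zlat)
    moreover have "u (\<lambda>i. 0) = (\<lambda>i. 0)"
      using u hom_one[of u ?G ?G] by (simp add: iso_def one_Zlat)
    ultimately have "u (\<lambda>l. 0 + int m * v l) = (\<lambda>l. 0 + int m * w l)"
      using ulin[OF u, of "\<lambda>i. 0" v "int m"] v by simp
    also have "\<dots> = u y" using all[OF y(1)] by (auto simp: w_def)
    finally have eq: "u (\<lambda>l. int m * v l) = u y" by simp
    have "(\<lambda>l. int m * v l) = y"
    proof (rule inj_onD[of u "carrier ?G"])
      show "u (\<lambda>l. int m * v l) = u y" by (rule eq)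
      show "inj_on u (carrier ?G)" using u by (simp add: iso_def bij_betw_def)
      show "(\<lambda>l. int m * v l) \<in> carrier ?G" using v by (simp add: carrier_Zlat)
      show "y \<in> carrier ?G" using LG y by blast
    qed
    then show False using y by auto
  qed
  \<comment> \<open>With pivot 1 this shear clears all other coordinates of \<open>u x\<close>; the
    transposition then moves the pivot from \<open>i\<close> to \<open>k\<close>.\<close>
  define c where "c = (\<lambda>j. - u x j)"
  have "c \<in> carrier ?G" using u0[OF u] LG x by (auto simp: c_def carrier_Zlat)
  define v where "v z = shear i c (u z) \<circ> transpose i k" for z
  have v: "v \<in> iso ?G ?G" unfolding v_def
    using iso_comp[OF iso_comp[OF u shear_iso[OF \<open>c \<in> carrier ?G\<close>]] transpose_iso[OF \<open>i < n\<close> \<open>k < n\<close>]] .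
  have "v x = unit_vec k"
    using x \<open>m = 1\<close> by (auto simp: v_def shear_def c_def unit_vec_def fun_eq_iff transpose_def)
  moreover have "inj_on v (carrier ?G)" using v by (simp add: iso_def bij_betw_def)
  ultimately have "inv_into (carrier ?G) v (unit_vec k) = x" using LG x inv_into_f_f by metis
  then show ?thesis using G.iso_set_sym[OF v] x by metis
qed

lemma unit_vec_in_Zlat: "k < n \<Longrightarrow> unit_vec k \<in> carrier (Zlat n)"
  by (auto simp: unit_vec_def carrier_Zlat)

section \<open>Kernels contained in dZ^n, and conjugacy of kernels\<close>

lemma subgroup_comm_group:
  assumes "comm_group G" "subgroup H G"
  shows "comm_group (G\<lparr>carrier := H\<rparr>)"
proof (rule group.group_comm_groupI)
  show "group (G\<lparr>carrier := H\<rparr>)"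
    using assms by (simp add: comm_group_def group.subgroup_imp_group)
  interpret comm_group G by fact
  fix x y assume "x \<in> carrier (G\<lparr>carrier := H\<rparr>)" "y \<in> carrier (G\<lparr>carrier := H\<rparr>)"
  then show "x \<otimes>\<^bsub>G\<lparr>carrier := H\<rparr>\<^esub> y = y \<otimes>\<^bsub>G\<lparr>carrier := H\<rparr>\<^esub> x"
    using subgroup.mem_carrier[OF assms(2)] m_comm by simp
qed

lemma pow_image_subgroup:
  fixes G (structure)
  assumes "comm_group G"
  shows "subgroup ((\<lambda>a. a [^] (d::nat)) ` carrier G) G"
proof -
  interpret G: comm_group G by fact
  show ?thesis
  proof (rule G.subgroupI)
    fix a assume "a \<in> (\<lambda>a. a [^] d) ` carrier G"
    then obtain b where "b \<in> carrier G" "a = b [^] d" by blast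
    then show "inv a \<in> (\<lambda>a. a [^] d) ` carrier G"
      by (intro image_eqI[of _ _ "inv b"]) (auto simp: G.nat_pow_inv)
  next
    fix a b assume "a \<in> (\<lambda>a. a [^] d) ` carrier G" "b \<in> (\<lambda>a. a [^] d) ` carrier G"
    then obtain a' b' where "a' \<in> carrier G" "a = a' [^] d" "b' \<in> carrier G" "b = b' [^] d"
      by blast
    then show "a \<otimes> b \<in> (\<lambda>a. a [^] d) ` carrier G"
      by (intro image_eqI[of _ _ "a' \<otimes> b'"]) (auto simp: G.pow_mult_distrib G.m_comm)
  qed auto
qed

text \<open>The kernel of \<open>f\<close> lies in \<open>d\<int>\<^sup>n\<close> iff \<open>A/dA\<close> has \<open>d\<^sup>n\<close> elements, a condition independent of \<open>f\<close>.\<close>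

lemma kernel_content_independent:
  fixes A (structure) and d :: nat
  assumes A: "comm_group A" and f: "f \<in> epi (Zlat n) A" and g: "g \<in> epi (Zlat n) A" and "d > 0"
    and fker: "\<And>x i. x \<in> carrier (Zlat n) \<Longrightarrow> f x = \<one> \<Longrightarrow> int d dvd x i"
    and x: "x \<in> carrier (Zlat n)" "g x = \<one>"
  shows "int d dvd x i"
proof -
  interpret A: comm_group A by (rule A)
  let ?G = "Zlat n"
  interpret G: comm_group ?G by (rule comm_group_Zlat)
  define D where "D = (\<lambda>a. a [^] d) ` carrier A"
  have D: "subgroup D A" unfolding D_def by (rule pow_image_subgroup[OF A])
  \<comment> \<open>Standard representatives of Z^n modulo d, a finite set that serves
    \<open>f\<close> and \<open>g\<close> alike.\<close>
  define Box where "Box = {v \<in> carrier ?G. \<forall>i. 0 \<le> v i \<and> v i < int d}"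
  have "Box \<subseteq> (\<lambda>w i. if i < n then w i else 0) ` ({..<n} \<rightarrow>\<^sub>E {0..<int d})"
  proof
    fix v assume v: "v \<in> Box"
    show "v \<in> (\<lambda>w i. if i < n then w i else 0) ` ({..<n} \<rightarrow>\<^sub>E {0..<int d})"
      using v by (intro image_eqI[of _ _ "restrict v {..<n}"]) (auto simp: Box_def carrier_Zlat fun_eq_iff)
  qed
  then have "finite Box" by (rule finite_subset) (intro finite_imageI finite_PiE; simp)
  \<comment> \<open>Writing v = d z + b shows that every coset of dA is already reached from
    \<open>Box\<close>, for any epimorphism \<open>k\<close>.\<close>
  have img: "(\<lambda>b. D #> k b) ` Box = (\<lambda>a. D #> a) ` carrier A"
    if k: "k \<in> epi ?G A" for k
  proof (intro equalityI subsetI)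
    have kh: "k \<in> hom ?G A" and ks: "k ` carrier ?G = carrier A" using k by (auto simp: epi_def)
    fix C assume "C \<in> (\<lambda>b. D #> k b) ` Box"
    then show "C \<in> (\<lambda>a. D #> a) ` carrier A" using ks by (auto simp: Box_def)
  next
    have kh: "k \<in> hom ?G A" and ks: "k ` carrier ?G = carrier A" using k by (auto simp: epi_def)
    fix C assume "C \<in> (\<lambda>a. D #> a) ` carrier A"
    then obtain a where a: "a \<in> k ` carrier ?G" "C = D #> a" by (auto simp only: ks)
    then obtain v where v: "v \<in> carrier ?G" "C = D #> k v" by blast
    define b where "b = (\<lambda>i. v i mod int d)"
    define z where "z = (\<lambda>i. v i div int d)"
    have b: "b \<in> Box" using v \<open>d > 0\<close> by (auto simp: Box_def b_def carrier_Zlat)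
    have z: "z \<in> carrier ?G" using v by (auto simp: z_def carrier_Zlat)
    have bG: "b \<in> carrier ?G" using b by (auto simp: Box_def)
    have kz: "k z \<in> carrier A" "k b \<in> carrier A" using z bG ks by auto
    have "v = (z [^]\<^bsub>?G\<^esub> d) \<otimes>\<^bsub>?G\<^esub> b"
      by (auto simp: nat_pow_Zlat mult_Zlat z_def b_def fun_eq_iff)
    then have "k v = (k z [^] d) \<otimes> k b"
      using z bG by (simp add: hom_mult[OF kh] hom_nat_pow_eq[OF G.is_group A.is_group kh])
    moreover have "k z [^] d \<in> D" using kz by (auto simp: D_def)
    ultimately have "k v \<in> D #> k b" by (auto simp: r_coset_def)
    then have "D #> k b = D #> k v" using A.repr_independence D kz by blast
    then show "C \<in> (\<lambda>b. D #> k b) ` Box" using b v by auto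
  qed
  have fh: "f \<in> hom ?G A" and fs: "f ` carrier ?G = carrier A" using f by (auto simp: epi_def)
  \<comment> \<open>Here the hypothesis on the kernel of \<open>f\<close> enters: if
    \<open>f b\<close> and \<open>f b'\<close> lie in one coset, then b - (d z + b') is in the
    kernel for some z, so b and b' agree modulo d.\<close>
  have "inj_on (\<lambda>b. D #> f b) Box"
  proof (rule inj_onI)
    fix b b' assume b: "b \<in> Box" and b': "b' \<in> Box" and eq: "D #> f b = D #> f b'"
    have bG: "b \<in> carrier ?G" "b' \<in> carrier ?G" using b b' by (auto simp: Box_def)
    have fb: "f b \<in> carrier A" "f b' \<in> carrier A" using bG fs by auto
    have "f b \<in> D #> f b'" using eq A.rcos_self[OF fb(1) D] by simp
    then obtain a where a: "a \<in> f ` carrier ?G" "f b = (a [^] d) \<otimes> f b'"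
      unfolding r_coset_def D_def fs by blast
    then obtain z where z: "z \<in> carrier ?G" "f b = (f z [^] d) \<otimes> f b'" by blast
    have fz: "f z \<in> carrier A" using fs z by auto
    define w where "w = b \<otimes>\<^bsub>?G\<^esub> inv\<^bsub>?G\<^esub> ((z [^]\<^bsub>?G\<^esub> d) \<otimes>\<^bsub>?G\<^esub> b')"
    have wG: "w \<in> carrier ?G" using bG z by (simp add: w_def)
    have "f w = f b \<otimes> inv f ((z [^]\<^bsub>?G\<^esub> d) \<otimes>\<^bsub>?G\<^esub> b')"
      using bG z by (simp add: w_def hom_mult[OF fh] hom_inv_eq[OF G.is_group A.is_group fh]
          del: G.inv_mult_group)
    also have "f ((z [^]\<^bsub>?G\<^esub> d) \<otimes>\<^bsub>?G\<^esub> b') = f b"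
      using bG z by (simp add: hom_mult[OF fh] hom_nat_pow_eq[OF G.is_group A.is_group fh])
    finally have "f w = \<one>" using fb by simp
    then have "int d dvd w i" for i using fker wG by blast
    moreover have "w i = b i - (int d * z i + b' i)" for i
      unfolding w_def using bG z by (subst inv_Zlat) (auto simp: mult_Zlat nat_pow_Zlat carrier_Zlat)
    ultimately have "int d dvd b i - (int d * z i + b' i)" for i by simp
    then have "int d dvd b i - b' i" for i
      by (metis diff_diff_add dvd_add_right_iff dvd_triv_left add_diff_cancel_left' diff_add_cancel add.commute)
    then have "b i mod int d = b' i mod int d" for i by (simp add: mod_eq_dvd_iff)
    then show "b = b'" using b b' by (auto simp: Box_def fun_eq_iff)
  qed
  \<comment> \<open>\<open>f\<close> and \<open>g\<close> map the same finite set onto the same set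
    of cosets, so injectivity passes from one to the other by counting.\<close>
  then have "card ((\<lambda>b. D #> g b) ` Box) = card Box"
    using img[OF f] img[OF g] card_image by metis
  then have inj: "inj_on (\<lambda>b. D #> g b) Box" using \<open>finite Box\<close> eq_card_imp_inj_on by blast
  have gh: "g \<in> hom ?G A" and gs: "g ` carrier ?G = carrier A" using g by (auto simp: epi_def)
  define b where "b = (\<lambda>i. x i mod int d)"
  \<comment> \<open>The sign makes b = d z + x. As \<open>g x\<close> is trivial, \<open>g b\<close>
    is a d-th power, so \<open>b\<close> shares its coset with the zero vector.\<close>
  define z where "z = (\<lambda>i. - (x i div int d))"
  have b: "b \<in> Box" using x \<open>d > 0\<close> by (auto simp: Box_def b_def carrier_Zlat)
  have o: "(\<lambda>i. 0) \<in> Box" using \<open>d > 0\<close> by (auto simp: Box_def carrier_Zlat)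
  have z: "z \<in> carrier ?G" using x by (auto simp: z_def carrier_Zlat)
  have "b = (z [^]\<^bsub>?G\<^esub> d) \<otimes>\<^bsub>?G\<^esub> x"
    by (auto simp: nat_pow_Zlat mult_Zlat z_def b_def fun_eq_iff minus_mult_div_eq_mod)
  then have "g b = g z [^] d \<otimes> g x"
    using z x by (simp add: hom_mult[OF gh] hom_nat_pow_eq[OF G.is_group A.is_group gh])
  then have "g b = g z [^] d" using x z hom_in_carrier[OF gh] by simp
  then have "g b \<in> D" using z gs by (auto simp: D_def)
  moreover have "g (\<lambda>i. 0) = \<one>" using hom_one[OF gh G.is_group A.is_group] by (simp add: one_Zlat)
  ultimately have "D #> g b = D #> g (\<lambda>i. 0)"
    using A.coset_join2 D by (simp add: A.subgroupE subgroup.mem_carrier subgroup.subset)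
  then have "b = (\<lambda>i. 0)" using inj b o by (auto dest: inj_onD)
  then have "x i mod int d = 0" by (auto simp: b_def fun_eq_iff)
  then show ?thesis by auto
qed

text \<open>The direct sum of \<open>u\<close> with the identity of the last coordinate;
  \<open>x(n := 0)\<close> projects to the first \<open>n\<close> coordinates. It lifts the
  automorphism supplied by an induction hypothesis in rank \<open>n\<close>.\<close>

lemma extend_iso_Zlat:
  assumes u: "u \<in> iso (Zlat n) (Zlat n)"
  shows "(\<lambda>x. (u (x(n := 0)))(n := x n)) \<in> iso (Zlat (Suc n)) (Zlat (Suc n))"
proof (rule isoI)
  have c: "x \<in> carrier (Zlat (Suc n)) \<Longrightarrow> x(n := 0) \<in> carrier (Zlat n)" for x
    by (auto simp: carrier_Zlat Suc_le_eq)
  have c': "w \<in> carrier (Zlat n) \<Longrightarrow> w(n := a) \<in> carrier (Zlat (Suc n))" for w a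
    by (auto simp: carrier_Zlat)
  have uc: "u x \<in> carrier (Zlat n)" if "x \<in> carrier (Zlat n)" for x
    using u that by (auto simp: iso_def hom_def)
  have uadd: "u (\<lambda>i. x i + y i) = (\<lambda>i. u x i + u y i)"
    if "x \<in> carrier (Zlat n)" "y \<in> carrier (Zlat n)" for x y
    using u that by (auto simp: iso_def hom_def mult_Zlat)
  show "(\<lambda>x. (u (x(n := 0)))(n := x n)) \<in> hom (Zlat (Suc n)) (Zlat (Suc n))"
  proof (rule homI)
    fix x y assume x: "x \<in> carrier (Zlat (Suc n))" and y: "y \<in> carrier (Zlat (Suc n))"
    have "(\<lambda>i. x i + y i)(n := 0) = (\<lambda>i. (x(n := 0)) i + (y(n := 0)) i)" by auto
    then have "u ((\<lambda>i. x i + y i)(n := 0)) = (\<lambda>i. u (x(n := 0)) i + u (y(n := 0)) i)"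
      using uadd[OF c[OF x] c[OF y]] by (simp only:)
    then show "(u ((x \<otimes>\<^bsub>Zlat (Suc n)\<^esub> y)(n := 0)))(n := (x \<otimes>\<^bsub>Zlat (Suc n)\<^esub> y) n) =
      (u (x(n := 0)))(n := x n) \<otimes>\<^bsub>Zlat (Suc n)\<^esub> (u (y(n := 0)))(n := y n)"
      by (auto simp: mult_Zlat fun_eq_iff)
  qed (use c c' uc in blast)
  obtain w where w: "w \<in> iso (Zlat n) (Zlat n)" and wu: "\<And>x. x \<in> carrier (Zlat n) \<Longrightarrow> w (u x) = x"
    and uw: "\<And>x. x \<in> carrier (Zlat n) \<Longrightarrow> w x \<in> carrier (Zlat n) \<and> u (w x) = x"
    using iso_inverse[OF u group_Zlat] by metis
  have upd: "x(n := 0) = x" if "x \<in> carrier (Zlat n)" for x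
    using that by (auto simp: carrier_Zlat)
  show "bij_betw (\<lambda>x. (u (x(n := 0)))(n := x n)) (carrier (Zlat (Suc n))) (carrier (Zlat (Suc n)))"
    by (rule bij_betw_byWitness[where f' = "\<lambda>x. (w (x(n := 0)))(n := x n)"])
      (use c c' uc in \<open>auto simp: upd uw wu\<close>)
qed

text \<open>Smith normal form together with the uniqueness of invariant factors, for torsion quotients:
  the smallest invariant factor is the largest \<open>d\<close> with \<open>ker f \<subseteq> d\<int>\<^sup>n\<close>, and passing from \<open>A\<close> to \<open>dA\<close>
  lets one split off a basis vector.\<close>

theorem Zlat_epi_kernels_equivalent:
  assumes "comm_group A" "\<And>a. a \<in> carrier A \<Longrightarrow> \<exists>k::nat. k > 0 \<and> a [^]\<^bsub>A\<^esub> k = \<one>\<^bsub>A\<^esub>"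
    and "f \<in> epi (Zlat n) A" "g \<in> epi (Zlat n) A"
  shows "\<exists>u\<in>iso (Zlat n) (Zlat n). \<forall>x\<in>carrier (Zlat n). f x = \<one>\<^bsub>A\<^esub> \<longleftrightarrow> g (u x) = \<one>\<^bsub>A\<^esub>"
  using assms
proof (induction n arbitrary: A f g)
  case 0
  have c: "carrier (Zlat 0) = {\<one>\<^bsub>Zlat 0\<^esub>}" by (auto simp: carrier_Zlat one_Zlat)
  have "f \<one>\<^bsub>Zlat 0\<^esub> = \<one>\<^bsub>A\<^esub>" "g \<one>\<^bsub>Zlat 0\<^esub> = \<one>\<^bsub>A\<^esub>"
    using 0 by (auto simp: epi_def intro: hom_one[OF _ group_Zlat] comm_group.axioms)
  then show ?case using c by (intro bexI[of _ "\<lambda>x. x"]) (auto intro: iso_set_refl)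
next
  case (Suc n)
  let ?G = "Zlat (Suc n)"
  interpret A: comm_group A by (rule Suc.prems)
  interpret G: comm_group ?G by (rule comm_group_Zlat)
  have fh: "f \<in> hom ?G A" and fs: "f ` carrier ?G = carrier A" using Suc.prems by (auto simp: epi_def)
  have gh: "g \<in> hom ?G A" and gs: "g ` carrier ?G = carrier A" using Suc.prems by (auto simp: epi_def)
  \<comment> \<open>By the counting lemma the kernel of \<open>g\<close> defines the same set, so
    one maximal \<open>d\<close> serves both maps.\<close>
  define Ds where "Ds = {d::nat. d > 0 \<and> (\<forall>x\<in>carrier ?G. f x = \<one>\<^bsub>A\<^esub> \<longrightarrow> (\<forall>i. int d dvd x i))}"
  have Ds_g: "d \<in> Ds \<longleftrightarrow> d > 0 \<and> (\<forall>x\<in>carrier ?G. g x = \<one>\<^bsub>A\<^esub> \<longrightarrow> (\<forall>i. int d dvd x i))" for d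
    unfolding Ds_def mem_Collect_eq
    using kernel_content_independent[OF Suc.prems(1,3,4), of d]
      kernel_content_independent[OF Suc.prems(1,4,3), of d] by meson
  have e: "unit_vec 0 \<in> carrier ?G" by (simp add: unit_vec_in_Zlat)
  obtain k :: nat where k: "k > 0" "f (unit_vec 0) [^]\<^bsub>A\<^esub> k = \<one>\<^bsub>A\<^esub>"
    using Suc.prems(2)[of "f (unit_vec 0)"] fs e by blast
  \<comment> \<open>The \<open>k\<close>-fold basis vector lies in the kernel of \<open>f\<close>
    and has \<open>k\<close> as a coordinate; thus torsion of A bounds the candidates for
    \<open>d\<close>.\<close>
  have "Ds \<subseteq> {..k}"
  proof
    fix d assume d: "d \<in> Ds"
    have "f (unit_vec 0 [^]\<^bsub>?G\<^esub> k) = \<one>\<^bsub>A\<^esub>"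
      using k e by (simp add: hom_nat_pow_eq[OF G.is_group A.is_group fh])
    then have "int d dvd (unit_vec 0 [^]\<^bsub>?G\<^esub> k) 0" using d e G.nat_pow_closed unfolding Ds_def by blast
    then have "d dvd k" by (simp add: nat_pow_Zlat unit_vec_def)
    then show "d \<in> {..k}" using k by (simp add: dvd_imp_le)
  qed
  then have fin: "finite Ds" using finite_subset by blast
  have "1 \<in> Ds" by (auto simp: Ds_def)
  define d where "d = Max Ds"
  have d: "d \<in> Ds" unfolding d_def using fin \<open>1 \<in> Ds\<close> by (intro Max_in) auto
  then have "d > 0" by (auto simp: Ds_def)
  \<comment> \<open>This is dA. Since the kernel of \<open>f\<close> lies in dZ^n, it is d times the
    kernel of the map sending x to the d-th power of \<open>f x\<close>, and that map has values in
    dA.\<close>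
  define A0 where "A0 = A\<lparr>carrier := (\<lambda>a. a [^]\<^bsub>A\<^esub> d) ` carrier A\<rparr>"
  have sub: "subgroup ((\<lambda>a. a [^]\<^bsub>A\<^esub> d) ` carrier A) A" by (rule pow_image_subgroup[OF Suc.prems(1)])
  have A0: "comm_group A0" unfolding A0_def
    by (rule subgroup_comm_group[OF Suc.prems(1) sub])
  have tor: "\<exists>k::nat. k > 0 \<and> a [^]\<^bsub>A0\<^esub> k = \<one>\<^bsub>A0\<^esub>" if "a \<in> carrier A0" for a
  proof -
    have "a \<in> carrier A" using that by (auto simp: A0_def)
    then show ?thesis using Suc.prems(2)[of a] by (simp add: A0_def nat_pow_def)
  qed
  \<comment> \<open>To be applied to \<open>f\<close> and to \<open>g\<close>: after a suitable
    automorphism the d-th power map kills the last basis vector, hence factors through the first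
    \<open>n\<close> coordinates. This lowers the rank.\<close>
  have step: "\<exists>u\<in>iso ?G ?G. (\<lambda>x. k (u x) [^]\<^bsub>A\<^esub> d) \<in> epi (Zlat n) A0 \<and>
      (\<forall>x\<in>carrier ?G. k (u x) [^]\<^bsub>A\<^esub> d = \<one>\<^bsub>A\<^esub> \<longleftrightarrow> k (u (x(n := 0))) [^]\<^bsub>A\<^esub> d = \<one>\<^bsub>A\<^esub>)"
    if k: "k \<in> epi ?G A" and Dk: "\<And>d. d \<in> Ds \<longleftrightarrow> d > 0 \<and> (\<forall>x\<in>carrier ?G. k x = \<one>\<^bsub>A\<^esub> \<longrightarrow> (\<forall>i. int d dvd x i))"
    for k
  proof -
    have kh: "k \<in> hom ?G A" and ks: "k ` carrier ?G = carrier A" using k by (auto simp: epi_def)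
    have kc: "x \<in> carrier ?G \<Longrightarrow> k x \<in> carrier A" for x using ks by blast
    define L where "L = {x \<in> carrier ?G. k x [^]\<^bsub>A\<^esub> d = \<one>\<^bsub>A\<^esub>}"
    have L: "subgroup L ?G"
    proof (rule G.subgroupI)
      show "L \<noteq> {}" using hom_one[OF kh] by (auto simp: L_def intro!: exI[of _ "\<one>\<^bsub>?G\<^esub>"])
    qed (use kc in \<open>auto simp: L_def hom_mult[OF kh] hom_inv_eq[OF G.is_group A.is_group kh]
          A.nat_pow_inv A.pow_mult_distrib A.m_comm\<close>)
    \<comment> \<open>If \<open>L\<close> were contained in d'Z^n, the kernel of \<open>k\<close>,
      which is d times \<open>L\<close>, would lie in dd'Z^n, against the maximality of
      \<open>d\<close>.\<close>
    have "\<exists>x\<in>L. \<exists>i. \<not> d' dvd x i" if "d' > 1" for d' :: int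
    proof (rule ccontr)
      assume neg: "\<not> (\<exists>x\<in>L. \<exists>i. \<not> d' dvd x i)"
      have "d * nat d' \<in> Ds"
        unfolding Dk
      proof (intro conjI ballI impI allI)
        show "d * nat d' > 0" using \<open>d > 0\<close> that by simp
        fix x i assume x: "x \<in> carrier ?G" "k x = \<one>\<^bsub>A\<^esub>"
        then have dx: "int d dvd x i" for i using d Dk by blast
        define w where "w = (\<lambda>i. x i div int d)"
        have w: "w \<in> carrier ?G" using x by (auto simp: w_def carrier_Zlat)
        have xw: "x = w [^]\<^bsub>?G\<^esub> d" using dx by (auto simp: w_def nat_pow_Zlat fun_eq_iff)
        then have "w \<in> L" using x w by (simp add: L_def hom_nat_pow_eq[OF G.is_group A.is_group kh])
        then have "d' dvd w i" using neg by blast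
        then show "int (d * nat d') dvd x i" using that by (simp add: xw nat_pow_Zlat)
      qed
      then have "d * nat d' \<le> d" unfolding d_def using fin by simp
      then show False using \<open>d > 0\<close> that by simp
    qed
    then obtain u where u: "u \<in> iso ?G ?G" "u (unit_vec n) \<in> L"
      using content_one_unit_vec[OF L] by blast
    have uh: "u \<in> hom ?G ?G" and us: "u ` carrier ?G = carrier ?G"
      using u by (auto simp: iso_def bij_betw_def)
    have uc: "x \<in> carrier ?G \<Longrightarrow> u x \<in> carrier ?G" for x using us by blast
    define k' where "k' x = k (u x) [^]\<^bsub>A\<^esub> d" for x
    have k'mult: "k' (x \<otimes>\<^bsub>?G\<^esub> y) = k' x \<otimes>\<^bsub>A\<^esub> k' y" if "x \<in> carrier ?G" "y \<in> carrier ?G" for x y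
      using that uc kc by (simp add: k'_def hom_mult[OF uh] hom_mult[OF kh] A.pow_mult_distrib A.m_comm)
    have k'c: "k' x \<in> carrier A0" if "x \<in> carrier ?G" for x
      using that uc kc by (auto simp: k'_def A0_def)
    have A0A: "a \<in> carrier A0 \<Longrightarrow> a \<in> carrier A" for a by (auto simp: A0_def)
    have en: "unit_vec n \<in> carrier ?G" by (simp add: unit_vec_in_Zlat)
    have k'e: "k' (unit_vec n) = \<one>\<^bsub>A\<^esub>" using u by (simp add: k'_def L_def)
    have k'h: "k' \<in> hom ?G A" using k'mult k'c A0A by (auto simp: hom_def)
    have sub': "carrier (Zlat n) \<subseteq> carrier ?G" by (auto simp: carrier_Zlat)
    have upd: "x(n := 0) \<in> carrier (Zlat n)" "k' (x(n := 0)) = k' x" if x: "x \<in> carrier ?G" for x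
    proof -
      show c: "x(n := 0) \<in> carrier (Zlat n)" using x by (auto simp: carrier_Zlat Suc_le_eq)
      have "x = x(n := 0) \<otimes>\<^bsub>?G\<^esub> (unit_vec n [^]\<^bsub>?G\<^esub> (x n))"
        using en by (auto simp: mult_Zlat int_pow_Zlat unit_vec_def fun_eq_iff)
      then have "k' x = k' (x(n := 0) \<otimes>\<^bsub>?G\<^esub> (unit_vec n [^]\<^bsub>?G\<^esub> (x n)))" by simp
      also have "\<dots> = k' (x(n := 0)) \<otimes>\<^bsub>A\<^esub> k' (unit_vec n) [^]\<^bsub>A\<^esub> (x n)"
        using c sub' en by (subst k'mult) (auto simp: hom_int_pow_eq[OF G.is_group A.is_group k'h])
      also have "\<dots> = k' (x(n := 0))" using k'e k'c[of "x(n := 0)"] A0A c sub' by auto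
      finally show "k' (x(n := 0)) = k' x" by simp
    qed
    have "k' \<in> epi (Zlat n) A0"
      unfolding epi_iff_subset
    proof (intro conjI subsetI)
      show "k' \<in> hom (Zlat n) A0"
        using k'c k'mult sub' by (auto simp: hom_def A0_def mult_Zlat)
      fix a assume "a \<in> carrier A0"
      then obtain b where "b \<in> k ` carrier ?G" "a = b [^]\<^bsub>A\<^esub> d" unfolding ks by (auto simp: A0_def)
      then obtain z where z: "z \<in> carrier ?G" "a = k z [^]\<^bsub>A\<^esub> d" by blast
      then obtain x where x: "x \<in> carrier ?G" "z = u x" using us by blast
      then have "a = k' (x(n := 0))" using z upd by (simp add: k'_def)
      then show "a \<in> k' ` carrier (Zlat n)" using upd x by blast
    qed
    then show ?thesis using u upd unfolding k'_def by (intro bexI[of _ u]) auto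
  qed
  obtain u1 where u1: "u1 \<in> iso ?G ?G" "(\<lambda>x. f (u1 x) [^]\<^bsub>A\<^esub> d) \<in> epi (Zlat n) A0"
    "\<And>x. x \<in> carrier ?G \<Longrightarrow> f (u1 x) [^]\<^bsub>A\<^esub> d = \<one>\<^bsub>A\<^esub> \<longleftrightarrow> f (u1 (x(n := 0))) [^]\<^bsub>A\<^esub> d = \<one>\<^bsub>A\<^esub>"
    using step[OF Suc.prems(3)] unfolding Ds_def by blast
  obtain u2 where u2: "u2 \<in> iso ?G ?G" "(\<lambda>x. g (u2 x) [^]\<^bsub>A\<^esub> d) \<in> epi (Zlat n) A0"
    "\<And>x. x \<in> carrier ?G \<Longrightarrow> g (u2 x) [^]\<^bsub>A\<^esub> d = \<one>\<^bsub>A\<^esub> \<longleftrightarrow> g (u2 (x(n := 0))) [^]\<^bsub>A\<^esub> d = \<one>\<^bsub>A\<^esub>"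
    using step[OF Suc.prems(4) Ds_g] by blast
  obtain v where v: "v \<in> iso (Zlat n) (Zlat n)"
    "\<And>x. x \<in> carrier (Zlat n) \<Longrightarrow> f (u1 x) [^]\<^bsub>A\<^esub> d = \<one>\<^bsub>A\<^esub> \<longleftrightarrow> g (u2 (v x)) [^]\<^bsub>A\<^esub> d = \<one>\<^bsub>A\<^esub>"
    using Suc.IH[OF A0 tor u1(2) u2(2)] by (auto simp: A0_def)
  define v' where "v' = (\<lambda>x. (v (x(n := 0)))(n := x n))"
  have v': "v' \<in> iso ?G ?G" unfolding v'_def by (rule extend_iso_Zlat[OF v(1)])
  define w where "w = inv_into (carrier ?G) u1"
  have w: "w \<in> iso ?G ?G" unfolding w_def by (rule G.iso_set_sym[OF u1(1)])
  define u where "u x = u2 (v' (w x))" for x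
  have u: "u \<in> iso ?G ?G" unfolding u_def using iso_comp[OF iso_comp[OF w v'] u2(1)] .
  have uh: "u \<in> hom ?G ?G" and us: "u ` carrier ?G = carrier ?G"
    using u by (auto simp: iso_def bij_betw_def)
  \<comment> \<open>\<open>u\<close> undoes \<open>u1\<close>, applies the extension of
    \<open>v\<close>, then \<open>u2\<close>. Both conditions ignore the last coordinate in these
    coordinates, so the rank \<open>n\<close> statement about \<open>v\<close> decides.\<close>
  have key: "f x [^]\<^bsub>A\<^esub> d = \<one>\<^bsub>A\<^esub> \<longleftrightarrow> g (u x) [^]\<^bsub>A\<^esub> d = \<one>\<^bsub>A\<^esub>" if x: "x \<in> carrier ?G" for x
  proof -
    have wx: "w x \<in> carrier ?G" using w x by (auto simp: iso_def hom_def)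
    have vx: "v' (w x) \<in> carrier ?G" using v' wx by (auto simp: iso_def hom_def)
    have c: "(w x)(n := 0) \<in> carrier (Zlat n)" using wx by (auto simp: carrier_Zlat Suc_le_eq)
    then have "v ((w x)(n := 0)) \<in> carrier (Zlat n)" using v by (auto simp: iso_def hom_def)
    then have eq: "(v' (w x))(n := 0) = v ((w x)(n := 0))" by (auto simp: v'_def carrier_Zlat)
    have "u1 (w x) = x" using u1(1) x unfolding w_def iso_def
      by (metis (no_types, lifting) bij_betw_inv_into_right mem_Collect_eq IntD2)
    then show ?thesis using u1(3)[OF wx] v(2)[OF c] u2(3)[OF vx] eq by (simp add: u_def)
  qed
  have div: "\<exists>w\<in>carrier ?G. x = w [^]\<^bsub>?G\<^esub> d" if "x \<in> carrier ?G" "\<And>i. int d dvd x i" for x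
    using that by (intro bexI[of _ "\<lambda>i. x i div int d"]) (auto simp: nat_pow_Zlat carrier_Zlat fun_eq_iff)
  \<comment> \<open>Divide by d, use \<open>key\<close>, multiply by d again: the kernels of
    \<open>f\<close> and \<open>g\<close> are d times the two subgroups compared there.\<close>
  show ?case
  proof (intro bexI[OF _ u] ballI iffI)
    fix x assume x: "x \<in> carrier ?G" and "f x = \<one>\<^bsub>A\<^esub>"
    then obtain w where w: "w \<in> carrier ?G" "x = w [^]\<^bsub>?G\<^esub> d" using div d unfolding Ds_def by blast
    then have "f w [^]\<^bsub>A\<^esub> d = \<one>\<^bsub>A\<^esub>"
      using \<open>f x = _\<close> by (simp add: hom_nat_pow_eq[OF G.is_group A.is_group fh])
    then have "g (u w) [^]\<^bsub>A\<^esub> d = \<one>\<^bsub>A\<^esub>" using key w by blast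
    then show "g (u x) = \<one>\<^bsub>A\<^esub>" using w us
      by (simp add: hom_nat_pow_eq[OF G.is_group A.is_group gh] hom_nat_pow_eq[OF G.is_group G.is_group uh] hom_in_carrier[OF uh])
  next
    fix x assume x: "x \<in> carrier ?G" and gx: "g (u x) = \<one>\<^bsub>A\<^esub>"
    have ux: "u x \<in> carrier ?G" using x us by blast
    then obtain w' where w': "w' \<in> carrier ?G" "u x = w' [^]\<^bsub>?G\<^esub> d"
      using div[OF ux] d gx Ds_g by blast
    then obtain w where w: "w \<in> carrier ?G" "w' = u w" using us by blast
    have "u x = u (w [^]\<^bsub>?G\<^esub> d)" using w w' by (simp add: hom_nat_pow_eq[OF G.is_group G.is_group uh])
    moreover have "inj_on u (carrier ?G)" using u by (simp add: iso_def bij_betw_def)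
    ultimately have xw: "x = w [^]\<^bsub>?G\<^esub> d" using x w by (metis G.nat_pow_closed inj_onD)
    have "g (u w) [^]\<^bsub>A\<^esub> d = \<one>\<^bsub>A\<^esub>" using gx w w'
      by (simp add: hom_nat_pow_eq[OF G.is_group A.is_group gh])
    then have "f w [^]\<^bsub>A\<^esub> d = \<one>\<^bsub>A\<^esub>" using key w by blast
    then show "f x = \<one>\<^bsub>A\<^esub>" using w by (simp add: xw hom_nat_pow_eq[OF G.is_group A.is_group fh])
  qed
qed

section \<open>Lattices and their duals\<close>

lemma hom_integer_groupD:
  assumes "\<phi> \<in> hom G integer_group" "x \<in> carrier G" "y \<in> carrier G"
  shows "\<phi> (x \<otimes>\<^bsub>G\<^esub> y) = \<phi> x + \<phi> y"
  using hom_mult[OF assms] by simp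

lemma int_pow_integer_group: "a [^]\<^bsub>integer_group\<^esub> (k::int) = k * a"
proof -
  have *: "a [^]\<^bsub>integer_group\<^esub> (m::nat) = int m * a" for m
    by (induction m) (auto simp: algebra_simps)
  show ?thesis by (auto simp: int_pow_def2 *)
qed

lemma hom_integer_group_int_pow:
  assumes "group G" "\<phi> \<in> hom G integer_group" "x \<in> carrier G"
  shows "\<phi> (x [^]\<^bsub>G\<^esub> (k::int)) = k * \<phi> x"
  using hom_int_pow_eq[OF assms(1) group_integer_group assms(2,3)] by (simp add: int_pow_integer_group)

lemma hom_integer_group_nat_pow:
  assumes "group G" "\<phi> \<in> hom G integer_group" "x \<in> carrier G"
  shows "\<phi> (x [^]\<^bsub>G\<^esub> (k::nat)) = int k * \<phi> x"
  using hom_integer_group_int_pow[OF assms, of "int k"] by (simp add: int_pow_int)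

lemma hom_integer_group_inv:
  assumes "group G" "\<phi> \<in> hom G integer_group" "x \<in> carrier G"
  shows "\<phi> (inv\<^bsub>G\<^esub> x) = - \<phi> x"
  using hom_inv_eq[OF assms(1) group_integer_group assms(2,3)] by simp

lemma hom_integer_group_one:
  assumes "group G" "\<phi> \<in> hom G integer_group"
  shows "\<phi> \<one>\<^bsub>G\<^esub> = 0"
  using hom_one[OF assms(2,1) group_integer_group] by simp

text \<open>Subgroups of Z^n are free. The kernel of the last coordinate is free by induction; if
  that coordinate is not identically zero, its image is dZ, and a preimage \<open>g\<close> of d
  splits off one more coordinate.\<close>

lemma injective_hom_Zlat_iso:
  assumes "comm_group G" "\<phi> \<in> hom G (Zlat n)" "inj_on \<phi> (carrier G)"
  shows "\<exists>m \<theta>. \<theta> \<in> iso G (Zlat m)"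
  using assms
proof (induction n arbitrary: G \<phi>)
  case 0
  interpret G: comm_group G by fact
  from 0 have "\<phi> ` carrier G \<subseteq> carrier (Zlat 0)" by (auto simp: hom_def)
  moreover have "carrier (Zlat 0) = {\<one>\<^bsub>Zlat 0\<^esub>}" by (auto simp: carrier_Zlat one_Zlat)
  moreover have "\<phi> \<one>\<^bsub>G\<^esub> = \<one>\<^bsub>Zlat 0\<^esub>" "\<one>\<^bsub>G\<^esub> \<in> carrier G"
    using hom_one[OF 0(2) G.is_group group_Zlat] by auto
  ultimately have "\<phi> ` carrier G = carrier (Zlat 0)"
    by (metis empty_iff image_is_empty subset_singletonD)
  then have "\<phi> \<in> iso G (Zlat 0)" using 0 by (simp add: iso_def bij_betw_def)
  then show ?case by blast
next
  case (Suc n)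
  interpret G: comm_group G by fact
  define l where "l x = \<phi> x n" for x
  have l: "l \<in> hom G integer_group" using Suc.prems(2) by (auto simp: hom_def l_def mult_Zlat)
  have lm: "x \<in> carrier G \<Longrightarrow> y \<in> carrier G \<Longrightarrow> l (x \<otimes>\<^bsub>G\<^esub> y) = l x + l y" for x y
    using hom_integer_groupD[OF l] by blast
  note lp = hom_integer_group_int_pow[OF G.is_group l]
  note li = hom_integer_group_inv[OF G.is_group l]
  define H where "H = {x \<in> carrier G. l x = 0}"
  have H: "subgroup H G"
  proof (rule G.subgroupI)
    show "H \<noteq> {}" using hom_integer_group_one[OF G.is_group l] by (auto simp: H_def)
  qed (auto simp: H_def lm li)
  have HG: "comm_group (G\<lparr>carrier := H\<rparr>)" using subgroup_comm_group[OF Suc.prems(1) H] .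
  have "\<phi> \<in> hom (G\<lparr>carrier := H\<rparr>) (Zlat n)"
    using Suc.prems(2) by (auto simp: hom_def H_def l_def carrier_Zlat mult_Zlat)
      (metis (mono_tags, lifting) Pi_mem Suc_leI le_neq_implies_less mem_Collect_eq)
  moreover have "inj_on \<phi> (carrier (G\<lparr>carrier := H\<rparr>))"
    using Suc.prems(3) by (auto simp: H_def inj_on_def)
  ultimately obtain m \<theta> where \<theta>: "\<theta> \<in> iso (G\<lparr>carrier := H\<rparr>) (Zlat m)" using Suc.IH[OF HG] by blast
  show ?case
  proof (cases "\<forall>x\<in>carrier G. l x = 0")
    case True
    then have "H = carrier G" by (auto simp: H_def)
    then show ?thesis using \<theta> by auto
  next
    case False
    define P where "P k \<longleftrightarrow> k > 0 \<and> (\<exists>x\<in>carrier G. l x = int k)" for k :: nat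
    obtain x0 where x0: "x0 \<in> carrier G" "l x0 \<noteq> 0" using False by blast
    have "P (nat \<bar>l x0\<bar>)"
    proof (cases "l x0 > 0")
      case True then show ?thesis using x0 by (auto simp: P_def)
    next
      case False
      then show ?thesis using x0 by (auto simp: P_def li intro!: bexI[of _ "inv\<^bsub>G\<^esub> x0"])
    qed
    then have ex: "\<exists>k. P k" by blast
    define d where "d = (LEAST k. P k)"
    have "P d" unfolding d_def by (rule LeastI_ex) fact
    then obtain g where g: "g \<in> carrier G" "l g = int d" and "d > 0" by (auto simp: P_def)
    have dvd: "int d dvd l x" if x: "x \<in> carrier G" for x
    proof (rule ccontr)
      assume "\<not> int d dvd l x"
      then have pos: "l x mod int d > 0" using \<open>d > 0\<close>
        by (metis dvd_eq_mod_eq_0 of_nat_0_less_iff order_le_less pos_mod_sign)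
      define y where "y = x \<otimes>\<^bsub>G\<^esub> (g [^]\<^bsub>G\<^esub> (- (l x div int d)))"
      have "y \<in> carrier G" using x g by (simp add: y_def)
      moreover have "l y = l x mod int d"
        using x g by (simp add: y_def lm lp minus_div_mult_eq_mod)
      ultimately have "P (nat (l x mod int d))" using pos by (auto simp: P_def)
      then have "d \<le> nat (l x mod int d)" unfolding d_def by (rule Least_le)
      then show False using \<open>d > 0\<close> pos
        by (metis le_nat_iff not_le of_nat_0_less_iff order_le_less pos_mod_bound)
    qed
    define k where "k x = l x div int d" for x
    have lk: "l x = k x * int d" if "x \<in> carrier G" for x using dvd[OF that] by (simp add: k_def)
    \<comment> \<open>The projection onto \<open>H\<close> along \<open>g\<close>; together with the
      coefficient \<open>k x\<close> it gives the new coordinates of \<open>x\<close>.\<close>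
    define r where "r x = x \<otimes>\<^bsub>G\<^esub> (g [^]\<^bsub>G\<^esub> (- k x))" for x
    have kadd: "k (x \<otimes>\<^bsub>G\<^esub> y) = k x + k y" if "x \<in> carrier G" "y \<in> carrier G" for x y
      using dvd that by (simp add: k_def lm div_plus_div_distrib_dvd_left)
    have rH: "r x \<in> H" if "x \<in> carrier G" for x
      using that g lk[OF that] by (simp add: r_def H_def lm lp)
    have radd: "r (x \<otimes>\<^bsub>G\<^esub> y) = r x \<otimes>\<^bsub>G\<^esub> r y" if "x \<in> carrier G" "y \<in> carrier G" for x y
    proof -
      have "g [^]\<^bsub>G\<^esub> (- k (x \<otimes>\<^bsub>G\<^esub> y)) = g [^]\<^bsub>G\<^esub> (- k x) \<otimes>\<^bsub>G\<^esub> g [^]\<^bsub>G\<^esub> (- k y)"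
        using kadd[OF that] g by (simp add: G.int_pow_mult[symmetric])
      then show ?thesis using that g by (simp add: r_def G.m_ac)
    qed
    have xr: "x = r x \<otimes>\<^bsub>G\<^esub> (g [^]\<^bsub>G\<^esub> k x)" if "x \<in> carrier G" for x
      using that g by (simp add: r_def G.m_assoc G.int_pow_neg)
    have th: "\<theta> \<in> hom (G\<lparr>carrier := H\<rparr>) (Zlat m)" and tb: "bij_betw \<theta> H (carrier (Zlat m))"
      using \<theta> by (auto simp: iso_def)
    have tc: "\<theta> x m = 0" if "x \<in> H" for x
      using th that by (auto simp: hom_def carrier_Zlat)
    define \<Theta> where "\<Theta> x = (\<theta> (r x))(m := k x)" for x
    have "\<Theta> \<in> iso G (Zlat (Suc m))"
    proof (rule isoI)
      show "\<Theta> \<in> hom G (Zlat (Suc m))"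
      proof (rule homI)
        fix x assume "x \<in> carrier G"
        then have "\<theta> (r x) \<in> carrier (Zlat m)" using rH th by (auto simp: hom_def)
        then show "\<Theta> x \<in> carrier (Zlat (Suc m))" by (auto simp: \<Theta>_def carrier_Zlat)
      next
        fix x y assume "x \<in> carrier G" "y \<in> carrier G"
        then have "\<theta> (r (x \<otimes>\<^bsub>G\<^esub> y)) = (\<lambda>i. \<theta> (r x) i + \<theta> (r y) i)"
          using hom_mult[OF th, of "r x" "r y"] rH radd by (simp add: mult_Zlat)
        then show "\<Theta> (x \<otimes>\<^bsub>G\<^esub> y) = \<Theta> x \<otimes>\<^bsub>Zlat (Suc m)\<^esub> \<Theta> y"
          using kadd \<open>x \<in> carrier G\<close> \<open>y \<in> carrier G\<close> by (auto simp: \<Theta>_def mult_Zlat)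
      qed
      show "bij_betw \<Theta> (carrier G) (carrier (Zlat (Suc m)))"
        unfolding bij_betw_def
      proof
        show "inj_on \<Theta> (carrier G)"
        proof (rule inj_onI)
          fix x y assume x: "x \<in> carrier G" and y: "y \<in> carrier G" and eq: "\<Theta> x = \<Theta> y"
          have kk: "k x = k y" using eq by (auto simp: \<Theta>_def dest: fun_cong[of _ _ m])
          have "\<theta> (r x) i = \<theta> (r y) i" for i
            using fun_cong[OF eq, of i] tc rH x y by (cases "i = m") (auto simp: \<Theta>_def)
          then have "\<theta> (r x) = \<theta> (r y)" by auto
          then have "r x = r y" using tb rH x y by (auto simp: bij_betw_def dest: inj_onD)
          then show "x = y" using xr x y kk by metis
        qed
        show "\<Theta> ` carrier G = carrier (Zlat (Suc m))"
        proof (intro equalityI subsetI)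
          fix v assume "v \<in> \<Theta> ` carrier G"
          then show "v \<in> carrier (Zlat (Suc m))" using \<open>\<Theta> \<in> hom G (Zlat (Suc m))\<close> by (auto simp: hom_def)
        next
          fix v assume v: "v \<in> carrier (Zlat (Suc m))"
          then have "v(m := 0) \<in> carrier (Zlat m)" by (auto simp: carrier_Zlat Suc_le_eq)
          then obtain w where w: "w \<in> H" "\<theta> w = v(m := 0)" using tb by (metis bij_betw_def imageE)
          have wG: "w \<in> carrier G" "l w = 0" using w by (auto simp: H_def)
          define x where "x = w \<otimes>\<^bsub>G\<^esub> (g [^]\<^bsub>G\<^esub> v m)"
          have x: "x \<in> carrier G" using wG g by (simp add: x_def)
          have "l x = v m * int d" using wG g by (simp add: x_def lm lp)
          then have kx: "k x = v m" using \<open>d > 0\<close> by (simp add: k_def)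
          have "r x = x \<otimes>\<^bsub>G\<^esub> (g [^]\<^bsub>G\<^esub> (- v m))" by (simp add: r_def kx)
          also have "\<dots> = w" using wG g by (simp add: x_def G.m_assoc G.int_pow_neg)
          finally have "r x = w" .
          then have "\<Theta> x = v" using w kx by (auto simp: \<Theta>_def)
          then show "v \<in> \<Theta> ` carrier G" using x by blast
        qed
      qed
    qed
    then show ?thesis by blast
  qed
qed

lemma lattice_DirProd:
  assumes G: "lattice G" and H: "lattice H"
  shows "lattice (G \<times>\<times> H)"
proof -
  interpret G: comm_group G using G by (simp add: lattice_def)
  interpret H: comm_group H using H by (simp add: lattice_def)
  interpret GH: group "G \<times>\<times> H" by (rule DirProd_group) unfold_locales
  have c: "comm_group (G \<times>\<times> H)"
    by (rule GH.group_comm_groupI) (auto simp: G.m_comm H.m_comm)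
  obtain n \<theta> where \<theta>: "\<theta> \<in> iso G (Zlat n)" using G by (auto simp: lattice_def)
  obtain m \<eta> where \<eta>: "\<eta> \<in> iso H (Zlat m)" using H by (auto simp: lattice_def)
  have tc: "\<theta> x \<in> carrier (Zlat n)" if "x \<in> carrier G" for x using \<theta> that by (auto simp: iso_def hom_def)
  have ec: "\<eta> x \<in> carrier (Zlat m)" if "x \<in> carrier H" for x using \<eta> that by (auto simp: iso_def hom_def)
  have tm: "\<theta> (x \<otimes>\<^bsub>G\<^esub> y) = (\<lambda>i. \<theta> x i + \<theta> y i)" if "x \<in> carrier G" "y \<in> carrier G" for x y
    using \<theta> that by (auto simp: iso_def hom_def mult_Zlat)
  have em: "\<eta> (x \<otimes>\<^bsub>H\<^esub> y) = (\<lambda>i. \<eta> x i + \<eta> y i)" if "x \<in> carrier H" "y \<in> carrier H" for x y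
    using \<eta> that by (auto simp: iso_def hom_def mult_Zlat)
  \<comment> \<open>Concatenated coordinates. Injectivity into Z^(n+m) is enough, because freeness
    then comes from \<open>injective_hom_Zlat_iso\<close>.\<close>
  define \<phi> where "\<phi> z = (\<lambda>i. if i < n then \<theta> (fst z) i else \<eta> (snd z) (i - n))" for z
  have "\<phi> \<in> hom (G \<times>\<times> H) (Zlat (n + m))"
  proof (rule homI)
    fix z assume "z \<in> carrier (G \<times>\<times> H)"
    then show "\<phi> z \<in> carrier (Zlat (n + m))"
      using ec[of "snd z"] by (auto simp: \<phi>_def carrier_Zlat)
  next
    fix x y assume "x \<in> carrier (G \<times>\<times> H)" "y \<in> carrier (G \<times>\<times> H)"
    then show "\<phi> (x \<otimes>\<^bsub>G \<times>\<times> H\<^esub> y) = \<phi> x \<otimes>\<^bsub>Zlat (n + m)\<^esub> \<phi> y"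
      by (cases x; cases y) (auto simp: \<phi>_def mult_Zlat tm em)
  qed
  moreover have "inj_on \<phi> (carrier (G \<times>\<times> H))"
  proof (rule inj_onI)
    fix x y assume x: "x \<in> carrier (G \<times>\<times> H)" and y: "y \<in> carrier (G \<times>\<times> H)" and eq: "\<phi> x = \<phi> y"
    obtain x1 x2 y1 y2 where xy: "x = (x1, x2)" "y = (y1, y2)" by (cases x; cases y)
    have "\<theta> x1 i = \<theta> y1 i" for i
      using fun_cong[OF eq, of i] tc[of x1] tc[of y1] x y
      by (cases "i < n") (auto simp: \<phi>_def xy carrier_Zlat)
    then have "\<theta> x1 = \<theta> y1" by auto
    then have 1: "x1 = y1" using \<theta> x y by (auto simp: iso_def bij_betw_def xy dest: inj_onD)
    have "\<eta> x2 i = \<eta> y2 i" for i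
      using fun_cong[OF eq, of "i + n"] by (auto simp: \<phi>_def xy)
    then have "\<eta> x2 = \<eta> y2" by auto
    then have 2: "x2 = y2" using \<eta> x y by (auto simp: iso_def bij_betw_def xy dest: inj_onD)
    show "x = y" using 1 2 xy by simp
  qed
  ultimately show ?thesis using injective_hom_Zlat_iso[OF c] c by (auto simp: lattice_def)
qed

lemma lattice_subgroup:
  assumes G: "lattice G" and H: "subgroup H G"
  shows "lattice (G\<lparr>carrier := H\<rparr>)"
proof -
  have c: "comm_group (G\<lparr>carrier := H\<rparr>)" using assms subgroup_comm_group by (auto simp: lattice_def)
  obtain n \<theta> where \<theta>: "\<theta> \<in> iso G (Zlat n)" using G by (auto simp: lattice_def)
  have "H \<subseteq> carrier G" using H subgroup.subset by blast
  then have "\<theta> \<in> hom (G\<lparr>carrier := H\<rparr>) (Zlat n)" "inj_on \<theta> (carrier (G\<lparr>carrier := H\<rparr>))"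
    using \<theta> by (auto simp: iso_def hom_def bij_betw_def subset_iff intro: inj_on_subset)
  then show ?thesis using injective_hom_Zlat_iso[OF c] c by (auto simp: lattice_def)
qed

section \<open>Z^n as its own dual\<close>

lemma lattice_Zlat: "lattice (Zlat n)"
  using comm_group_Zlat iso_set_refl by (auto simp: lattice_def)

definition dot :: "nat \<Rightarrow> (nat \<Rightarrow> int) \<Rightarrow> (nat \<Rightarrow> int) \<Rightarrow> int" where
  "dot n v w = (\<Sum>i<n. v i * w i)"

lemma dot_commute: "dot n v w = dot n w v"
  by (simp add: dot_def mult.commute)

lemma dot_hom: "(\<lambda>v. dot n v w) \<in> hom (Zlat n) integer_group"
  by (auto simp: hom_def dot_def mult_Zlat algebra_simps sum.distrib)

lemma dot_hom_right: "dot n v \<in> hom (Zlat n) integer_group"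
  by (auto simp: hom_def dot_def mult_Zlat algebra_simps sum.distrib)

lemma dot_unit_vec: "k < n \<Longrightarrow> dot n (unit_vec k) w = w k"
  by (simp add: dot_def unit_vec_def if_distrib[of "\<lambda>x. x * _"] sum.delta cong: if_cong)

text \<open>Coordinate i of the representing vector is forced to be the value of \<phi> at the i-th
  unit vector. This supplies both perfectness conditions for the concrete data on Z^n.\<close>

lemma hom_Zlat_eq_dot:
  assumes \<phi>: "\<phi> \<in> hom (Zlat n) integer_group"
  shows "\<exists>!w. w \<in> carrier (Zlat n) \<and> (\<forall>v\<in>carrier (Zlat n). dot n v w = \<phi> v)"
proof
  define w where "w = (\<lambda>i. if i < n then \<phi> (unit_vec i) else 0)"
  \<comment> \<open>The induction runs over the number \<open>m\<close> of possibly nonzero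
    coordinates while \<open>n\<close> stays fixed, so \<phi> keeps its domain.\<close>
  have *: "\<phi> v = dot m v w" if "m \<le> n" "v \<in> carrier (Zlat m)" for m v
    using that
  proof (induction m arbitrary: v)
    case 0
    then have "v = \<one>\<^bsub>Zlat n\<^esub>" by (auto simp: carrier_Zlat one_Zlat)
    then show ?case using hom_integer_group_one[OF group_Zlat \<phi>] by (simp add: dot_def)
  next
    case (Suc m)
    have c: "v(m := 0) \<in> carrier (Zlat m)" using Suc.prems by (auto simp: carrier_Zlat Suc_le_eq)
    have c': "v(m := 0) \<in> carrier (Zlat n)" using Suc.prems by (auto simp: carrier_Zlat)
    have e: "unit_vec m \<in> carrier (Zlat n)" using Suc.prems by (intro unit_vec_in_Zlat) simp
    have "v = v(m := 0) \<otimes>\<^bsub>Zlat n\<^esub> (unit_vec m [^]\<^bsub>Zlat n\<^esub> v m)"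
      using e by (auto simp: mult_Zlat int_pow_Zlat unit_vec_def fun_eq_iff)
    then have "\<phi> v = \<phi> (v(m := 0) \<otimes>\<^bsub>Zlat n\<^esub> (unit_vec m [^]\<^bsub>Zlat n\<^esub> v m))" by simp
    also have "\<dots> = \<phi> (v(m := 0)) + v m * \<phi> (unit_vec m)"
      using c' e by (subst hom_integer_groupD[OF \<phi>])
        (auto simp: hom_integer_group_int_pow[OF group_Zlat \<phi>] group.int_pow_closed[OF group_Zlat])
    also have "\<dots> = dot m (v(m := 0)) w + v m * w m" 
      using Suc.IH[OF _ c] Suc.prems by (simp add: w_def del: fun_upd_apply)
    also have "\<dots> = dot (Suc m) v w" by (simp add: dot_def)
    finally show ?case .
  qed
  show "w \<in> carrier (Zlat n) \<and> (\<forall>v\<in>carrier (Zlat n). dot n v w = \<phi> v)"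
    using *[OF order_refl] by (simp add: carrier_Zlat) (simp add: w_def)
  fix w' assume w': "w' \<in> carrier (Zlat n) \<and> (\<forall>v\<in>carrier (Zlat n). dot n v w' = \<phi> v)"
  show "w' = w"
  proof
    fix i show "w' i = w i"
      using w' unit_vec_in_Zlat[of i n] dot_unit_vec[of i n w']
      by (cases "i < n") (auto simp: w_def carrier_Zlat)
  qed
qed

section \<open>Finite reflection data in a perfect pairing\<close>

text \<open>Nondegeneracy and reflections are imposed on both sides symmetrically, so that a result
  about coroots can be flipped into one about roots.\<close>

locale root_pairing =
  fixes P :: "'a monoid" and Q :: "'b monoid" (structure) and e :: "'a \<Rightarrow> 'b \<Rightarrow> int"
    and \<Phi> :: "'a set" and c :: "'a \<Rightarrow> 'b"
  assumes P: "comm_group P" and Q: "comm_group Q"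
    and e_left: "x \<in> carrier P \<Longrightarrow> e x \<in> hom Q integer_group"
    and e_right: "y \<in> carrier Q \<Longrightarrow> (\<lambda>x. e x y) \<in> hom P integer_group"
    and nondeg_P: "x \<in> carrier P \<Longrightarrow> \<forall>y\<in>carrier Q. e x y = 0 \<Longrightarrow> x = \<one>\<^bsub>P\<^esub>"
    and nondeg_Q: "y \<in> carrier Q \<Longrightarrow> \<forall>x\<in>carrier P. e x y = 0 \<Longrightarrow> y = \<one>"
    and roots: "\<Phi> \<subseteq> carrier P" "finite \<Phi>"
    and coroots: "c ` \<Phi> \<subseteq> carrier Q" "inj_on c \<Phi>"
    and two: "\<alpha> \<in> \<Phi> \<Longrightarrow> e \<alpha> (c \<alpha>) = 2"
    and reflection: "\<alpha> \<in> \<Phi> \<Longrightarrow> (\<lambda>x. x \<otimes>\<^bsub>P\<^esub> inv\<^bsub>P\<^esub> (\<alpha> [^]\<^bsub>P\<^esub> e x (c \<alpha>))) ` \<Phi> = \<Phi>"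
    and coreflection:
      "\<alpha> \<in> \<Phi> \<Longrightarrow> (\<lambda>y. y \<otimes> inv (c \<alpha> [^] e \<alpha> y)) ` c ` \<Phi> = c ` \<Phi>"

text \<open>The duality of the setting: the coroots become the roots, and the inverse of
  \<open>c\<close> assigns to each of them its partner.\<close>

lemma root_pairing_flip:
  assumes "root_pairing P Q e \<Phi> c"
  shows "root_pairing Q P (\<lambda>y x. e x y) (c ` \<Phi>) (inv_into \<Phi> c)"
proof -
  interpret root_pairing P Q e \<Phi> c by fact
  have inv: "inv_into \<Phi> c ` c ` \<Phi> = \<Phi>" "\<And>\<alpha>. \<alpha> \<in> \<Phi> \<Longrightarrow> inv_into \<Phi> c (c \<alpha>) = \<alpha>"
    using coroots(2) by (auto intro: inv_into_f_f)
  show ?thesis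
  proof (rule root_pairing.intro)
    fix y assume "y \<in> c ` \<Phi>"
    then obtain \<alpha> where \<alpha>: "\<alpha> \<in> \<Phi>" "y = c \<alpha>" by blast
    show "(\<lambda>x. x \<otimes>\<^bsub>Q\<^esub> inv\<^bsub>Q\<^esub> (y [^]\<^bsub>Q\<^esub> e (inv_into \<Phi> c y) x)) ` c ` \<Phi> = c ` \<Phi>"
      using coreflection[OF \<alpha>(1)] \<alpha> inv by simp
    show "(\<lambda>x. x \<otimes>\<^bsub>P\<^esub> inv\<^bsub>P\<^esub> (inv_into \<Phi> c y [^]\<^bsub>P\<^esub> e x y)) ` inv_into \<Phi> c ` c ` \<Phi> =
        inv_into \<Phi> c ` c ` \<Phi>"
      unfolding inv(1) using reflection[OF \<alpha>(1)] \<alpha> inv(2) by simp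
  qed (use P Q e_left e_right nondeg_P nondeg_Q roots coroots two inv in \<open>auto simp: inj_on_inv_into\<close>)
qed

section \<open>The invariant form and the rational splitting it gives\<close>

context root_pairing
begin

interpretation P: comm_group P by (rule P)
interpretation Q: comm_group Q by (rule Q)

lemma e_mult_left: "x \<in> carrier P \<Longrightarrow> x' \<in> carrier P \<Longrightarrow> y \<in> carrier Q \<Longrightarrow> e (x \<otimes>\<^bsub>P\<^esub> x') y = e x y + e x' y"
  using hom_integer_groupD[OF e_right] by blast

lemma e_mult_right: "x \<in> carrier P \<Longrightarrow> y \<in> carrier Q \<Longrightarrow> y' \<in> carrier Q \<Longrightarrow> e x (y \<otimes> y') = e x y + e x y'"
  using hom_integer_groupD[OF e_left] by blast

lemma e_inv_left: "x \<in> carrier P \<Longrightarrow> y \<in> carrier Q \<Longrightarrow> e (inv\<^bsub>P\<^esub> x) y = - e x y"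
  using hom_integer_group_inv[OF P.is_group e_right] by blast

lemma e_inv_right: "x \<in> carrier P \<Longrightarrow> y \<in> carrier Q \<Longrightarrow> e x (inv y) = - e x y"
  using hom_integer_group_inv[OF Q.is_group e_left] by blast

lemma e_pow_left: "x \<in> carrier P \<Longrightarrow> y \<in> carrier Q \<Longrightarrow> e (x [^]\<^bsub>P\<^esub> (k::int)) y = k * e x y"
  using hom_integer_group_int_pow[OF P.is_group e_right] by blast

lemma e_pow_right: "x \<in> carrier P \<Longrightarrow> y \<in> carrier Q \<Longrightarrow> e x (y [^] (k::int)) = k * e x y"
  using hom_integer_group_int_pow[OF Q.is_group e_left] by blast

lemma e_nat_pow_left: "x \<in> carrier P \<Longrightarrow> y \<in> carrier Q \<Longrightarrow> e (x [^]\<^bsub>P\<^esub> (k::nat)) y = int k * e x y"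
  using hom_integer_group_nat_pow[OF P.is_group e_right] by blast

lemma e_nat_pow_right: "x \<in> carrier P \<Longrightarrow> y \<in> carrier Q \<Longrightarrow> e x (y [^] (k::nat)) = int k * e x y"
  using hom_integer_group_nat_pow[OF Q.is_group e_left] by blast

lemma e_one_left: "y \<in> carrier Q \<Longrightarrow> e \<one>\<^bsub>P\<^esub> y = 0"
  using hom_integer_group_one[OF P.is_group e_right] by blast

lemma e_one_right: "x \<in> carrier P \<Longrightarrow> e x \<one> = 0"
  using hom_integer_group_one[OF Q.is_group e_left] by blast

lemmas e_simps = e_mult_left e_mult_right e_inv_left e_inv_right e_pow_left e_pow_right
  e_nat_pow_left e_nat_pow_right e_one_left e_one_right

lemma root_in: "\<alpha> \<in> \<Phi> \<Longrightarrow> \<alpha> \<in> carrier P"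
  using roots by blast

lemma coroot_in: "\<alpha> \<in> \<Phi> \<Longrightarrow> c \<alpha> \<in> carrier Q"
  using coroots by blast

lemma generate_vanish:
  assumes "z \<in> generate Q S" "S \<subseteq> carrier Q" "x \<in> carrier P" "\<And>y. y \<in> S \<Longrightarrow> e x y = 0"
  shows "e x z = 0"
  using assms(1)
proof (induction z rule: generate.induct)
  case (eng a b)
  then show ?case using Q.generate_in_carrier[OF assms(2)] assms by (simp add: e_simps)
qed (use assms in \<open>auto simp: e_simps\<close>)

lemma satur_vanish:
  assumes z: "z \<in> satur Q S" and "S \<subseteq> carrier Q" and x: "x \<in> carrier P" and "\<And>y. y \<in> S \<Longrightarrow> e x y = 0"
  shows "e x z = 0"
proof -
  obtain n :: nat where n: "n > 0" "z \<in> carrier Q" "z [^] n \<in> generate Q S"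
    using z by (auto simp: satur_def)
  have "e x (z [^] n) = 0" using generate_vanish[OF n(3)] assms by blast
  then show ?thesis using n x by (simp add: e_nat_pow_right)
qed

text \<open>The form \<open>\<Sum>\<^sub>\<alpha> \<langle>\<alpha>,y\<rangle>\<langle>\<alpha>,w\<rangle>\<close> is invariant under the reflections.\<close>

definition form :: "'b \<Rightarrow> 'b \<Rightarrow> int" where
  "form y w = (\<Sum>\<alpha>\<in>\<Phi>. e \<alpha> y * e \<alpha> w)"

text \<open>The reflection in \<alpha> permutes the roots; reindexing the sum by it negates the
  pairings with \<open>c \<alpha>\<close> and shifts those with \<open>w\<close> by multiples of
  \<open>e \<alpha> w\<close>. Up to a positive factor, \<alpha> is thus the functional that its
  coroot defines through the form.\<close>

lemma form_coroot:
  assumes \<alpha>: "\<alpha> \<in> \<Phi>" and w: "w \<in> carrier Q"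
  shows "2 * form (c \<alpha>) w = form (c \<alpha>) (c \<alpha>) * e \<alpha> w"
proof -
  define s where "s x = x \<otimes>\<^bsub>P\<^esub> inv\<^bsub>P\<^esub> (\<alpha> [^]\<^bsub>P\<^esub> e x (c \<alpha>))" for x
  have s: "s ` \<Phi> = \<Phi>" unfolding s_def by (rule reflection[OF \<alpha>])
  then have inj: "inj_on s \<Phi>" using roots(2) eq_card_imp_inj_on by metis
  have es: "e (s \<beta>) y = e \<beta> y - e \<beta> (c \<alpha>) * e \<alpha> y" if "\<beta> \<in> \<Phi>" "y \<in> carrier Q" for \<beta> y
    using that \<alpha> by (simp add: s_def e_simps root_in coroot_in)
  have "form (c \<alpha>) w = (\<Sum>\<beta>\<in>s ` \<Phi>. e \<beta> (c \<alpha>) * e \<beta> w)" by (simp add: form_def s)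
  also have "\<dots> = (\<Sum>\<beta>\<in>\<Phi>. e (s \<beta>) (c \<alpha>) * e (s \<beta>) w)" by (simp add: sum.reindex[OF inj])
  also have "\<dots> = (\<Sum>\<beta>\<in>\<Phi>. - (e \<beta> (c \<alpha>) * e \<beta> w) + (e \<beta> (c \<alpha>) * e \<beta> (c \<alpha>)) * e \<alpha> w)"
    using two[OF \<alpha>] by (intro sum.cong refl) (auto simp: es w coroot_in[OF \<alpha>] algebra_simps)
  also have "\<dots> = - form (c \<alpha>) w + form (c \<alpha>) (c \<alpha>) * e \<alpha> w"
    by (simp add: form_def sum_subtractf sum_distrib_right)
  finally show ?thesis by simp
qed

lemma form_coroot_pos:
  assumes \<alpha>: "\<alpha> \<in> \<Phi>" shows "form (c \<alpha>) (c \<alpha>) > 0"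
proof -
  have "e \<alpha> (c \<alpha>) * e \<alpha> (c \<alpha>) \<le> form (c \<alpha>) (c \<alpha>)"
    unfolding form_def by (rule member_le_sum) (use \<alpha> roots in auto)
  then show ?thesis using two[OF \<alpha>] by simp
qed

text \<open>An integral combination of coroots is specified by its pairings, which spares a finite
  product in the multiplicatively written group.\<close>

lemma coroot_combination:
  assumes "finite F" "F \<subseteq> \<Phi>"
  shows "\<exists>z\<in>generate Q (c ` \<Phi>). \<forall>x\<in>carrier P. e x z = (\<Sum>\<beta>\<in>F. k \<beta> * e x (c \<beta>))"
  using assms
proof (induction F rule: finite_induct)
  case empty
  then show ?case by (intro bexI[of _ "\<one>"]) (auto simp: e_simps generate.one)
next
  case (insert \<beta> F)
  then obtain z where z: "z \<in> generate Q (c ` \<Phi>)" "\<And>x. x \<in> carrier P \<Longrightarrow> e x z = (\<Sum>\<beta>\<in>F. k \<beta> * e x (c \<beta>))"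
    by auto
  have zQ: "z \<in> carrier Q" using Q.generate_in_carrier[OF coroots(1) z(1)] .
  have b: "c \<beta> \<in> carrier Q" using insert coroot_in by auto
  have sub: "subgroup (generate Q (c ` \<Phi>)) Q" using Q.generate_is_subgroup coroots by blast
  have "c \<beta> \<in> generate Q (c ` \<Phi>)" using insert by (auto intro: generate.incl)
  then have "(c \<beta> [^] k \<beta>) \<otimes> z \<in> generate Q (c ` \<Phi>)"
    using z Q.subgroup_int_pow_closed[OF sub] generate.eng by metis
  moreover have "e x ((c \<beta> [^] k \<beta>) \<otimes> z) = (\<Sum>\<beta>\<in>insert \<beta> F. k \<beta> * e x (c \<beta>))"
    if "x \<in> carrier P" for x
    using insert z that b zQ by (simp add: e_simps)
  ultimately show ?case by blast
qed

text \<open>Rationally, Q is the sum of the span of the coroots and the annihilator of the roots;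
  \<open>N\<close> clears denominators. The element \<open>z\<close> has coefficients 2 M
  (\<open>e \<beta> y\<close>) / \<open>form (c \<beta>) (c \<beta>)\<close>. By
  \<open>form_coroot\<close> it has the same form against \<open>v\<close> as M times
  \<open>y\<close>, so the difference \<open>v\<close> satisfies \<open>form v v = 0\<close>, and a
  vanishing sum of squares makes every root vanish on \<open>v\<close>.\<close>

lemma multiple_in_coroot_span_plus_perp:
  assumes y: "y \<in> carrier Q"
  shows "\<exists>N::nat. N > 0 \<and> (\<exists>z\<in>generate Q (c ` \<Phi>). \<forall>\<alpha>\<in>\<Phi>. e \<alpha> (y [^] N) = e \<alpha> z)"
proof -
  define b where "b \<alpha> = form (c \<alpha>) (c \<alpha>)" for \<alpha>
  \<comment> \<open>A common multiple of all the norms \<open>b \<alpha>\<close>, so that the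
    coefficients of \<open>z\<close> are integers.\<close>
  define M where "M = (\<Prod>\<alpha>\<in>\<Phi>. b \<alpha>)"
  have "M > 0" unfolding M_def b_def using form_coroot_pos by (intro prod_pos) auto
  have div: "M div b \<alpha> * b \<alpha> = M" if "\<alpha> \<in> \<Phi>" for \<alpha>
    using that roots(2) by (simp add: M_def dvd_prod_eqI)
  define N where "N = nat M"
  have N: "N > 0" "int N = M" using \<open>M > 0\<close> by (auto simp: N_def)
  obtain z where z: "z \<in> generate Q (c ` \<Phi>)"
    "\<And>x. x \<in> carrier P \<Longrightarrow> e x z = (\<Sum>\<beta>\<in>\<Phi>. (2 * e \<beta> y * (M div b \<beta>)) * e x (c \<beta>))"
    using coroot_combination[OF roots(2) order_refl, of "\<lambda>\<beta>. 2 * e \<beta> y * (M div b \<beta>)"] by blast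
  have zQ: "z \<in> carrier Q" using Q.generate_in_carrier[OF coroots(1) z(1)] .
  define v where "v = (y [^] N) \<otimes> inv z"
  have vQ: "v \<in> carrier Q" using y zQ by (simp add: v_def)
  have ev: "e \<alpha> v = M * e \<alpha> y - e \<alpha> z" if "\<alpha> \<in> \<Phi>" for \<alpha>
    using that y zQ N by (simp add: v_def e_simps root_in)
  have "form z v = (\<Sum>\<alpha>\<in>\<Phi>. (\<Sum>\<beta>\<in>\<Phi>. (2 * e \<beta> y * (M div b \<beta>)) * e \<alpha> (c \<beta>)) * e \<alpha> v)"
    unfolding form_def using z(2) root_in by (intro sum.cong) auto
  also have "\<dots> = (\<Sum>\<beta>\<in>\<Phi>. \<Sum>\<alpha>\<in>\<Phi>. (e \<beta> y * (M div b \<beta>)) * (2 * (e \<alpha> (c \<beta>) * e \<alpha> v)))"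
    unfolding sum_distrib_right by (subst sum.swap) (simp add: mult_ac)
  also have "\<dots> = (\<Sum>\<beta>\<in>\<Phi>. (e \<beta> y * (M div b \<beta>)) * (2 * form (c \<beta>) v))"
    by (simp add: form_def sum_distrib_left)
  also have "\<dots> = (\<Sum>\<beta>\<in>\<Phi>. M * (e \<beta> y * e \<beta> v))"
  proof (rule sum.cong[OF refl])
    fix \<beta> assume \<beta>: "\<beta> \<in> \<Phi>"
    have "(e \<beta> y * (M div b \<beta>)) * (2 * form (c \<beta>) v) = e \<beta> y * (M div b \<beta> * b \<beta>) * e \<beta> v"
      using form_coroot[OF \<beta> vQ] by (simp add: b_def)
    then show "(e \<beta> y * (M div b \<beta>)) * (2 * form (c \<beta>) v) = M * (e \<beta> y * e \<beta> v)"
      using div[OF \<beta>] by simp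
  qed
  finally have *: "form z v = M * form y v" by (simp add: form_def sum_distrib_left)
  have "form v v = (\<Sum>\<alpha>\<in>\<Phi>. M * (e \<alpha> y * e \<alpha> v) - e \<alpha> z * e \<alpha> v)"
    unfolding form_def by (intro sum.cong refl) (simp add: ev algebra_simps)
  also have "\<dots> = M * form y v - form z v" by (simp add: form_def sum_subtractf sum_distrib_left)
  finally have "(\<Sum>\<alpha>\<in>\<Phi>. e \<alpha> v * e \<alpha> v) = 0" using * by (simp add: form_def)
  then have "e \<alpha> v = 0" if "\<alpha> \<in> \<Phi>" for \<alpha>
    using that roots(2) by (subst (asm) sum_nonneg_eq_0_iff) auto
  then have "\<forall>\<alpha>\<in>\<Phi>. e \<alpha> (y [^] N) = e \<alpha> z"
    using ev y N by (auto simp: e_simps root_in)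
  then show ?thesis using N z(1) by blast
qed

interpretation flip: root_pairing Q P "\<lambda>y x. e x y" "c ` \<Phi>" "inv_into \<Phi> c"
  by (rule root_pairing_flip) unfold_locales

lemma inv_image: "inv_into \<Phi> c ` c ` \<Phi> = \<Phi>"
  using coroots(2) by auto

lemma multiple_in_root_span_plus_perp:
  assumes "x \<in> carrier P"
  shows "\<exists>N::nat. N > 0 \<and> (\<exists>z\<in>generate P \<Phi>. \<forall>y\<in>c ` \<Phi>. e (x [^]\<^bsub>P\<^esub> N) y = e z y)"
  using flip.multiple_in_coroot_span_plus_perp[OF assms] unfolding inv_image by blast

text \<open>A multiple of any \<open>y\<close> is z + w with \<open>z\<close> in the coroot span and
  \<open>w\<close> killed by all roots. \<open>x\<close> kills \<open>z\<close> by assumption, and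
  kills \<open>w\<close> because a multiple of \<open>x\<close> lies in the root span; nondegeneracy
  finishes.\<close>

lemma satur_roots_perp_coroots:
  assumes x: "x \<in> satur P \<Phi>" and perp: "\<And>y. y \<in> c ` \<Phi> \<Longrightarrow> e x y = 0"
  shows "x = \<one>\<^bsub>P\<^esub>"
proof (rule nondeg_P)
  show xP: "x \<in> carrier P" using x by (simp add: satur_def)
  obtain k :: nat where k: "k > 0" "x [^]\<^bsub>P\<^esub> k \<in> generate P \<Phi>" using x by (auto simp: satur_def)
  show "\<forall>y\<in>carrier Q. e x y = 0"
  proof
    fix y assume y: "y \<in> carrier Q"
    obtain N :: nat and z where N: "N > 0" and z: "z \<in> generate Q (c ` \<Phi>)"
      and eq: "\<And>\<alpha>. \<alpha> \<in> \<Phi> \<Longrightarrow> e \<alpha> (y [^] N) = e \<alpha> z"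
      using multiple_in_coroot_span_plus_perp[OF y] by blast
    have zQ: "z \<in> carrier Q" using Q.generate_in_carrier[OF coroots(1) z] .
    define w where "w = (y [^] N) \<otimes> inv z"
    have wQ: "w \<in> carrier Q" using y zQ by (simp add: w_def)
    have "e \<alpha> w = 0" if "\<alpha> \<in> \<Phi>" for \<alpha> using eq[OF that] that y zQ by (simp add: w_def e_mult_right e_inv_right root_in)
    then have "e (x [^]\<^bsub>P\<^esub> k) w = 0"
      using flip.generate_vanish[OF k(2) roots(1) wQ] by blast
    then have "e x w = 0" using k xP wQ by (simp add: e_nat_pow_left)
    moreover have "e x z = 0" using generate_vanish[OF z coroots(1) xP] perp by blast
    ultimately have "e x (y [^] N) = 0" using xP y zQ by (simp add: w_def e_mult_right e_inv_right)
    then show "e x y = 0" using N xP y by (simp add: e_nat_pow_right)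
  qed
qed

text \<open>Split a multiple of \<open>y\<close> as z + w and show w = 0 by testing against any
  \<open>x\<close>, a multiple of which splits as u + v on the other side. \<open>u\<close> kills
  \<open>w\<close> since the roots do; \<open>v\<close> annihilates the coroots, so it kills
  \<open>y\<close> by hypothesis and \<open>z\<close>, hence \<open>w\<close>.\<close>

lemma double_perp_coroots:
  assumes y: "y \<in> carrier Q"
    and perp: "\<And>x. x \<in> carrier P \<Longrightarrow> \<forall>y'\<in>c ` \<Phi>. e x y' = 0 \<Longrightarrow> e x y = 0"
  shows "y \<in> satur Q (c ` \<Phi>)"
proof -
  obtain N :: nat and z where N: "N > 0" and z: "z \<in> generate Q (c ` \<Phi>)"
    and eq: "\<And>\<alpha>. \<alpha> \<in> \<Phi> \<Longrightarrow> e \<alpha> (y [^] N) = e \<alpha> z"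
    using multiple_in_coroot_span_plus_perp[OF y] by blast
  have zQ: "z \<in> carrier Q" using Q.generate_in_carrier[OF coroots(1) z] .
  define w where "w = (y [^] N) \<otimes> inv z"
  have wQ: "w \<in> carrier Q" using y zQ by (simp add: w_def)
  have w0: "e \<alpha> w = 0" if "\<alpha> \<in> \<Phi>" for \<alpha> using eq[OF that] that y zQ by (simp add: w_def e_mult_right e_inv_right root_in)
  have "w = \<one>"
  proof (rule nondeg_Q[OF wQ], rule ballI)
    fix x assume x: "x \<in> carrier P"
    obtain M :: nat and u where M: "M > 0" and u: "u \<in> generate P \<Phi>"
      and eq': "\<And>y'. y' \<in> c ` \<Phi> \<Longrightarrow> e (x [^]\<^bsub>P\<^esub> M) y' = e u y'"
      using multiple_in_root_span_plus_perp[OF x] by blast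
    have uP: "u \<in> carrier P" using P.generate_in_carrier[OF roots(1) u] .
    define v where "v = (x [^]\<^bsub>P\<^esub> M) \<otimes>\<^bsub>P\<^esub> inv\<^bsub>P\<^esub> u"
    have vP: "v \<in> carrier P" using x uP by (simp add: v_def)
    have v0: "\<forall>y'\<in>c ` \<Phi>. e v y' = 0"
      using eq' x uP coroots(1) by (auto simp: v_def e_mult_left e_inv_left coroot_in)
    have "e v y = 0" using perp vP v0 by blast
    moreover have "e v z = 0" using generate_vanish[OF z coroots(1) vP] v0 by blast
    ultimately have "e v w = 0" using vP y zQ by (simp add: w_def e_mult_right e_inv_right e_nat_pow_right)
    moreover have "e u w = 0" using flip.generate_vanish[OF u roots(1) wQ] w0 by blast
    ultimately have "e (x [^]\<^bsub>P\<^esub> M) w = 0" using x uP wQ by (simp add: v_def e_mult_left e_inv_left)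
    then show "e x w = 0" using M x wQ by (simp add: e_nat_pow_left)
  qed
  then have "y [^] N = z" using y zQ by (metis w_def Q.inv_closed Q.inv_equality Q.inv_inv Q.nat_pow_closed)
  then show ?thesis using y N z by (auto simp: satur_def)
qed

end

section \<open>Isomorphisms of root data\<close>

lemma hom_factor_epi:
  assumes "group G" "group H" "group L" and p: "p \<in> epi G H" and k: "k \<in> hom G L"
    and ker: "\<And>x. x \<in> carrier G \<Longrightarrow> p x = \<one>\<^bsub>H\<^esub> \<Longrightarrow> k x = \<one>\<^bsub>L\<^esub>"
  shows "\<exists>g\<in>hom H L. \<forall>x\<in>carrier G. g (p x) = k x"
proof -
  interpret G: group G by fact
  interpret H: group H by fact
  interpret L: group L by fact
  have ph: "p \<in> hom G H" and ps: "p ` carrier G = carrier H" using p by (auto simp: epi_def)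
  have pc: "p x \<in> carrier H" if "x \<in> carrier G" for x using that ps by blast
  have kc: "k x \<in> carrier L" if "x \<in> carrier G" for x using that hom_in_carrier[OF k] by blast
  have eq: "k x = k y" if x: "x \<in> carrier G" and y: "y \<in> carrier G" and pxy: "p x = p y" for x y
  proof -
    have "p (x \<otimes>\<^bsub>G\<^esub> inv\<^bsub>G\<^esub> y) = \<one>\<^bsub>H\<^esub>"
      using x y pxy pc by (simp add: hom_mult[OF ph] hom_inv_eq[OF G.is_group H.is_group ph])
    then have "k (x \<otimes>\<^bsub>G\<^esub> inv\<^bsub>G\<^esub> y) = \<one>\<^bsub>L\<^esub>" using ker x y by simp
    then have "k x \<otimes>\<^bsub>L\<^esub> inv\<^bsub>L\<^esub> (k y) = \<one>\<^bsub>L\<^esub>"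
      using x y by (simp add: hom_mult[OF k] hom_inv_eq[OF G.is_group L.is_group k])
    then show ?thesis using kc x y by (metis L.inv_closed L.inv_equality L.inv_inv)
  qed
  define g where "g y = k (inv_into (carrier G) p y)" for y
  have i: "inv_into (carrier G) p y \<in> carrier G" "p (inv_into (carrier G) p y) = y"
    if "y \<in> carrier H" for y using that ps by (auto intro: inv_into_into f_inv_into_f)
  have gp: "g (p x) = k x" if "x \<in> carrier G" for x
    unfolding g_def using eq i[OF pc[OF that]] that by blast
  have "g \<in> hom H L"
  proof (rule homI)
    fix y assume "y \<in> carrier H"
    then show "g y \<in> carrier L" using i kc by (simp add: g_def)
  next
    fix y z assume "y \<in> carrier H" "z \<in> carrier H"
    then obtain a b where ab: "a \<in> carrier G" "b \<in> carrier G" and eqs: "y = p a" "z = p b" using ps by blast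
    have "g (p a \<otimes>\<^bsub>H\<^esub> p b) = g (p (a \<otimes>\<^bsub>G\<^esub> b))" by (simp only: hom_mult[OF ph ab])
    also have "\<dots> = g (p a) \<otimes>\<^bsub>L\<^esub> g (p b)" using ab by (simp only: gp G.m_closed hom_mult[OF k])
    finally show "g (y \<otimes>\<^bsub>H\<^esub> z) = g y \<otimes>\<^bsub>L\<^esub> g z" by (simp only: eqs)
  qed
  then show ?thesis using gp by blast
qed

lemma iso_factor_epi:
  assumes G: "group G" and H: "group H" and L: "group L" and p: "p \<in> epi G H" and k: "k \<in> epi G L"
    and ker: "\<And>x. x \<in> carrier G \<Longrightarrow> p x = \<one>\<^bsub>H\<^esub> \<longleftrightarrow> k x = \<one>\<^bsub>L\<^esub>"
  shows "\<exists>g\<in>iso H L. \<forall>x\<in>carrier G. g (p x) = k x"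
proof -
  have ph: "p \<in> hom G H" and ps: "p ` carrier G = carrier H" using p by (auto simp: epi_def)
  have kh: "k \<in> hom G L" and ks: "k ` carrier G = carrier L" using k by (auto simp: epi_def)
  obtain g where g: "g \<in> hom H L" "\<And>x. x \<in> carrier G \<Longrightarrow> g (p x) = k x"
    using hom_factor_epi[OF G H L p kh] ker by blast
  obtain g' where g': "g' \<in> hom L H" "\<And>x. x \<in> carrier G \<Longrightarrow> g' (k x) = p x"
    using hom_factor_epi[OF G L H k ph] ker by blast
  have "bij_betw g (carrier H) (carrier L)"
  proof (rule bij_betw_byWitness[where f' = g'])
    show "\<forall>a\<in>carrier H. g' (g a) = a" "\<forall>a\<in>carrier L. g (g' a) = a"
      unfolding ps[symmetric] ks[symmetric] using g g' by auto
    show "g ` carrier H \<subseteq> carrier L" "g' ` carrier L \<subseteq> carrier H"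
      using g g' hom_in_carrier by fast+
  qed
  then show ?thesis using g by (auto simp: iso_def)
qed

text \<open>Only functionals on the lattice have to be represented. This suffices to rebuild dual
  isomorphisms, and it passes to quotients and induced data without any reflections being checked
  there.\<close>

definition left_perfect :: "('a, 'b) rdatum \<Rightarrow> bool" where
  "left_perfect R \<longleftrightarrow> comm_group (lat R) \<and> comm_group (dlat R) \<and>
     (\<forall>x\<in>carrier (lat R). (\<lambda>y. pairing R x y) \<in> hom (dlat R) integer_group) \<and>
     (\<forall>y\<in>carrier (dlat R). (\<lambda>x. pairing R x y) \<in> hom (lat R) integer_group) \<and>
     (\<forall>\<phi>\<in>hom (lat R) integer_group.
        \<exists>!y. y \<in> carrier (dlat R) \<and> (\<forall>x\<in>carrier (lat R). pairing R x y = \<phi> x)) \<and>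
     coroots R \<subseteq> carrier (dlat R)"

lemma root_datum_left_perfect: "root_datum R \<Longrightarrow> left_perfect R"
  unfolding root_datum_def left_perfect_def lattice_def
  by (elim conjE, intro conjI) assumption+

lemma left_perfect_unique:
  assumes "left_perfect R" "y \<in> carrier (dlat R)" "y' \<in> carrier (dlat R)"
    and "\<And>x. x \<in> carrier (lat R) \<Longrightarrow> pairing R x y = pairing R x y'"
  shows "y = y'"
proof -
  have "(\<lambda>x. pairing R x y) \<in> hom (lat R) integer_group" using assms by (auto simp: left_perfect_def)
  then have "\<exists>!z. z \<in> carrier (dlat R) \<and> (\<forall>x\<in>carrier (lat R). pairing R x z = pairing R x y)"
    using assms(1) by (auto simp: left_perfect_def)
  then show ?thesis using assms by metis
qed

lemma left_perfect_represent:
  assumes "left_perfect R" "\<phi> \<in> hom (lat R) integer_group"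
  shows "\<exists>y\<in>carrier (dlat R). \<forall>x\<in>carrier (lat R). pairing R x y = \<phi> x"
  using assms unfolding left_perfect_def by blast

text \<open>Coroots are compared as functionals pulled back to the source lattice. \<phi> may be any
  map, in particular a quotient map or a projection, for which no dual map in the same direction
  exists.\<close>

definition coroots_match :: "('a, 'b) rdatum \<Rightarrow> ('c, 'd) rdatum \<Rightarrow> ('a \<Rightarrow> 'c) \<Rightarrow> bool" where
  "coroots_match R S \<phi> \<longleftrightarrow>
     (\<forall>y\<in>coroots R. \<exists>y'\<in>coroots S. \<forall>x\<in>carrier (lat R). pairing S (\<phi> x) y' = pairing R x y) \<and>
     (\<forall>y'\<in>coroots S. \<exists>y\<in>coroots R. \<forall>x\<in>carrier (lat R). pairing S (\<phi> x) y' = pairing R x y)"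

lemma coroots_matchD:
  assumes "coroots_match R S \<phi>"
  shows "y \<in> coroots R \<Longrightarrow> \<exists>y'\<in>coroots S. \<forall>x\<in>carrier (lat R). pairing S (\<phi> x) y' = pairing R x y"
    and "y' \<in> coroots S \<Longrightarrow> \<exists>y\<in>coroots R. \<forall>x\<in>carrier (lat R). pairing S (\<phi> x) y' = pairing R x y"
  using assms unfolding coroots_match_def by simp_all

lemma coroots_match_image:
  assumes "coroots S = \<psi> ` coroots R"
    and "\<And>x y. x \<in> carrier (lat R) \<Longrightarrow> y \<in> coroots R \<Longrightarrow> pairing S (\<phi> x) (\<psi> y) = pairing R x y"
  shows "coroots_match R S \<phi>"
  using assms unfolding coroots_match_def by auto

lemma coroots_match_comp:
  assumes u: "coroots_match R S u" and v: "coroots_match S U v"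
    and c: "\<And>x. x \<in> carrier (lat R) \<Longrightarrow> u x \<in> carrier (lat S)"
  shows "coroots_match R U (\<lambda>x. v (u x))"
  unfolding coroots_match_def
proof (intro conjI ballI)
  fix y assume "y \<in> coroots R"
  then obtain y1 where y1: "y1 \<in> coroots S" "\<forall>x\<in>carrier (lat R). pairing S (u x) y1 = pairing R x y"
    using coroots_matchD(1)[OF u] by meson
  obtain y2 where "y2 \<in> coroots U" "\<forall>x\<in>carrier (lat S). pairing U (v x) y2 = pairing S x y1"
    using coroots_matchD(1)[OF v y1(1)] by meson
  then show "\<exists>y'\<in>coroots U. \<forall>x\<in>carrier (lat R). pairing U (v (u x)) y' = pairing R x y"
    using y1(2) c by (intro bexI[of _ y2]) simp_all
next
  fix y assume "y \<in> coroots U"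
  then obtain y1 where y1: "y1 \<in> coroots S" "\<forall>x\<in>carrier (lat S). pairing U (v x) y = pairing S x y1"
    using coroots_matchD(2)[OF v] by meson
  obtain y2 where "y2 \<in> coroots R" "\<forall>x\<in>carrier (lat R). pairing S (u x) y1 = pairing R x y2"
    using coroots_matchD(2)[OF u y1(1)] by meson
  then show "\<exists>y'\<in>coroots R. \<forall>x\<in>carrier (lat R). pairing U (v (u x)) y = pairing R x y'"
    using y1(2) c by (intro bexI[of _ y2]) simp_all
qed

lemma coroots_match_cancel_right:
  assumes u: "coroots_match R S u" and w: "coroots_match R U w"
    and surj: "u ` carrier (lat R) = carrier (lat S)"
    and vu: "\<And>x. x \<in> carrier (lat R) \<Longrightarrow> v (u x) = w x"
  shows "coroots_match S U v"
  unfolding coroots_match_def surj[symmetric]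
proof (intro conjI ballI)
  fix y assume "y \<in> coroots S"
  then obtain y1 where y1: "y1 \<in> coroots R" "\<forall>x\<in>carrier (lat R). pairing S (u x) y = pairing R x y1"
    using coroots_matchD(2)[OF u] by meson
  obtain y2 where "y2 \<in> coroots U" "\<forall>x\<in>carrier (lat R). pairing U (w x) y2 = pairing R x y1"
    using coroots_matchD(1)[OF w y1(1)] by meson
  then show "\<exists>y'\<in>coroots U. \<forall>x\<in>u ` carrier (lat R). pairing U (v x) y' = pairing S x y"
    using y1(2) vu by (intro bexI[of _ y2]) auto
next
  fix y assume "y \<in> coroots U"
  then obtain y1 where y1: "y1 \<in> coroots R" "\<forall>x\<in>carrier (lat R). pairing U (w x) y = pairing R x y1"
    using coroots_matchD(2)[OF w] by meson
  obtain y2 where "y2 \<in> coroots S" "\<forall>x\<in>carrier (lat R). pairing S (u x) y2 = pairing R x y1"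
    using coroots_matchD(1)[OF u y1(1)] by meson
  then show "\<exists>y'\<in>coroots S. \<forall>x\<in>u ` carrier (lat R). pairing U (v x) y = pairing S x y'"
    using y1(2) vu by (intro bexI[of _ y2]) auto
qed

lemma coroots_match_cancel_left:
  assumes v: "coroots_match S U v" and vu: "coroots_match R U (\<lambda>x. v (u x))"
    and c: "\<And>x. x \<in> carrier (lat R) \<Longrightarrow> u x \<in> carrier (lat S)"
  shows "coroots_match R S u"
  unfolding coroots_match_def
proof (intro conjI ballI)
  fix y assume "y \<in> coroots R"
  then obtain y1 where y1: "y1 \<in> coroots U" "\<forall>x\<in>carrier (lat R). pairing U (v (u x)) y1 = pairing R x y"
    using coroots_matchD(1)[OF vu] by meson
  obtain y2 where "y2 \<in> coroots S" "\<forall>x\<in>carrier (lat S). pairing U (v x) y1 = pairing S x y2"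
    using coroots_matchD(2)[OF v y1(1)] by meson
  then show "\<exists>y'\<in>coroots S. \<forall>x\<in>carrier (lat R). pairing S (u x) y' = pairing R x y"
    using y1(2) c by (intro bexI[of _ y2]) simp_all
next
  fix y assume "y \<in> coroots S"
  then obtain y1 where y1: "y1 \<in> coroots U" "\<forall>x\<in>carrier (lat S). pairing U (v x) y1 = pairing S x y"
    using coroots_matchD(1)[OF v] by meson
  obtain y2 where "y2 \<in> coroots R" "\<forall>x\<in>carrier (lat R). pairing U (v (u x)) y1 = pairing R x y2"
    using coroots_matchD(2)[OF vu y1(1)] by meson
  then show "\<exists>y'\<in>coroots R. \<forall>x\<in>carrier (lat R). pairing S (u x) y = pairing R x y'"
    using y1(2) c by (intro bexI[of _ y2]) simp_all
qed

definition lat_iso :: "('a, 'b) rdatum \<Rightarrow> ('c, 'd) rdatum \<Rightarrow> ('a \<Rightarrow> 'c) \<Rightarrow> bool" where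
  "lat_iso R S \<phi> \<longleftrightarrow> \<phi> \<in> iso (lat R) (lat S) \<and> \<phi> ` roots R = roots S \<and> coroots_match R S \<phi>"

lemma rd_iso_imp_lat_iso:
  assumes "rd_iso R S \<phi> \<psi>" "coroots R \<subseteq> carrier (dlat R)"
  shows "lat_iso R S \<phi>"
proof -
  have "coroots_match R S \<phi>"
    by (rule coroots_match_image[of S \<psi>]) (use assms in \<open>auto simp: rd_iso_def\<close>)
  then show ?thesis using assms(1) by (simp add: rd_iso_def lat_iso_def)
qed

text \<open>The dual half is the inverse transpose: the functional obtained from \<open>y\<close> by
  composing with the inverse of \<phi> is represented in the dual lattice of
  \<open>S\<close>.\<close>

lemma lat_iso_imp_rd_iso:
  assumes R: "left_perfect R" and S: "left_perfect S" and \<phi>: "lat_iso R S \<phi>"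
  shows "\<exists>\<psi>. rd_iso R S \<phi> \<psi>"
proof -
  have iso: "\<phi> \<in> iso (lat R) (lat S)" using \<phi> by (simp add: lat_iso_def)
  have hom: "\<phi> \<in> hom (lat R) (lat S)" and surj: "\<phi> ` carrier (lat R) = carrier (lat S)"
    using iso by (auto simp: iso_def bij_betw_def)
  have gR: "group (lat R)" using R by (auto simp: left_perfect_def comm_group_def)
  define \<phi>' where "\<phi>' = inv_into (carrier (lat R)) \<phi>"
  have \<phi>': "\<phi>' \<in> hom (lat S) (lat R)" using group.iso_set_sym[OF gR iso] by (simp add: \<phi>'_def iso_def)
  have inv: "\<phi>' (\<phi> x) = x" if "x \<in> carrier (lat R)" for x
    unfolding \<phi>'_def using iso that by (auto simp: iso_def bij_betw_def)
  have "\<exists>y'\<in>carrier (dlat S). \<forall>x\<in>carrier (lat R). pairing S (\<phi> x) y' = pairing R x y"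
    if y: "y \<in> carrier (dlat R)" for y
  proof -
    have "(\<lambda>x. pairing R x y) \<in> hom (lat R) integer_group" using R y by (auto simp: left_perfect_def)
    then have "(\<lambda>x. pairing R (\<phi>' x) y) \<in> hom (lat S) integer_group"
      using hom_compose[OF \<phi>', of "\<lambda>x. pairing R x y"] by (simp add: comp_def)
    then obtain y' where "y' \<in> carrier (dlat S)" "\<forall>x\<in>carrier (lat S). pairing S x y' = pairing R (\<phi>' x) y"
      using left_perfect_represent[OF S] by blast
    then show ?thesis using inv hom_in_carrier[OF hom] by (intro bexI[of _ y']) auto
  qed
  then obtain \<psi> where \<psi>: "\<And>y. y \<in> carrier (dlat R) \<Longrightarrow> \<psi> y \<in> carrier (dlat S)"
    and ad: "\<And>x y. y \<in> carrier (dlat R) \<Longrightarrow> x \<in> carrier (lat R) \<Longrightarrow> pairing S (\<phi> x) (\<psi> y) = pairing R x y"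
    by metis
  \<comment> \<open>Compatibility with the pairing pins down \<open>\<psi> y\<close>; additivity,
    surjectivity and the image of the coroots are all read off from this.\<close>
  have uniq: "\<psi> y = y'" if "y \<in> carrier (dlat R)" "y' \<in> carrier (dlat S)"
    "\<And>x. x \<in> carrier (lat R) \<Longrightarrow> pairing S (\<phi> x) y' = pairing R x y" for y y'
  proof (rule left_perfect_unique[OF S \<psi>[OF that(1)] that(2)])
    fix x assume "x \<in> carrier (lat S)"
    then obtain x' where "x' \<in> carrier (lat R)" "x = \<phi> x'" using surj by blast
    then show "pairing S x (\<psi> y) = pairing S x y'" using ad that by simp
  qed
  have "\<psi> \<in> iso (dlat R) (dlat S)"
  proof (rule isoI)
    show "\<psi> \<in> hom (dlat R) (dlat S)"
    proof (rule homI)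
      fix y z assume y: "y \<in> carrier (dlat R)" and z: "z \<in> carrier (dlat R)"
      interpret DR: comm_group "dlat R" using R by (simp add: left_perfect_def)
      interpret DS: comm_group "dlat S" using S by (simp add: left_perfect_def)
      show "\<psi> (y \<otimes>\<^bsub>dlat R\<^esub> z) = \<psi> y \<otimes>\<^bsub>dlat S\<^esub> \<psi> z"
      proof (rule uniq)
        fix x assume x: "x \<in> carrier (lat R)"
        then have x': "\<phi> x \<in> carrier (lat S)" using surj by blast
        have 1: "pairing R x \<in> hom (dlat R) integer_group" using R x by (auto simp: left_perfect_def)
        have 2: "pairing S (\<phi> x) \<in> hom (dlat S) integer_group" using S x' by (auto simp: left_perfect_def)
        show "pairing S (\<phi> x) (\<psi> y \<otimes>\<^bsub>dlat S\<^esub> \<psi> z) = pairing R x (y \<otimes>\<^bsub>dlat R\<^esub> z)"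
          using hom_integer_groupD[OF 1 y z] hom_integer_groupD[OF 2 \<psi>[OF y] \<psi>[OF z]] ad x y z by simp
      qed (use y z \<psi> in auto)
    qed (rule \<psi>)
    show "bij_betw \<psi> (carrier (dlat R)) (carrier (dlat S))"
      unfolding bij_betw_def
    proof (intro conjI equalityI subsetI)
      show "inj_on \<psi> (carrier (dlat R))"
      proof (rule inj_onI)
        fix y z assume "y \<in> carrier (dlat R)" "z \<in> carrier (dlat R)" "\<psi> y = \<psi> z"
        then show "y = z" using ad left_perfect_unique[OF R] by metis
      qed
      fix y' assume y': "y' \<in> carrier (dlat S)"
      then have "(\<lambda>x. pairing S x y') \<in> hom (lat S) integer_group" using S by (auto simp: left_perfect_def)
      then have "(\<lambda>x. pairing S (\<phi> x) y') \<in> hom (lat R) integer_group"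
        using hom_compose[OF hom, of "\<lambda>x. pairing S x y'"] by (simp add: comp_def)
      then obtain y where "y \<in> carrier (dlat R)" "\<And>x. x \<in> carrier (lat R) \<Longrightarrow> pairing R x y = pairing S (\<phi> x) y'"
        using left_perfect_represent[OF R] by blast
      then have "y \<in> carrier (dlat R)" "\<psi> y = y'" using uniq y' by auto
      then show "y' \<in> \<psi> ` carrier (dlat R)" by blast
    qed (use \<psi> in auto)
  qed
  moreover have "\<psi> ` coroots R = coroots S"
  proof -
    have cm: "coroots_match R S \<phi>" using \<phi> by (simp add: lat_iso_def)
    have cR: "coroots R \<subseteq> carrier (dlat R)" and cS: "coroots S \<subseteq> carrier (dlat S)"
      using R S by (auto simp: left_perfect_def)
    have "\<psi> y \<in> coroots S" if y: "y \<in> coroots R" for y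
    proof -
      obtain y' where "y' \<in> coroots S" "\<And>x. x \<in> carrier (lat R) \<Longrightarrow> pairing S (\<phi> x) y' = pairing R x y"
        using coroots_matchD(1)[OF cm y] by blast
      then show ?thesis using uniq[of y y'] cR cS y by auto
    qed
    moreover have "y' \<in> \<psi> ` coroots R" if y': "y' \<in> coroots S" for y'
    proof -
      obtain y where "y \<in> coroots R" "\<And>x. x \<in> carrier (lat R) \<Longrightarrow> pairing S (\<phi> x) y' = pairing R x y"
        using coroots_matchD(2)[OF cm y'] by blast
      then show ?thesis using uniq[of y y'] cR cS y' by auto
    qed
    ultimately show ?thesis by blast
  qed
  ultimately have "rd_iso R S \<phi> \<psi>" using iso ad \<phi> by (auto simp: rd_iso_def lat_iso_def)
  then show ?thesis by blast
qed

section \<open>Isomorphism classes\<close>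

lemma rd_isomorphic_refl: "rd_isomorphic R R"
  unfolding rd_isomorphic_def rd_iso_def
  by (intro exI[of _ "\<lambda>x. x"] conjI iso_set_refl) auto

lemma rd_isomorphic_trans:
  assumes "rd_isomorphic R S" "rd_isomorphic S T"
  shows "rd_isomorphic R T"
proof -
  obtain u v where 1: "rd_iso R S u v" using assms by (auto simp: rd_isomorphic_def)
  obtain u' v' where 2: "rd_iso S T u' v'" using assms by (auto simp: rd_isomorphic_def)
  have "rd_iso R T (\<lambda>x. u' (u x)) (\<lambda>x. v' (v x))"
    unfolding rd_iso_def
  proof (intro conjI ballI)
    show "(\<lambda>x. u' (u x)) \<in> iso (lat R) (lat T)" "(\<lambda>x. v' (v x)) \<in> iso (dlat R) (dlat T)"
      using 1 2 by (auto simp: rd_iso_def intro: iso_comp)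
    have "(\<lambda>x. u' (u x)) ` roots R = u' ` u ` roots R" "(\<lambda>x. v' (v x)) ` coroots R = v' ` v ` coroots R"
      by (simp_all only: image_image)
    then show "(\<lambda>x. u' (u x)) ` roots R = roots T" "(\<lambda>x. v' (v x)) ` coroots R = coroots T"
      using 1 2 by (simp_all add: rd_iso_def)
    fix x y assume "x \<in> carrier (lat R)" "y \<in> carrier (dlat R)"
    moreover then have "u x \<in> carrier (lat S)" "v y \<in> carrier (dlat S)"
      using 1 by (auto simp: rd_iso_def iso_def hom_def)
    ultimately show "pairing T (u' (u x)) (v' (v y)) = pairing R x y"
      using 1 2 by (simp add: rd_iso_def)
  qed
  then show ?thesis by (auto simp: rd_isomorphic_def)
qed

lemma rd_isomorphic_sym:
  assumes "rd_isomorphic R S" "group (lat R)" "group (dlat R)"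
    and "roots R \<subseteq> carrier (lat R)" "coroots R \<subseteq> carrier (dlat R)"
  shows "rd_isomorphic S R"
proof -
  obtain u v where 1: "rd_iso R S u v" using assms by (auto simp: rd_isomorphic_def)
  have u: "bij_betw u (carrier (lat R)) (carrier (lat S))" and v: "bij_betw v (carrier (dlat R)) (carrier (dlat S))"
    using 1 by (auto simp: rd_iso_def iso_def)
  have "rd_iso S R (inv_into (carrier (lat R)) u) (inv_into (carrier (dlat R)) v)"
    unfolding rd_iso_def
  proof (intro conjI ballI)
    show "inv_into (carrier (lat R)) u \<in> iso (lat S) (lat R)" "inv_into (carrier (dlat R)) v \<in> iso (dlat S) (dlat R)"
      using 1 assms by (auto simp: rd_iso_def intro: group.iso_set_sym)
    have "inv_into (carrier (lat R)) u ` u ` roots R = roots R"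
      using u assms(4) by (simp add: bij_betw_def inv_into_image_cancel)
    then show "inv_into (carrier (lat R)) u ` roots S = roots R" using 1 by (simp add: rd_iso_def)
    have "inv_into (carrier (dlat R)) v ` v ` coroots R = coroots R"
      using v assms(5) by (simp add: bij_betw_def inv_into_image_cancel)
    then show "inv_into (carrier (dlat R)) v ` coroots S = coroots R" using 1 by (simp add: rd_iso_def)
    fix x y assume x: "x \<in> carrier (lat S)" and y: "y \<in> carrier (dlat S)"
    obtain x' y' where "x' \<in> carrier (lat R)" "x = u x'" "y' \<in> carrier (dlat R)" "y = v y'"
      using x y u v by (metis bij_betw_def imageE)
    then show "pairing R (inv_into (carrier (lat R)) u x) (inv_into (carrier (dlat R)) v y) = pairing S x y"
      using 1 u v by (simp add: rd_iso_def bij_betw_inv_into_left)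
  qed
  then show ?thesis by (auto simp: rd_isomorphic_def)
qed

text \<open>Inverting the isomorphism requires group structure and containments for \<open>S\<close>
  alone, so \<open>R\<close> can be a central product that has not been shown to be a root
  datum.\<close>

lemma rd_class_eq:
  fixes S :: crd
  assumes S: "root_datum S" and iso: "rd_isomorphic S R"
  shows "rd_class R = rd_class S"
proof -
  have "rd_isomorphic R S"
  proof -
    have "group (lat S)" "group (dlat S)" "roots S \<subseteq> carrier (lat S)" "coroots S \<subseteq> carrier (dlat S)"
      using S by (auto simp: root_datum_def lattice_def comm_group_def)
    then show ?thesis by (rule rd_isomorphic_sym[OF iso])
  qed
  then show ?thesis using iso unfolding rd_class_def by (auto intro: rd_isomorphic_trans)
qed

text \<open>Common to the derived datum and the radical: functionals on the quotient by
  \<open>N\<close> are the functionals vanishing on \<open>N\<close>, and these are represented by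
  the annihilator \<open>D\<close>. It is therefore essential that the dual lattice be the full
  annihilator.\<close>

lemma left_perfect_quotient:
  fixes \<Psi> :: "'a set set" and R :: "('a, 'b) rdatum"
  assumes R: "left_perfect R" and N: "subgroup N (lat R)"
    and D: "D = {y \<in> carrier (dlat R). \<forall>x\<in>N. pairing R x y = 0}" and C: "C \<subseteq> D"
  defines "Q \<equiv> \<lparr>lat = lat R Mod N, roots = \<Psi>, dlat = (dlat R)\<lparr>carrier := D\<rparr>, coroots = C,
     pairing = (\<lambda>C y. pairing R (SOME x. x \<in> C) y)\<rparr>"
  shows "left_perfect Q"
    and "\<And>x y. x \<in> carrier (lat R) \<Longrightarrow> y \<in> D \<Longrightarrow> pairing Q (N #>\<^bsub>lat R\<^esub> x) y = pairing R x y"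
proof -
  interpret L: comm_group "lat R" using R by (simp add: left_perfect_def)
  interpret M: comm_group "dlat R" using R by (simp add: left_perfect_def)
  have NL: "x \<in> N \<Longrightarrow> x \<in> carrier (lat R)" for x using N subgroup.subset by blast
  have left: "pairing R x \<in> hom (dlat R) integer_group" if "x \<in> carrier (lat R)" for x
    using R that by (auto simp: left_perfect_def)
  have right: "(\<lambda>x. pairing R x y) \<in> hom (lat R) integer_group" if "y \<in> carrier (dlat R)" for y
    using R that by (auto simp: left_perfect_def)
  have DM: "y \<in> D \<Longrightarrow> y \<in> carrier (dlat R)" for y by (simp add: D)
  have Dsub: "subgroup D (dlat R)"
  proof (rule M.subgroupI)
    show "D \<noteq> {}" using hom_integer_group_one[OF M.is_group left] NL by (auto simp: D)
  qed (use NL in \<open>auto simp: D hom_integer_groupD[OF left] hom_integer_group_inv[OF M.is_group left]\<close>)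
  \<comment> \<open>Elements of \<open>D\<close> vanish on \<open>N\<close>, so the pairing is
    constant on cosets and the choice made by \<open>SOME\<close> is harmless.\<close>
  have pair: "pairing R x' y = pairing R x y" if "x \<in> carrier (lat R)" "y \<in> D" "x' \<in> N #>\<^bsub>lat R\<^esub> x" for x x' y
    using that NL by (auto simp: r_coset_def D hom_integer_groupD[OF right])
  show pQ: "pairing Q (N #>\<^bsub>lat R\<^esub> x) y = pairing R x y" if x: "x \<in> carrier (lat R)" and y: "y \<in> D" for x y
  proof -
    have "(SOME x'. x' \<in> N #>\<^bsub>lat R\<^esub> x) \<in> N #>\<^bsub>lat R\<^esub> x"
      using L.rcos_self[OF x N] by (rule someI)
    then show ?thesis using pair x y by (simp add: Q_def)
  qed
  have nor: "N \<lhd> lat R" using N L.normal_iff_subgroup by blast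
  have proj: "(\<lambda>x. N #>\<^bsub>lat R\<^esub> x) \<in> hom (lat R) (lat R Mod N)" using nor by (rule normal.r_coset_hom_Mod)
  have carQ: "carrier (lat Q) = (\<lambda>x. N #>\<^bsub>lat R\<^esub> x) ` carrier (lat R)"
    by (auto simp: Q_def FactGroup_def RCOSETS_def)
  have mQ: "(N #>\<^bsub>lat R\<^esub> x) \<otimes>\<^bsub>lat Q\<^esub> (N #>\<^bsub>lat R\<^esub> x') = N #>\<^bsub>lat R\<^esub> (x \<otimes>\<^bsub>lat R\<^esub> x')"
    if "x \<in> carrier (lat R)" "x' \<in> carrier (lat R)" for x x'
    using hom_mult[OF proj that] by (simp add: Q_def)
  show "left_perfect Q"
    unfolding left_perfect_def
  proof (intro conjI ballI)
    show "comm_group (lat Q)" using L.abelian_FactGroup[OF N] by (simp add: Q_def)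
    show "comm_group (dlat Q)" using subgroup_comm_group[OF M.comm_group_axioms Dsub] by (simp add: Q_def)
    show "coroots Q \<subseteq> carrier (dlat Q)" using C by (simp add: Q_def)
  next
    fix c assume "c \<in> carrier (lat Q)"
    then obtain x where x: "x \<in> carrier (lat R)" "c = N #>\<^bsub>lat R\<^esub> x" using carQ by blast
    show "pairing Q c \<in> hom (dlat Q) integer_group"
    proof (rule homI)
      fix y z assume "y \<in> carrier (dlat Q)" "z \<in> carrier (dlat Q)"
      then have y: "y \<in> D" and z: "z \<in> D" by (auto simp: Q_def)
      then have "y \<otimes>\<^bsub>dlat R\<^esub> z \<in> D" using Dsub subgroup.m_closed by metis
      then show "pairing Q c (y \<otimes>\<^bsub>dlat Q\<^esub> z) = pairing Q c y \<otimes>\<^bsub>integer_group\<^esub> pairing Q c z"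
        using pQ[OF x(1)] y z x DM hom_integer_groupD[OF left[OF x(1)], of y z] by (simp add: Q_def)
    qed simp
  next
    fix y assume "y \<in> carrier (dlat Q)"
    then have y: "y \<in> D" by (simp add: Q_def)
    show "(\<lambda>c. pairing Q c y) \<in> hom (lat Q) integer_group"
    proof (rule homI)
      fix c d assume "c \<in> carrier (lat Q)" "d \<in> carrier (lat Q)"
      then obtain x x' where x: "x \<in> carrier (lat R)" "x' \<in> carrier (lat R)"
        and eqs: "c = N #>\<^bsub>lat R\<^esub> x" "d = N #>\<^bsub>lat R\<^esub> x'"
        unfolding carQ by blast
      show "pairing Q (c \<otimes>\<^bsub>lat Q\<^esub> d) y = pairing Q c y \<otimes>\<^bsub>integer_group\<^esub> pairing Q d y"
        using x hom_integer_groupD[OF right[OF DM[OF y]] x] pQ[OF _ y]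
        by (simp add: eqs mQ)
    qed simp
  next
    fix \<phi> assume \<phi>: "\<phi> \<in> hom (lat Q) integer_group"
    have "(\<lambda>x. \<phi> (N #>\<^bsub>lat R\<^esub> x)) \<in> hom (lat R) integer_group"
      using hom_compose[OF proj, of \<phi> integer_group] \<phi> by (simp add: comp_def Q_def)
    then obtain y where y: "y \<in> carrier (dlat R)" "\<And>x. x \<in> carrier (lat R) \<Longrightarrow> pairing R x y = \<phi> (N #>\<^bsub>lat R\<^esub> x)"
      using left_perfect_represent[OF R] by blast
    have "pairing R x y = 0" if "x \<in> N" for x
    proof -
      have "N #>\<^bsub>lat R\<^esub> x = N #>\<^bsub>lat R\<^esub> \<one>\<^bsub>lat R\<^esub>"
        using that N NL by (simp add: L.coset_join2 subgroup.one_closed)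
      then have "pairing R x y = pairing R \<one>\<^bsub>lat R\<^esub> y" using y that NL by simp
      then show ?thesis using hom_integer_group_one[OF L.is_group right[OF y(1)]] by simp
    qed
    then have yD: "y \<in> D" using y by (simp add: D)
    show "\<exists>!y. y \<in> carrier (dlat Q) \<and> (\<forall>c\<in>carrier (lat Q). pairing Q c y = \<phi> c)"
    proof (rule ex1I[of _ y])
      show "y \<in> carrier (dlat Q) \<and> (\<forall>c\<in>carrier (lat Q). pairing Q c y = \<phi> c)"
        unfolding carQ using yD y pQ by (auto simp: Q_def)
      fix z assume z: "z \<in> carrier (dlat Q) \<and> (\<forall>c\<in>carrier (lat Q). pairing Q c z = \<phi> c)"
      then have zD: "z \<in> D" by (simp add: Q_def)
      show "z = y"
      proof (rule left_perfect_unique[OF R DM[OF zD] y(1)])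
        fix x assume x: "x \<in> carrier (lat R)"
        then have "pairing Q (N #>\<^bsub>lat R\<^esub> x) z = \<phi> (N #>\<^bsub>lat R\<^esub> x)" using z carQ by blast
        then show "pairing R x z = pairing R x y" using pQ[OF x zD] y(2)[OF x] by simp
      qed
    qed
  qed
qed

section \<open>The derived datum and the radical\<close>

lemma satur_subgroup:
  fixes G (structure)
  assumes "comm_group G" "S \<subseteq> carrier G"
  shows "subgroup (satur G S) G"
proof -
  interpret G: comm_group G by fact
  have sub: "subgroup (generate G S) G" using G.generate_is_subgroup assms by blast
  note pow = group.subgroup_int_pow_closed[OF G.is_group sub]
  have npow: "x [^] (n::nat) \<in> generate G S" if "x \<in> generate G S" for x n
    using pow[OF that, of "int n"] by (simp add: int_pow_int)
  show ?thesis
  proof (rule G.subgroupI)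
    show "satur G S \<noteq> {}"
      using generate.one[of G S] by (auto simp: satur_def intro!: exI[of _ "\<one>"] exI[of _ "1::nat"])
  next
    fix a assume "a \<in> satur G S"
    then obtain n :: nat where n: "a \<in> carrier G" "n > 0" "a [^] n \<in> generate G S"
      by (auto simp: satur_def)
    then have "(inv a) [^] n \<in> generate G S"
      using subgroup.m_inv_closed[OF sub n(3)] by (simp add: G.nat_pow_inv)
    then show "inv a \<in> satur G S" using n by (auto simp: satur_def)
  next
    fix a b assume "a \<in> satur G S" "b \<in> satur G S"
    then obtain n m :: nat where n: "a \<in> carrier G" "n > 0" "a [^] n \<in> generate G S"
      and m: "b \<in> carrier G" "m > 0" "b [^] m \<in> generate G S"
      by (auto simp: satur_def)
    have "(a \<otimes> b) [^] (n * m) = (a [^] n) [^] m \<otimes> (b [^] m) [^] n"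
      using n m by (simp add: G.pow_mult_distrib G.m_comm G.nat_pow_pow mult.commute)
    also have "\<dots> \<in> generate G S" using npow n m by (intro generate.eng) auto
    finally show "a \<otimes> b \<in> satur G S"
      using n m by (auto simp: satur_def intro!: exI[of _ "n * m"])
  qed (auto simp: satur_def)
qed

lemma subset_satur:
  assumes "group G" "S \<subseteq> carrier G"
  shows "S \<subseteq> satur G S"
proof
  interpret group G by fact
  fix x assume "x \<in> S"
  then have x: "x \<in> carrier G" "x \<in> generate G S" using assms(2) by (auto intro: generate.incl)
  have "x [^]\<^bsub>G\<^esub> (1::nat) \<in> generate G S" unfolding nat_pow_eone[OF x(1)] by (rule x(2))
  then show "x \<in> satur G S" unfolding satur_def using x(1) zero_less_one by blast
qed

lemma lattice_torsion_free:
  assumes "lattice G" "x \<in> carrier G" "n > 0" "x [^]\<^bsub>G\<^esub> (n::nat) = \<one>\<^bsub>G\<^esub>"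
  shows "x = \<one>\<^bsub>G\<^esub>"
proof -
  interpret G: comm_group G using assms by (simp add: lattice_def)
  obtain m \<theta> where \<theta>: "\<theta> \<in> iso G (Zlat m)" using assms by (auto simp: lattice_def)
  have h: "\<theta> \<in> hom G (Zlat m)" using \<theta> by (simp add: iso_def)
  have o: "\<theta> \<one>\<^bsub>G\<^esub> = \<one>\<^bsub>Zlat m\<^esub>" using hom_one[OF h G.is_group group_Zlat] .
  then have "\<theta> x [^]\<^bsub>Zlat m\<^esub> n = \<one>\<^bsub>Zlat m\<^esub>"
    using hom_nat_pow_eq[OF G.is_group group_Zlat h assms(2), of n] assms by simp
  then have "\<theta> x = \<theta> \<one>\<^bsub>G\<^esub>" using assms o by (auto simp: nat_pow_Zlat one_Zlat fun_eq_iff)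
  then show ?thesis using \<theta> assms(2) by (auto simp: iso_def bij_betw_def dest: inj_onD)
qed

text \<open>Nondegeneracy on either side is the uniqueness of the element representing the zero
  functional.\<close>

lemma root_datum_root_pairing:
  assumes "root_datum R"
  shows "\<exists>c. root_pairing (lat R) (dlat R) (pairing R) (roots R) c \<and> c ` roots R = coroots R"
proof -
  obtain c where bij: "bij_betw c (roots R) (coroots R)"
    and c: "\<And>\<alpha>. \<alpha> \<in> roots R \<Longrightarrow> pairing R \<alpha> (c \<alpha>) = 2 \<and>
           (\<lambda>x. x \<otimes>\<^bsub>lat R\<^esub> inv\<^bsub>lat R\<^esub> (\<alpha> [^]\<^bsub>lat R\<^esub> pairing R x (c \<alpha>))) ` roots R = roots R \<and>
           (\<lambda>y. y \<otimes>\<^bsub>dlat R\<^esub> inv\<^bsub>dlat R\<^esub> (c \<alpha> [^]\<^bsub>dlat R\<^esub> pairing R \<alpha> y)) ` coroots R = coroots R"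
    using assms unfolding root_datum_def by (elim conjE exE) (rule that, assumption, auto)
  have img: "c ` roots R = coroots R" and inj: "inj_on c (roots R)" using bij by (auto simp: bij_betw_def)
  have L: "comm_group (lat R)" and M: "comm_group (dlat R)"
    using assms by (auto simp: root_datum_def lattice_def)
  interpret L: comm_group "lat R" by fact
  interpret M: comm_group "dlat R" by fact
  have left: "pairing R x \<in> hom (dlat R) integer_group" if "x \<in> carrier (lat R)" for x
    using assms that by (auto simp: root_datum_def)
  have right: "(\<lambda>x. pairing R x y) \<in> hom (lat R) integer_group" if "y \<in> carrier (dlat R)" for y
    using assms that by (auto simp: root_datum_def)
  have "root_pairing (lat R) (dlat R) (pairing R) (roots R) c"
  proof (rule root_pairing.intro)
    fix x assume x: "x \<in> carrier (lat R)" "\<forall>y\<in>carrier (dlat R). pairing R x y = 0"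
    have "(\<lambda>y. 0) \<in> hom (dlat R) integer_group" by (simp add: hom_def)
    then have "\<exists>!x. x \<in> carrier (lat R) \<and> (\<forall>y\<in>carrier (dlat R). pairing R x y = 0)"
      using assms by (auto simp: root_datum_def)
    moreover have "\<forall>y\<in>carrier (dlat R). pairing R \<one>\<^bsub>lat R\<^esub> y = 0"
      using hom_integer_group_one[OF L.is_group right] by blast
    ultimately show "x = \<one>\<^bsub>lat R\<^esub>" using x L.one_closed by blast
  next
    fix y assume y: "y \<in> carrier (dlat R)" "\<forall>x\<in>carrier (lat R). pairing R x y = 0"
    show "y = \<one>\<^bsub>dlat R\<^esub>"
      by (rule left_perfect_unique[OF root_datum_left_perfect[OF assms]])
        (use y hom_integer_group_one[OF M.is_group left] in auto)
  next
    show "roots R \<subseteq> carrier (lat R)" "finite (roots R)" "c ` roots R \<subseteq> carrier (dlat R)"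
      using assms unfolding img by (auto simp: root_datum_def)
  qed (use L M left right c inj img in auto)
  then show ?thesis using img by blast
qed

lemma satur_Int_perpD:
  assumes "root_datum R" "x \<in> satur (lat R) (roots R)" "x \<in> perpD R (coroots R)"
  shows "x = \<one>\<^bsub>lat R\<^esub>"
proof -
  obtain c where rp: "root_pairing (lat R) (dlat R) (pairing R) (roots R) c" and c: "c ` roots R = coroots R"
    using root_datum_root_pairing[OF assms(1)] by blast
  show ?thesis
    by (rule root_pairing.satur_roots_perp_coroots[OF rp assms(2)]) (use assms(3) c in \<open>auto simp: perpD_def\<close>)
qed

lemma root_datum_bilinear:
  assumes "root_datum R"
  shows "comm_group (lat R)" "comm_group (dlat R)" "roots R \<subseteq> carrier (lat R)" "coroots R \<subseteq> carrier (dlat R)"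
    "\<And>x. x \<in> carrier (lat R) \<Longrightarrow> pairing R x \<in> hom (dlat R) integer_group"
    "\<And>y. y \<in> carrier (dlat R) \<Longrightarrow> (\<lambda>x. pairing R x y) \<in> hom (lat R) integer_group"
  using assms by (auto simp: root_datum_def lattice_def)

lemma group_root_datum: "root_datum R \<Longrightarrow> group (lat R)" "root_datum R \<Longrightarrow> group (dlat R)"
  using root_datum_bilinear(1,2) by (auto simp: comm_group_def)

text \<open>The inclusion from right to left is the double annihilator property. It makes the dual
  lattice of the derived datum a full annihilator, as \<open>left_perfect_quotient\<close>
  demands.\<close>

lemma satur_coroots_eq:
  assumes R: "root_datum R"
  shows "satur (dlat R) (coroots R) = {y \<in> carrier (dlat R). \<forall>x\<in>perpD R (coroots R). pairing R x y = 0}"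
proof -
  note B = root_datum_bilinear[OF R]
  obtain c where rp: "root_pairing (lat R) (dlat R) (pairing R) (roots R) c" and c: "c ` roots R = coroots R"
    using root_datum_root_pairing[OF R] by blast
  have "pairing R x y = 0" if y: "y \<in> satur (dlat R) (coroots R)" and x: "x \<in> perpD R (coroots R)" for x y
    by (rule root_pairing.satur_vanish[OF rp y B(4)]) (use x in \<open>auto simp: perpD_def\<close>)
  moreover have "y \<in> satur (dlat R) (coroots R)"
    if "y \<in> carrier (dlat R)" "\<forall>x\<in>perpD R (coroots R). pairing R x y = 0" for y
    using root_pairing.double_perp_coroots[OF rp that(1)] that(2) unfolding c by (auto simp: perpD_def)
  ultimately show ?thesis by (auto simp: satur_def)
qed

text \<open>The counterpart for the radical: an element killed by the roots is killed by everything
  that has a multiple in their span, the integers being torsion-free.\<close>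

lemma perpL_roots_eq:
  assumes R: "root_datum R"
  shows "perpL R (roots R) = {y \<in> carrier (dlat R). \<forall>x\<in>satur (lat R) (roots R). pairing R x y = 0}"
proof -
  note B = root_datum_bilinear[OF R]
  obtain c where rp: "root_pairing (lat R) (dlat R) (pairing R) (roots R) c" and c: "c ` roots R = coroots R"
    using root_datum_root_pairing[OF R] by blast
  have "pairing R x y = 0" if x: "x \<in> satur (lat R) (roots R)" and y: "y \<in> perpL R (roots R)" for x y
    by (rule root_pairing.satur_vanish[OF root_pairing_flip[OF rp] x B(3)]) (use y in \<open>auto simp: perpL_def\<close>)
  then show ?thesis using subset_satur[OF group_root_datum(1)[OF R] B(3)] by (auto simp: perpL_def)
qed

lemma perpD_subgroup:
  assumes R: "root_datum R"
  shows "subgroup (perpD R (coroots R)) (lat R)"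
proof -
  note B = root_datum_bilinear[OF R]
  interpret L: comm_group "lat R" by (rule B)
  have c: "y \<in> coroots R \<Longrightarrow> y \<in> carrier (dlat R)" for y using B(4) by blast
  show ?thesis
  proof (rule L.subgroupI)
    show "perpD R (coroots R) \<noteq> {}"
      using hom_integer_group_one[OF L.is_group B(6)] c by (auto simp: perpD_def)
  qed (use c in \<open>auto simp: perpD_def hom_integer_groupD[OF B(6)] hom_integer_group_inv[OF L.is_group B(6)]\<close>)
qed

lemma rd_der_left_perfect:
  assumes R: "root_datum R"
  shows "left_perfect (rd_der R)"
    and "\<And>x y. x \<in> carrier (lat R) \<Longrightarrow> y \<in> coroots R \<Longrightarrow>
      pairing (rd_der R) (perpD R (coroots R) #>\<^bsub>lat R\<^esub> x) y = pairing R x y"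
proof -
  have sub: "coroots R \<subseteq> satur (dlat R) (coroots R)"
    unfolding satur_coroots_eq[OF R] using root_datum_bilinear(4)[OF R] by (auto simp: perpD_def)
  note q = left_perfect_quotient[OF root_datum_left_perfect[OF R] perpD_subgroup[OF R] satur_coroots_eq[OF R] sub,
      folded rd_der_def, where \<Psi> = "(\<lambda>\<alpha>. perpD R (coroots R) #>\<^bsub>lat R\<^esub> \<alpha>) ` roots R", folded rd_der_def]
  show "left_perfect (rd_der R)" by (rule q)
  show "pairing (rd_der R) (perpD R (coroots R) #>\<^bsub>lat R\<^esub> x) y = pairing R x y"
    if "x \<in> carrier (lat R)" "y \<in> coroots R" for x y
    using q(2) that sub by blast
qed

lemma rd_rad_left_perfect:
  assumes R: "root_datum R"
  shows "left_perfect (rd_rad R)"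
  unfolding rd_rad_def
  by (rule left_perfect_quotient(1)[OF root_datum_left_perfect[OF R]
        satur_subgroup[OF root_datum_bilinear(1,3)[OF R]] perpL_roots_eq[OF R]]) simp

lemma Mod_projection_epi:
  assumes "comm_group G" "subgroup N G"
  shows "(\<lambda>x. N #>\<^bsub>G\<^esub> x) \<in> epi G (G Mod N)"
    and "\<And>x. x \<in> carrier G \<Longrightarrow> N #>\<^bsub>G\<^esub> x = \<one>\<^bsub>G Mod N\<^esub> \<longleftrightarrow> x \<in> N"
proof -
  interpret G: comm_group G by fact
  have "N \<lhd> G" using assms G.normal_iff_subgroup by blast
  then have "(\<lambda>x. N #>\<^bsub>G\<^esub> x) \<in> hom G (G Mod N)" by (rule normal.r_coset_hom_Mod)
  then show "(\<lambda>x. N #>\<^bsub>G\<^esub> x) \<in> epi G (G Mod N)" by (auto simp: epi_def FactGroup_def RCOSETS_def)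
  show "N #>\<^bsub>G\<^esub> x = \<one>\<^bsub>G Mod N\<^esub> \<longleftrightarrow> x \<in> N" if "x \<in> carrier G" for x
    using that assms G.coset_join1 G.coset_join2 by (auto simp: FactGroup_def)
qed

lemma comm_group_DirProd: "comm_group G \<Longrightarrow> comm_group H \<Longrightarrow> comm_group (G \<times>\<times> H)"
  by (rule group.group_comm_groupI)
    (auto simp: DirProd_group comm_group_def comm_monoid.m_comm)

section \<open>Data induced by a sublattice\<close>

lemma dual_group_comm_group:
  assumes "comm_group G"
  shows "comm_group (dual_group G)"
proof -
  interpret G: comm_group G by fact
  show ?thesis
  proof (rule comm_groupI)
    fix \<phi> assume \<phi>: "\<phi> \<in> carrier (dual_group G)"
    show "\<exists>\<psi>\<in>carrier (dual_group G). \<psi> \<otimes>\<^bsub>dual_group G\<^esub> \<phi> = \<one>\<^bsub>dual_group G\<^esub>"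
      by (rule bexI[of _ "\<lambda>x\<in>carrier G. - \<phi> x"])
        (use \<phi> in \<open>auto simp: dual_group_def hom_def fun_eq_iff\<close>)
  qed (auto simp: dual_group_def hom_def fun_eq_iff extensional_def)
qed

text \<open>The dual lattice consists of all extensional functionals on \<open>M\<close>, so a
  functional is represented by its own restriction, and extensionality gives uniqueness.\<close>

lemma left_perfect_induced:
  assumes S: "comm_group (lat S)" and M: "subgroup M (lat S)"
    and c: "\<And>c. c \<in> coroots S \<Longrightarrow> (\<lambda>x. pairing S x c) \<in> hom (lat S) integer_group"
  shows "left_perfect (rd_induced S M)"
proof -
  have G: "comm_group ((lat S)\<lparr>carrier := M\<rparr>)" by (rule subgroup_comm_group[OF S M])
  have MS: "x \<in> M \<Longrightarrow> x \<in> carrier (lat S)" for x using M subgroup.subset by blast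
  have Mm: "x \<in> M \<Longrightarrow> y \<in> M \<Longrightarrow> x \<otimes>\<^bsub>lat S\<^esub> y \<in> M" for x y using M subgroup.m_closed by metis
  show ?thesis
    unfolding left_perfect_def
  proof (intro conjI ballI)
    show "comm_group (lat (rd_induced S M))" using G by (simp add: rd_induced_def)
    show "comm_group (dlat (rd_induced S M))" using dual_group_comm_group[OF G] by (simp add: rd_induced_def)
    show "coroots (rd_induced S M) \<subseteq> carrier (dlat (rd_induced S M))"
      using MS Mm by (auto simp: rd_induced_def dual_group_def hom_def hom_integer_groupD[OF c])
  next
    fix x assume "x \<in> carrier (lat (rd_induced S M))"
    then show "pairing (rd_induced S M) x \<in> hom (dlat (rd_induced S M)) integer_group"
      by (auto simp: rd_induced_def dual_group_def hom_def)
  next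
    fix y assume "y \<in> carrier (dlat (rd_induced S M))"
    then show "(\<lambda>x. pairing (rd_induced S M) x y) \<in> hom (lat (rd_induced S M)) integer_group"
      by (auto simp: rd_induced_def dual_group_def hom_def)
  next
    fix \<phi> assume \<phi>: "\<phi> \<in> hom (lat (rd_induced S M)) integer_group"
    show "\<exists>!y. y \<in> carrier (dlat (rd_induced S M)) \<and>
      (\<forall>x\<in>carrier (lat (rd_induced S M)). pairing (rd_induced S M) x y = \<phi> x)"
    proof (rule ex1I[of _ "restrict \<phi> M"])
      show "restrict \<phi> M \<in> carrier (dlat (rd_induced S M)) \<and>
        (\<forall>x\<in>carrier (lat (rd_induced S M)). pairing (rd_induced S M) x (restrict \<phi> M) = \<phi> x)"
        using \<phi> Mm by (auto simp: rd_induced_def dual_group_def hom_def)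
      fix y assume "y \<in> carrier (dlat (rd_induced S M)) \<and>
        (\<forall>x\<in>carrier (lat (rd_induced S M)). pairing (rd_induced S M) x y = \<phi> x)"
      then show "y = restrict \<phi> M"
        by (auto simp: rd_induced_def dual_group_def extensional_def fun_eq_iff)
    qed
  qed
qed

section \<open>Presentations of central products\<close>

definition fibre :: "('a, 'b) rdatum \<Rightarrow> ('c, 'd) rdatum \<Rightarrow> ('a \<Rightarrow> 'e) \<Rightarrow> ('c \<Rightarrow> 'e) \<Rightarrow> ('a \<times> 'c) set" where
  "fibre R T h g = {(x, t). x \<in> carrier (lat R) \<and> t \<in> carrier (lat T) \<and> h x = g t}"

lemma mem_fibre: "(x, t) \<in> fibre R T h g \<longleftrightarrow> x \<in> carrier (lat R) \<and> t \<in> carrier (lat T) \<and> h x = g t"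
  by (simp add: fibre_def)

text \<open>\<open>(p, q)\<close> identifies \<open>R'\<close> with the central product of \<open>R\<close> and the torus \<open>T\<close> along \<open>h\<close> and \<open>g\<close>.\<close>

definition fibre_pres :: "('i, 'j) rdatum \<Rightarrow> ('a, 'b) rdatum \<Rightarrow> ('c, 'd) rdatum \<Rightarrow> ('a \<Rightarrow> 'e) \<Rightarrow> ('c \<Rightarrow> 'e)
    \<Rightarrow> ('i \<Rightarrow> 'a) \<Rightarrow> ('i \<Rightarrow> 'c) \<Rightarrow> bool" where
  "fibre_pres R' R T h g p q \<longleftrightarrow>
     p \<in> hom (lat R') (lat R) \<and> q \<in> hom (lat R') (lat T) \<and>
     inj_on (\<lambda>x. (p x, q x)) (carrier (lat R')) \<and>
     (\<lambda>x. (p x, q x)) ` carrier (lat R') = fibre R T h g \<and>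
     p ` roots R' = roots R \<and> (\<forall>\<alpha>\<in>roots R'. q \<alpha> = \<one>\<^bsub>lat T\<^esub>) \<and> coroots_match R' R p"

lemma fibre_presD:
  assumes "fibre_pres R' R T h g p q"
  shows "p \<in> hom (lat R') (lat R)" "q \<in> hom (lat R') (lat T)" "p ` roots R' = roots R"
    "\<And>\<alpha>. \<alpha> \<in> roots R' \<Longrightarrow> q \<alpha> = \<one>\<^bsub>lat T\<^esub>"
    "coroots_match R' R p"
    "\<And>x x'. x \<in> carrier (lat R') \<Longrightarrow> x' \<in> carrier (lat R') \<Longrightarrow> p x = p x' \<Longrightarrow> q x = q x' \<Longrightarrow> x = x'"
    "\<And>x. x \<in> carrier (lat R') \<Longrightarrow> h (p x) = g (q x)"
    "\<And>x t. x \<in> carrier (lat R) \<Longrightarrow> t \<in> carrier (lat T) \<Longrightarrow> h x = g t \<Longrightarrow>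
       \<exists>x'\<in>carrier (lat R'). p x' = x \<and> q x' = t"
proof -
  have im: "(\<lambda>x. (p x, q x)) ` carrier (lat R') = fibre R T h g" using assms by (simp add: fibre_pres_def)
  show "h (p x) = g (q x)" if "x \<in> carrier (lat R')" for x
  proof -
    have "(p x, q x) \<in> fibre R T h g" unfolding im[symmetric] using that by blast
    then show ?thesis by (simp add: mem_fibre)
  qed
  show "\<exists>x'\<in>carrier (lat R'). p x' = x \<and> q x' = t"
    if "x \<in> carrier (lat R)" "t \<in> carrier (lat T)" "h x = g t" for x t
  proof -
    have "(x, t) \<in> (\<lambda>x. (p x, q x)) ` carrier (lat R')" unfolding im using that by (simp add: mem_fibre)
    then show ?thesis by auto
  qed
qed (use assms in \<open>auto simp: fibre_pres_def inj_on_def\<close>)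

text \<open>A is kept abstract; the subgroup K of the theorem is present as the kernel of
  \<open>h\<close>.\<close>

locale central_product =
  fixes R :: "('a, 'b) rdatum" and T :: "('c, 'd) rdatum" and A :: "'e monoid" (structure) and h :: "'a \<Rightarrow> 'e"
  assumes R: "root_datum R" and ss: "semisimple R"
    and T: "root_datum T" and roots_T: "roots T = {}" and coroots_T: "coroots T = {}"
    and A: "comm_group A" and h: "h \<in> epi (lat R) A" and h_root: "\<alpha> \<in> roots R \<Longrightarrow> h \<alpha> = \<one>"
begin

interpretation L: comm_group "lat R" by (rule root_datum_bilinear(1)[OF R])
interpretation T: comm_group "lat T" by (rule root_datum_bilinear(1)[OF T])
interpretation A: comm_group A by (rule A)

lemma h_hom: "h \<in> hom (lat R) A" and h_surj: "h ` carrier (lat R) = carrier A"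
  using h by (auto simp: epi_def)

lemma h_in: "x \<in> carrier (lat R) \<Longrightarrow> h x \<in> carrier A"
  using hom_in_carrier[OF h_hom] .

lemma h_one: "h \<one>\<^bsub>lat R\<^esub> = \<one>"
  using hom_one[OF h_hom L.is_group A.is_group] .

text \<open>Semisimplicity puts a multiple of every lattice element into the span of the roots,
  which \<open>h\<close> kills. This is the torsion hypothesis for comparing kernels of surjections
  onto A.\<close>

lemma A_torsion:
  assumes "a \<in> carrier A"
  shows "\<exists>k::nat. k > 0 \<and> a [^] k = \<one>"
proof -
  obtain x where x: "x \<in> carrier (lat R)" "a = h x" using assms h_surj by blast
  have "x \<in> satur (lat R) (roots R)" using ss x by (simp add: semisimple_def)
  then obtain n :: nat where n: "n > 0" "x [^]\<^bsub>lat R\<^esub> n \<in> generate (lat R) (roots R)" by (auto simp: satur_def)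
  have "subgroup (kernel (lat R) A h) (lat R)"
    using h_hom by (intro group_hom.subgroup_kernel group_hom.intro group_hom_axioms.intro) unfold_locales
  moreover have "roots R \<subseteq> kernel (lat R) A h"
    using h_root root_datum_bilinear(3)[OF R] by (auto simp: kernel_def)
  ultimately have "x [^]\<^bsub>lat R\<^esub> n \<in> kernel (lat R) A h"
    using n L.generate_subgroup_incl by blast
  then have "a [^] n = \<one>"
    using hom_nat_pow_eq[OF L.is_group A.is_group h_hom x(1), of n] x by (simp add: kernel_def)
  then show ?thesis using n by blast
qed

lemma fibre_subgroup:
  assumes g: "g \<in> hom (lat T) A"
  shows "subgroup (fibre R T h g) (lat R \<times>\<times> lat T)"
proof -
  interpret LT: group "lat R \<times>\<times> lat T" by (rule DirProd_group) unfold_locales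
  show ?thesis
  proof (rule LT.subgroupI)
    have "(\<one>\<^bsub>lat R\<^esub>, \<one>\<^bsub>lat T\<^esub>) \<in> fibre R T h g"
      using h_one hom_one[OF g] by (simp add: mem_fibre T.is_group A.is_group)
    then show "fibre R T h g \<noteq> {}" by blast
  next
    fix z assume "z \<in> fibre R T h g"
    then show "inv\<^bsub>lat R \<times>\<times> lat T\<^esub> z \<in> fibre R T h g"
      by (cases z) (auto simp: mem_fibre inv_DirProd[OF L.is_group T.is_group]
          hom_inv_eq[OF L.is_group A.is_group h_hom] hom_inv_eq[OF T.is_group A.is_group g])
  next
    fix z w assume "z \<in> fibre R T h g" "w \<in> fibre R T h g"
    then show "z \<otimes>\<^bsub>lat R \<times>\<times> lat T\<^esub> w \<in> fibre R T h g"
      by (cases z; cases w) (auto simp: mem_fibre hom_mult[OF h_hom] hom_mult[OF g])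
  qed (auto simp: fibre_def)
qed

lemma pairing_T_one: "t \<in> carrier (lat T) \<Longrightarrow> pairing T t \<one>\<^bsub>dlat T\<^esub> = 0"
  using hom_integer_group_one[OF group_root_datum(2)[OF T] root_datum_bilinear(5)[OF T]] .

lemma cprod_simps:
  "lat (cprod R T h g) = (lat R \<times>\<times> lat T)\<lparr>carrier := fibre R T h g\<rparr>"
  "roots (cprod R T h g) = (\<lambda>\<alpha>. (\<alpha>, \<one>\<^bsub>lat T\<^esub>)) ` roots R"
  "coroots (cprod R T h g) = (\<lambda>y. \<lambda>m\<in>fibre R T h g. pairing R (fst m) y) ` coroots R"
  "pairing (cprod R T h g) m \<phi> = \<phi> m"
proof -
  \<comment> \<open>The torus component of a coroot is trivial and pairs to 0, so coroots are pulled
    back along the first projection.\<close>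
  have "coroots (cprod R T h g) =
      (\<lambda>y. \<lambda>m\<in>fibre R T h g. pairing R (fst m) y + pairing T (snd m) \<one>\<^bsub>dlat T\<^esub>) ` coroots R"
    by (simp add: cprod_def rd_induced_def rd_dsum_def coroots_T image_image fibre_def case_prod_beta)
  also have "\<dots> = (\<lambda>y. \<lambda>m\<in>fibre R T h g. pairing R (fst m) y) ` coroots R"
    by (intro image_cong refl restrict_ext) (auto simp: mem_fibre pairing_T_one)
  finally show "coroots (cprod R T h g) = (\<lambda>y. \<lambda>m\<in>fibre R T h g. pairing R (fst m) y) ` coroots R" .
qed (simp_all add: cprod_def rd_induced_def rd_dsum_def roots_T fibre_def)

lemma coroots_match_fst: "coroots_match (cprod R T h g) R fst"
proof -
  have "coroots_match (cprod R T h g) R fst \<longleftrightarrow>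
      (\<forall>y\<in>coroots R. \<exists>y'\<in>coroots R. \<forall>m\<in>fibre R T h g. pairing R (fst m) y' = pairing R (fst m) y)"
    unfolding coroots_match_def cprod_simps by auto
  then show ?thesis by blast
qed

lemma left_perfect_cprod:
  assumes g: "g \<in> hom (lat T) A"
  shows "left_perfect (cprod R T h g)"
  unfolding cprod_def fibre_def[symmetric]
proof (rule left_perfect_induced)
  show "comm_group (lat (rd_dsum R T))"
    using comm_group_DirProd[OF L.comm_group_axioms T.comm_group_axioms] by (simp add: rd_dsum_def)
  show "subgroup (fibre R T h g) (lat (rd_dsum R T))" using fibre_subgroup[OF g] by (simp add: rd_dsum_def)
  fix c assume "c \<in> coroots (rd_dsum R T)"
  then obtain y where y: "y \<in> coroots R" "c = (y, \<one>\<^bsub>dlat T\<^esub>)" by (auto simp: rd_dsum_def coroots_T)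
  then have yR: "y \<in> carrier (dlat R)" using root_datum_bilinear(4)[OF R] by blast
  show "(\<lambda>x. pairing (rd_dsum R T) x c) \<in> hom (lat (rd_dsum R T)) integer_group"
    using y by (auto simp: hom_def rd_dsum_def pairing_T_one hom_integer_groupD[OF root_datum_bilinear(6)[OF R yR]])
qed

text \<open>The two components of a lattice isomorphism form a presentation, and conversely; the
  dual half is automatic. From here on central products are handled through \<open>p\<close> and
  \<open>q\<close>, with their dual lattices out of sight.\<close>

lemma isomorphic_cprod_iff:
  assumes R': "left_perfect R'" and g: "g \<in> hom (lat T) A"
  shows "rd_isomorphic R' (cprod R T h g) \<longleftrightarrow> (\<exists>p q. fibre_pres R' R T h g p q)"
proof
  assume "rd_isomorphic R' (cprod R T h g)"
  then obtain \<phi> where \<phi>: "lat_iso R' (cprod R T h g) \<phi>"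
    using R' rd_iso_imp_lat_iso unfolding rd_isomorphic_def left_perfect_def by blast
  have iso: "\<phi> \<in> iso (lat R') ((lat R \<times>\<times> lat T)\<lparr>carrier := fibre R T h g\<rparr>)"
    using \<phi> by (simp add: lat_iso_def cprod_simps)
  have im: "\<phi> ` carrier (lat R') = fibre R T h g" and inj: "inj_on \<phi> (carrier (lat R'))"
    using iso by (auto simp: iso_def bij_betw_def)
  have c: "\<phi> x \<in> fibre R T h g" if "x \<in> carrier (lat R')" for x using im that by blast
  have mult: "\<phi> (x \<otimes>\<^bsub>lat R'\<^esub> y) = \<phi> x \<otimes>\<^bsub>lat R \<times>\<times> lat T\<^esub> \<phi> y"
    if "x \<in> carrier (lat R')" "y \<in> carrier (lat R')" for x y
    using iso that by (auto simp: iso_def hom_def)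
  have rt: "\<phi> ` roots R' = (\<lambda>\<alpha>. (\<alpha>, \<one>\<^bsub>lat T\<^esub>)) ` roots R" using \<phi> by (simp add: lat_iso_def cprod_simps)
  have "fibre_pres R' R T h g (\<lambda>x. fst (\<phi> x)) (\<lambda>x. snd (\<phi> x))"
    unfolding fibre_pres_def
  proof (intro conjI ballI)
    show "(\<lambda>x. fst (\<phi> x)) \<in> hom (lat R') (lat R)"
    proof (rule homI)
      fix x assume "x \<in> carrier (lat R')"
      from c[OF this] show "fst (\<phi> x) \<in> carrier (lat R)" by (cases "\<phi> x") (simp add: mem_fibre)
    qed (simp add: mult mult_DirProd')
    show "(\<lambda>x. snd (\<phi> x)) \<in> hom (lat R') (lat T)"
    proof (rule homI)
      fix x assume "x \<in> carrier (lat R')"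
      from c[OF this] show "snd (\<phi> x) \<in> carrier (lat T)" by (cases "\<phi> x") (simp add: mem_fibre)
    qed (simp add: mult mult_DirProd')
    show "inj_on (\<lambda>x. (fst (\<phi> x), snd (\<phi> x))) (carrier (lat R'))" using inj by simp
    show "(\<lambda>x. (fst (\<phi> x), snd (\<phi> x))) ` carrier (lat R') = fibre R T h g" using im by simp
    have "(\<lambda>x. fst (\<phi> x)) ` roots R' = fst ` \<phi> ` roots R'" by (simp only: image_image)
    also have "\<dots> = roots R" unfolding rt by (simp add: image_image)
    finally show "(\<lambda>x. fst (\<phi> x)) ` roots R' = roots R" .
    show "snd (\<phi> \<alpha>) = \<one>\<^bsub>lat T\<^esub>" if "\<alpha> \<in> roots R'" for \<alpha>
    proof -
      have "\<phi> \<alpha> \<in> (\<lambda>\<alpha>. (\<alpha>, \<one>\<^bsub>lat T\<^esub>)) ` roots R" unfolding rt[symmetric] using that by blast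
      then show ?thesis by auto
    qed
    show "coroots_match R' R (\<lambda>x. fst (\<phi> x))"
      by (rule coroots_match_comp[OF _ coroots_match_fst[of g]]) (use \<phi> c in \<open>simp_all add: lat_iso_def cprod_simps(1)\<close>)
  qed
  then show "\<exists>p q. fibre_pres R' R T h g p q" by blast
next
  assume "\<exists>p q. fibre_pres R' R T h g p q"
  then obtain p q where pq: "fibre_pres R' R T h g p q" by blast
  note D = fibre_presD[OF pq]
  define \<phi> where "\<phi> x = (p x, q x)" for x
  have im: "\<phi> ` carrier (lat R') = fibre R T h g" and inj: "inj_on \<phi> (carrier (lat R'))"
    using pq unfolding \<phi>_def fibre_pres_def by auto
  have c: "\<phi> x \<in> fibre R T h g" if "x \<in> carrier (lat R')" for x using im that by blast
  have "lat_iso R' (cprod R T h g) \<phi>"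
    unfolding lat_iso_def
  proof (intro conjI)
    show "\<phi> \<in> iso (lat R') (lat (cprod R T h g))"
      unfolding cprod_simps
    proof (rule isoI)
      show "\<phi> \<in> hom (lat R') ((lat R \<times>\<times> lat T)\<lparr>carrier := fibre R T h g\<rparr>)"
        by (rule homI) (auto simp: c, auto simp: \<phi>_def hom_mult[OF D(1)] hom_mult[OF D(2)])
    qed (use im inj in \<open>simp add: bij_betw_def\<close>)
    have "\<phi> ` roots R' = (\<lambda>\<alpha>. (\<alpha>, \<one>\<^bsub>lat T\<^esub>)) ` p ` roots R'"
      unfolding image_image by (rule image_cong) (simp_all add: \<phi>_def D(4))
    then show "\<phi> ` roots R' = roots (cprod R T h g)" unfolding cprod_simps D(3) .
    show "coroots_match R' (cprod R T h g) \<phi>"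
      by (rule coroots_match_cancel_left[OF coroots_match_fst]) (use D(5) c in \<open>simp_all add: \<phi>_def cprod_simps(1)\<close>)
  qed
  then show "rd_isomorphic R' (cprod R T h g)"
    using lat_iso_imp_rd_iso[OF R' left_perfect_cprod[OF g]] by (auto simp: rd_isomorphic_def)
qed

end

section \<open>Recognising the derived datum and the radical\<close>

lemma coroots_match_der:
  assumes "root_datum R"
  shows "coroots_match R (rd_der R) (\<lambda>x. perpD R (coroots R) #>\<^bsub>lat R\<^esub> x)"
  by (rule coroots_match_image[of _ "\<lambda>y. y"]) (simp add: rd_der_def, rule rd_der_left_perfect(2)[OF assms])

text \<open>The isomorphism theorem supplies the lattice half \<phi>. The coroots of the quotient
  match those of \<open>S\<close> because both match the coroots of \<open>R'\<close>, and the
  projection is surjective.\<close>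

lemma rd_der_iso_of_epi:
  assumes R': "root_datum R'" and S: "root_datum S" and p: "p \<in> epi (lat R') (lat S)"
    and ker: "\<And>x. x \<in> carrier (lat R') \<Longrightarrow> p x = \<one>\<^bsub>lat S\<^esub> \<longleftrightarrow> x \<in> perpD R' (coroots R')"
    and rt: "p ` roots R' = roots S"
    and cm: "coroots_match R' S p"
  shows "\<exists>\<phi> \<psi>. rd_iso (rd_der R') S \<phi> \<psi> \<and>
    (\<forall>x\<in>carrier (lat R'). \<phi> (perpD R' (coroots R') #>\<^bsub>lat R'\<^esub> x) = p x)"
proof -
  let ?N = "perpD R' (coroots R')"
  note C = root_datum_bilinear(1)[OF R']
  note N = perpD_subgroup[OF R']
  note pr = Mod_projection_epi[OF C N]
  have gN: "group (lat R' Mod ?N)" using comm_group.abelian_FactGroup[OF C N] by (simp add: comm_group_def)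
  obtain \<phi> where \<phi>: "\<phi> \<in> iso (lat R' Mod ?N) (lat S)" "\<And>x. x \<in> carrier (lat R') \<Longrightarrow> \<phi> (?N #>\<^bsub>lat R'\<^esub> x) = p x"
    using iso_factor_epi[OF group_root_datum(1)[OF R'] gN group_root_datum(1)[OF S] pr(1) p] pr(2) ker by blast
  have car: "carrier (lat (rd_der R')) = (\<lambda>x. ?N #>\<^bsub>lat R'\<^esub> x) ` carrier (lat R')"
    using pr(1) by (simp add: rd_der_def epi_def)
  have "lat_iso (rd_der R') S \<phi>"
    unfolding lat_iso_def
  proof (intro conjI)
    show "\<phi> \<in> iso (lat (rd_der R')) (lat S)" using \<phi> by (simp add: rd_der_def)
    have "\<phi> ` roots (rd_der R') = (\<lambda>\<alpha>. \<phi> (?N #>\<^bsub>lat R'\<^esub> \<alpha>)) ` roots R'" by (simp add: rd_der_def image_image)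
    also have "\<dots> = p ` roots R'" using \<phi>(2) root_datum_bilinear(3)[OF R'] by (intro image_cong) auto
    finally show "\<phi> ` roots (rd_der R') = roots S" using rt by simp
    show "coroots_match (rd_der R') S \<phi>"
      by (rule coroots_match_cancel_right[OF coroots_match_der[OF R'] cm]) (simp_all add: car \<phi>(2))
  qed
  then obtain \<psi> where "rd_iso (rd_der R') S \<phi> \<psi>"
    using lat_iso_imp_rd_iso[OF rd_der_left_perfect(1)[OF R'] root_datum_left_perfect[OF S]] by blast
  then show ?thesis using \<phi>(2) by blast
qed

lemma lat_iso_torus:
  assumes "roots S = {}" "coroots S = {}" "roots T = {}" "coroots T = {}" "u \<in> iso (lat S) (lat T)"
  shows "lat_iso S T u"
  using assms by (simp add: lat_iso_def coroots_match_def)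

text \<open>Between tori there are no roots or coroots to respect, so the kernel of \<open>q\<close>
  decides.\<close>

lemma rd_rad_iso_of_epi:
  assumes R': "root_datum R'" and T: "root_datum T" "roots T = {}" "coroots T = {}"
    and q: "q \<in> epi (lat R') (lat T)"
    and ker: "\<And>x. x \<in> carrier (lat R') \<Longrightarrow> q x = \<one>\<^bsub>lat T\<^esub> \<longleftrightarrow> x \<in> satur (lat R') (roots R')"
  shows "rd_isomorphic (rd_rad R') T"
proof -
  let ?N = "satur (lat R') (roots R')"
  note C = root_datum_bilinear(1)[OF R']
  note N = satur_subgroup[OF root_datum_bilinear(1,3)[OF R']]
  note pr = Mod_projection_epi[OF C N]
  have gN: "group (lat R' Mod ?N)" using comm_group.abelian_FactGroup[OF C N] by (simp add: comm_group_def)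
  obtain \<phi> where \<phi>: "\<phi> \<in> iso (lat R' Mod ?N) (lat T)"
    using iso_factor_epi[OF group_root_datum(1)[OF R'] gN group_root_datum(1)[OF T(1)] pr(1) q] pr(2) ker by blast
  have "lat_iso (rd_rad R') T \<phi>"
    by (rule lat_iso_torus) (use T \<phi> in \<open>simp_all add: rd_rad_def\<close>)
  then show ?thesis
    using lat_iso_imp_rd_iso[OF rd_rad_left_perfect[OF R'] root_datum_left_perfect[OF T(1)]]
    unfolding rd_isomorphic_def by blast
qed

text \<open>As \<open>p\<close> kills \<open>N\<close>, the factor \<open>N\<close> leaves no trace
  in the image. This converts the condition on K in \<open>rd_RTK\<close> into one about
  \<open>p\<close> on the saturation of the roots.\<close>

lemma image_coset_image_set_mult:
  fixes G (structure)
  assumes G: "comm_group G" and N: "subgroup N G" and S: "S \<subseteq> carrier G" and H: "group H" and p: "p \<in> hom G H"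
    and ker: "\<And>x. x \<in> N \<Longrightarrow> p x = \<one>\<^bsub>H\<^esub>"
    and \<phi>: "\<And>x. x \<in> carrier G \<Longrightarrow> \<phi> (N #> x) = p x"
  shows "\<phi> ` ((\<lambda>z. N #> z) ` (S <#> N)) = p ` S"
proof -
  interpret G: comm_group G by fact
  interpret H: group H by fact
  have NG: "n \<in> N \<Longrightarrow> n \<in> carrier G" for n using N subgroup.subset by blast
  have SG: "s \<in> S \<Longrightarrow> s \<in> carrier G" for s using S by blast
  have e: "\<phi> (N #> (s \<otimes> n)) = p s" if "s \<in> S" "n \<in> N" for s n
    using that SG NG by (simp add: \<phi> hom_mult[OF p] ker hom_in_carrier[OF p])
  show ?thesis
  proof (intro equalityI subsetI)
    fix z assume "z \<in> \<phi> ` ((\<lambda>z. N #> z) ` (S <#> N))"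
    then obtain s n where "s \<in> S" "n \<in> N" "z = \<phi> (N #> (s \<otimes> n))" by (auto simp: set_mult_def)
    then show "z \<in> p ` S" using e by auto
  next
    fix z assume "z \<in> p ` S"
    then obtain s where s: "s \<in> S" "z = p s" by blast
    then have "z = \<phi> (N #> (s \<otimes> \<one>))" using e subgroup.one_closed[OF N] by simp
    moreover have "s \<otimes> \<one> \<in> S <#> N" unfolding set_mult_def using s subgroup.one_closed[OF N] by blast
    ultimately show "z \<in> \<phi> ` ((\<lambda>z. N #> z) ` (S <#> N))" by blast
  qed
qed

lemma iso_eq_one_iff:
  assumes "k \<in> iso G H" "group G" "group H" "c \<in> carrier G"
  shows "k c = \<one>\<^bsub>H\<^esub> \<longleftrightarrow> c = \<one>\<^bsub>G\<^esub>"
proof -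
  have h: "k \<in> hom G H" and i: "inj_on k (carrier G)" using assms(1) by (auto simp: iso_def bij_betw_def)
  have "\<one>\<^bsub>G\<^esub> \<in> carrier G" using assms(2) by (simp add: group.is_monoid)
  then show ?thesis using hom_one[OF h assms(2,3)] inj_onD[OF i, of c "\<one>\<^bsub>G\<^esub>"] assms(4) by auto
qed

lemma autoI_iso:
  assumes "k \<in> iso G G" "group G"
  shows "restrict k (carrier G) \<in> auto G"
proof -
  have h: "k \<in> hom G G" and b: "bij_betw k (carrier G) (carrier G)" using assms by (auto simp: iso_def)
  have "restrict k (carrier G) \<in> hom G G"
    using h assms(2) by (auto simp: hom_def Pi_iff group.is_monoid monoid.m_closed)
  moreover have "bij_betw (restrict k (carrier G)) (carrier G) (carrier G)"
    using b by (simp cong: bij_betw_cong)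
  ultimately show ?thesis by (simp add: auto_def Bij_def)
qed

lemma auto_imp_iso: "k \<in> auto G \<Longrightarrow> k \<in> iso G G"
  by (simp add: auto_def Bij_def iso_def)

section \<open>Presentations: intrinsic kernels, change, existence\<close>

context central_product
begin

interpretation L: comm_group "lat R" by (rule root_datum_bilinear(1)[OF R])
interpretation T: comm_group "lat T" by (rule root_datum_bilinear(1)[OF T])
interpretation A: comm_group A by (rule A)

text \<open>Both kernels are described by \<open>R'\<close> alone, which makes two presentations of
  one datum comparable. The last item recovers the kernel of \<open>h\<close>, that is K, from the
  saturation of the roots.\<close>

lemma fibre_pres_kernels:
  assumes R': "root_datum R'" and g: "g \<in> epi (lat T) A" and pq: "fibre_pres R' R T h g p q"
  shows "p \<in> epi (lat R') (lat R)" and "q \<in> epi (lat R') (lat T)"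
    and "\<And>x. x \<in> carrier (lat R') \<Longrightarrow> p x = \<one>\<^bsub>lat R\<^esub> \<longleftrightarrow> x \<in> perpD R' (coroots R')"
    and "\<And>x. x \<in> carrier (lat R') \<Longrightarrow> q x = \<one>\<^bsub>lat T\<^esub> \<longleftrightarrow> x \<in> satur (lat R') (roots R')"
    and "p ` satur (lat R') (roots R') = {x \<in> carrier (lat R). h x = \<one>}"
proof -
  note D = fibre_presD[OF pq]
  interpret L': comm_group "lat R'" by (rule root_datum_bilinear(1)[OF R'])
  have gh: "g \<in> hom (lat T) A" and gs: "g ` carrier (lat T) = carrier A" using g by (auto simp: epi_def)
  show "p \<in> epi (lat R') (lat R)"
    unfolding epi_iff_subset
  proof (intro conjI subsetI D(1))
    fix x assume x: "x \<in> carrier (lat R)"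
    then have "h x \<in> g ` carrier (lat T)" using gs h_in by simp
    then show "x \<in> p ` carrier (lat R')" using D(8)[OF x] by blast
  qed
  show "q \<in> epi (lat R') (lat T)"
    unfolding epi_iff_subset
  proof (intro conjI subsetI D(2))
    fix t assume t: "t \<in> carrier (lat T)"
    then have "g t \<in> h ` carrier (lat R)" using hom_in_carrier[OF gh] h_surj by simp
    then obtain x where x: "x \<in> carrier (lat R)" "g t = h x" by blast
    show "t \<in> q ` carrier (lat R')" using D(8)[OF x(1) t x(2)[symmetric]] by blast
  qed
  show "p x = \<one>\<^bsub>lat R\<^esub> \<longleftrightarrow> x \<in> perpD R' (coroots R')" if x: "x \<in> carrier (lat R')" for x
  proof
    assume px: "p x = \<one>\<^bsub>lat R\<^esub>"
    have "pairing R' x y = 0" if y: "y \<in> coroots R'" for y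
    proof -
      obtain y' where y': "y' \<in> coroots R" "pairing R (p x) y' = pairing R' x y" using coroots_matchD(1)[OF D(5) y] x by blast
      have "y' \<in> carrier (dlat R)" using y' root_datum_bilinear(4)[OF R] by blast
      then show ?thesis
        using y' px hom_integer_group_one[OF L.is_group root_datum_bilinear(6)[OF R]] by simp
    qed
    then show "x \<in> perpD R' (coroots R')" using x by (simp add: perpD_def)
  next
    assume xp: "x \<in> perpD R' (coroots R')"
    have px: "p x \<in> carrier (lat R)" using hom_in_carrier[OF D(1) x] .
    have "pairing R (p x) y' = 0" if y': "y' \<in> coroots R" for y'
    proof -
      obtain y where "y \<in> coroots R'" "pairing R (p x) y' = pairing R' x y" using coroots_matchD(2)[OF D(5) y'] x by blast
      then show ?thesis using xp by (simp add: perpD_def)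
    qed
    \<comment> \<open>Semisimplicity puts \<open>p x\<close> into the saturation of the roots as
      well, and the two subgroups meet trivially.\<close>
    then have "p x \<in> perpD R (coroots R)" using px by (simp add: perpD_def)
    moreover have "p x \<in> satur (lat R) (roots R)" using px ss by (simp add: semisimple_def)
    ultimately show "p x = \<one>\<^bsub>lat R\<^esub>" using satur_Int_perpD[OF R] by blast
  qed
  have ker_sub: "subgroup (kernel (lat R') (lat T) q) (lat R')"
    using D(2) by (intro group_hom.subgroup_kernel group_hom.intro group_hom_axioms.intro) unfold_locales
  have "roots R' \<subseteq> kernel (lat R') (lat T) q"
    using D(4) root_datum_bilinear(3)[OF R'] by (auto simp: kernel_def)
  then have gen: "z \<in> generate (lat R') (roots R') \<Longrightarrow> z \<in> carrier (lat R') \<and> q z = \<one>\<^bsub>lat T\<^esub>" for z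
    using L'.generate_subgroup_incl[OF _ ker_sub] by (auto simp: kernel_def)
  show q_ker: "q x = \<one>\<^bsub>lat T\<^esub> \<longleftrightarrow> x \<in> satur (lat R') (roots R')" if x: "x \<in> carrier (lat R')" for x
  proof
    assume "x \<in> satur (lat R') (roots R')"
    then obtain n :: nat where n: "n > 0" "x [^]\<^bsub>lat R'\<^esub> n \<in> generate (lat R') (roots R')" by (auto simp: satur_def)
    then have "q x [^]\<^bsub>lat T\<^esub> n = \<one>\<^bsub>lat T\<^esub>"
      using gen hom_nat_pow_eq[OF L'.is_group T.is_group D(2) x, of n] by simp
    moreover have "lattice (lat T)" using T by (simp add: root_datum_def)
    ultimately show "q x = \<one>\<^bsub>lat T\<^esub>" using lattice_torsion_free[OF _ hom_in_carrier[OF D(2) x] n(1)] by simp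
  next
    assume qx: "q x = \<one>\<^bsub>lat T\<^esub>"
    have "p x \<in> satur (lat R) (roots R)"
      using hom_in_carrier[OF D(1) x] ss by (simp add: semisimple_def)
    then obtain n :: nat where n: "n > 0" "p x [^]\<^bsub>lat R\<^esub> n \<in> generate (lat R) (p ` roots R')"
      unfolding D(3) by (auto simp: satur_def)
    have "generate (lat R) (p ` roots R') = p ` generate (lat R') (roots R')"
      using root_datum_bilinear(3)[OF R'] D(1)
      by (intro group_hom.generate_img group_hom.intro group_hom_axioms.intro) unfold_locales
    then obtain z where z: "z \<in> generate (lat R') (roots R')" "p x [^]\<^bsub>lat R\<^esub> n = p z" using n(2) by blast
    \<comment> \<open>Both elements have the same image under \<open>p\<close> and are killed by
      \<open>q\<close>, and the pair of maps is injective.\<close>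
    have "x [^]\<^bsub>lat R'\<^esub> n = z"
    proof (rule D(6))
      show "p (x [^]\<^bsub>lat R'\<^esub> n) = p z" using z hom_nat_pow_eq[OF L'.is_group L.is_group D(1) x] by simp
      show "q (x [^]\<^bsub>lat R'\<^esub> n) = q z" using qx gen[OF z(1)] hom_nat_pow_eq[OF L'.is_group T.is_group D(2) x] by simp
    qed (use x gen[OF z(1)] in auto)
    then show "x \<in> satur (lat R') (roots R')" using z n x by (auto simp: satur_def)
  qed
  have g1: "g \<one>\<^bsub>lat T\<^esub> = \<one>" using hom_one[OF gh T.is_group A.is_group] .
  \<comment> \<open>Since the saturation of the roots is the kernel of \<open>q\<close>, its image
    under \<open>p\<close> consists of those \<open>x\<close> whose pair with the identity of T lies
    in the fibre product.\<close>
  show "p ` satur (lat R') (roots R') = {x \<in> carrier (lat R). h x = \<one>}"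
  proof (intro equalityI subsetI)
    fix z assume "z \<in> p ` satur (lat R') (roots R')"
    then obtain x where x: "x \<in> satur (lat R') (roots R')" "z = p x" by blast
    then have xc: "x \<in> carrier (lat R')" by (simp add: satur_def)
    then show "z \<in> {x \<in> carrier (lat R). h x = \<one>}"
      using x q_ker[OF xc] D(7)[OF xc] g1 hom_in_carrier[OF D(1) xc] by simp
  next
    fix z assume "z \<in> {x \<in> carrier (lat R). h x = \<one>}"
    then obtain x where "x \<in> carrier (lat R')" "p x = z" "q x = \<one>\<^bsub>lat T\<^esub>"
      using D(8)[of z "\<one>\<^bsub>lat T\<^esub>"] g1 by auto
    then show "z \<in> p ` satur (lat R') (roots R')" using q_ker by blast
  qed
qed

text \<open>The hypothesis \<open>eq\<close> says that the pair (v, w) carries the fibre product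
  along \<open>g\<close> onto the one along \<open>g'\<close>. It serves both to normalise the
  gluing map and to realise tame automorphisms.\<close>

lemma fibre_pres_change:
  assumes pq: "fibre_pres R' R T h g p q" and v: "lat_iso R R v" and w: "w \<in> iso (lat T) (lat T)"
    and eq: "\<And>x t. x \<in> carrier (lat R) \<Longrightarrow> t \<in> carrier (lat T) \<Longrightarrow> h x = g t \<longleftrightarrow> h (v x) = g' (w t)"
  shows "fibre_pres R' R T h g' (\<lambda>x. v (p x)) (\<lambda>x. w (q x))"
proof -
  note D = fibre_presD[OF pq]
  have vh: "v \<in> hom (lat R) (lat R)" and vb: "inj_on v (carrier (lat R))" "v ` carrier (lat R) = carrier (lat R)"
    using v by (auto simp: lat_iso_def iso_def bij_betw_def)
  have wh: "w \<in> hom (lat T) (lat T)" and wb: "inj_on w (carrier (lat T))" "w ` carrier (lat T) = carrier (lat T)"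
    using w by (auto simp: iso_def bij_betw_def)
  note pc = hom_in_carrier[OF D(1)] and qc = hom_in_carrier[OF D(2)]
  show ?thesis
    unfolding fibre_pres_def
  proof (intro conjI ballI)
    show "(\<lambda>x. v (p x)) \<in> hom (lat R') (lat R)" using hom_compose[OF D(1) vh] by (simp add: comp_def)
    show "(\<lambda>x. w (q x)) \<in> hom (lat R') (lat T)" using hom_compose[OF D(2) wh] by (simp add: comp_def)
    show "inj_on (\<lambda>x. (v (p x), w (q x))) (carrier (lat R'))"
    proof (rule inj_onI)
      fix x y assume x: "x \<in> carrier (lat R')" and y: "y \<in> carrier (lat R')"
        and e: "(v (p x), w (q x)) = (v (p y), w (q y))"
      then have "p x = p y" "q x = q y"
        using inj_onD[OF vb(1)] inj_onD[OF wb(1)] pc[OF x] pc[OF y] qc[OF x] qc[OF y] by auto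
      then show "x = y" using D(6)[OF x y] by blast
    qed
    show "(\<lambda>x. (v (p x), w (q x))) ` carrier (lat R') = fibre R T h g'"
    proof (intro equalityI subsetI)
      fix z assume "z \<in> (\<lambda>x. (v (p x), w (q x))) ` carrier (lat R')"
      then obtain x where x: "x \<in> carrier (lat R')" "z = (v (p x), w (q x))" by blast
      then show "z \<in> fibre R T h g'"
        using eq[OF pc[OF x(1)] qc[OF x(1)]] D(7)[OF x(1)] hom_in_carrier[OF vh pc[OF x(1)]] hom_in_carrier[OF wh qc[OF x(1)]]
        by (simp add: mem_fibre)
    next
      fix z assume "z \<in> fibre R T h g'"
      then obtain a b where ab: "z = (a, b)" "a \<in> carrier (lat R)" "b \<in> carrier (lat T)" "h a = g' b"
        by (cases z) (auto simp: mem_fibre)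
      obtain x where x: "x \<in> carrier (lat R)" "a = v x" using ab(2) vb(2) by blast
      obtain t where t: "t \<in> carrier (lat T)" "b = w t" using ab(3) wb(2) by blast
      have "h x = g t" using eq[OF x(1) t(1)] ab x t by simp
      then obtain x' where "x' \<in> carrier (lat R')" "p x' = x" "q x' = t" using D(8)[OF x(1) t(1)] by blast
      then show "z \<in> (\<lambda>x. (v (p x), w (q x))) ` carrier (lat R')" using ab x t by blast
    qed
    have "(\<lambda>x. v (p x)) ` roots R' = v ` p ` roots R'" by (simp only: image_image)
    then show "(\<lambda>x. v (p x)) ` roots R' = roots R" using v D(3) by (simp add: lat_iso_def)
    show "w (q \<alpha>) = \<one>\<^bsub>lat T\<^esub>" if "\<alpha> \<in> roots R'" for \<alpha>
      using D(4)[OF that] hom_one[OF wh T.is_group T.is_group] by simp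
    show "coroots_match R' R (\<lambda>x. v (p x))"
      by (rule coroots_match_comp[OF D(5) _ pc]) (use v in \<open>simp_all add: lat_iso_def\<close>)
  qed
qed

text \<open>\<open>p\<close> and \<open>q\<close> are the projections to the derived and radical
  lattices, followed by the given isomorphisms. The condition on K says that \<open>p\<close> maps
  the kernel of \<open>q\<close> onto the kernel of \<open>h\<close>; hence
  \<open>h \<circ> p\<close> factors through \<open>q\<close>, and the factor is the gluing map
  \<open>g\<close>.\<close>

lemma fibre_pres_of_der_rad:
  assumes R': "root_datum R'" and der: "rd_iso (rd_der R') R \<phi> \<psi>"
    and K: "\<phi> ` ((\<lambda>z. perpD R' (coroots R') #>\<^bsub>lat R'\<^esub> z) `
               (satur (lat R') (roots R') <#>\<^bsub>lat R'\<^esub> perpD R' (coroots R'))) = {x \<in> carrier (lat R). h x = \<one>}"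
    and rad: "rd_isomorphic (rd_rad R') T"
  shows "\<exists>g\<in>epi (lat T) A. \<exists>p q. fibre_pres R' R T h g p q"
proof -
  let ?N = "perpD R' (coroots R')" and ?S = "satur (lat R') (roots R')"
  interpret L': comm_group "lat R'" by (rule root_datum_bilinear(1)[OF R'])
  note N = perpD_subgroup[OF R']
  note S = satur_subgroup[OF root_datum_bilinear(1,3)[OF R']]
  note prN = Mod_projection_epi[OF L'.comm_group_axioms N]
  note prS = Mod_projection_epi[OF L'.comm_group_axioms S]
  have gN: "group (lat R' Mod ?N)" using L'.abelian_FactGroup[OF N] by (simp add: comm_group_def)
  have gS: "group (lat R' Mod ?S)" using L'.abelian_FactGroup[OF S] by (simp add: comm_group_def)
  obtain \<chi> \<eta> where "rd_iso (rd_rad R') T \<chi> \<eta>" using rad by (auto simp: rd_isomorphic_def)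
  then have \<chi>: "\<chi> \<in> iso (lat R' Mod ?S) (lat T)" by (simp add: rd_iso_def rd_rad_def)
  have \<phi>: "\<phi> \<in> iso (lat R' Mod ?N) (lat R)" using der by (simp add: rd_iso_def rd_der_def)
  define p where "p x = \<phi> (?N #>\<^bsub>lat R'\<^esub> x)" for x
  define q where "q x = \<chi> (?S #>\<^bsub>lat R'\<^esub> x)" for x
  have p: "p \<in> epi (lat R') (lat R)"
    using epi_compose[OF prN(1), of \<phi> "lat R"] \<phi> by (simp add: p_def[abs_def] comp_def iso_iff_mon_epi)
  have q: "q \<in> epi (lat R') (lat T)"
    using epi_compose[OF prS(1), of \<chi> "lat T"] \<chi> by (simp add: q_def[abs_def] comp_def iso_iff_mon_epi)
  have ph: "p \<in> hom (lat R') (lat R)" and qh: "q \<in> hom (lat R') (lat T)" using p q by (auto simp: epi_def)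
  have prNc: "?N #>\<^bsub>lat R'\<^esub> x \<in> carrier (lat R' Mod ?N)" "?S #>\<^bsub>lat R'\<^esub> x \<in> carrier (lat R' Mod ?S)"
    if "x \<in> carrier (lat R')" for x using prN(1) prS(1) that by (auto simp: epi_def)
  have pk: "p x = \<one>\<^bsub>lat R\<^esub> \<longleftrightarrow> x \<in> ?N" if "x \<in> carrier (lat R')" for x
    unfolding p_def using that iso_eq_one_iff[OF \<phi> gN L.is_group] prN(2) prNc by simp
  have qk: "q x = \<one>\<^bsub>lat T\<^esub> \<longleftrightarrow> x \<in> ?S" if "x \<in> carrier (lat R')" for x
    unfolding q_def using that iso_eq_one_iff[OF \<chi> gS T.is_group] prS(2) prNc by simp
  have pS: "p ` ?S = {x \<in> carrier (lat R). h x = \<one>}"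
  proof -
    have "\<phi> ` ((\<lambda>z. ?N #>\<^bsub>lat R'\<^esub> z) ` (?S <#>\<^bsub>lat R'\<^esub> ?N)) = p ` ?S"
    proof (rule image_coset_image_set_mult[OF L'.comm_group_axioms N subgroup.subset[OF S] L.is_group ph])
      show "p x = \<one>\<^bsub>lat R\<^esub>" if "x \<in> ?N" for x using pk[OF subgroup.mem_carrier[OF N that]] that by simp
    qed (simp add: p_def)
    then show ?thesis using K by simp
  qed
  have hp: "(\<lambda>x. h (p x)) \<in> epi (lat R') A" using epi_compose[OF p h] by (simp add: comp_def)
  have "h (p x) = \<one>" if x: "x \<in> carrier (lat R')" "q x = \<one>\<^bsub>lat T\<^esub>" for x
  proof -
    have "p x \<in> p ` ?S" using qk x by blast
    then show ?thesis unfolding pS by simp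
  qed
  then obtain g where g: "g \<in> hom (lat T) A" "\<And>x. x \<in> carrier (lat R') \<Longrightarrow> g (q x) = h (p x)"
    using hom_factor_epi[OF L'.is_group T.is_group A.is_group q, of "\<lambda>x. h (p x)"] hp by (auto simp: epi_def)
  have ge: "g \<in> epi (lat T) A"
    unfolding epi_iff_subset
  proof (intro conjI subsetI g(1))
    fix a assume "a \<in> carrier A"
    then obtain x where x: "x \<in> carrier (lat R')" "a = h (p x)" using hp by (auto simp: epi_def)
    then have "a = g (q x)" using g by simp
    then show "a \<in> g ` carrier (lat T)" using hom_in_carrier[OF qh x(1)] by blast
  qed
  have lat: "lat_iso (rd_der R') R \<phi>"
    using rd_iso_imp_lat_iso[OF der] rd_der_left_perfect(1)[OF R'] by (simp add: left_perfect_def)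
  have "fibre_pres R' R T h g p q"
    unfolding fibre_pres_def
  proof (intro conjI ballI ph qh)
    show "inj_on (\<lambda>x. (p x, q x)) (carrier (lat R'))"
    proof (rule inj_onI)
      fix x y assume x: "x \<in> carrier (lat R')" and y: "y \<in> carrier (lat R')" and e: "(p x, q x) = (p y, q y)"
      define z where "z = x \<otimes>\<^bsub>lat R'\<^esub> inv\<^bsub>lat R'\<^esub> y"
      have z: "z \<in> carrier (lat R')" using x y by (simp add: z_def)
      have "p z = \<one>\<^bsub>lat R\<^esub>" "q z = \<one>\<^bsub>lat T\<^esub>"
        using x y e hom_in_carrier[OF ph y] hom_in_carrier[OF qh y]
        by (simp_all add: z_def hom_mult[OF ph] hom_mult[OF qh] hom_inv_eq[OF L'.is_group L.is_group ph]
            hom_inv_eq[OF L'.is_group T.is_group qh])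
      then have "z = \<one>\<^bsub>lat R'\<^esub>" using satur_Int_perpD[OF R'] pk qk z by blast
      then show "x = y" using x y by (metis L'.inv_closed L'.inv_equality L'.inv_inv z_def)
    qed
    show "(\<lambda>x. (p x, q x)) ` carrier (lat R') = fibre R T h g"
    proof (intro equalityI subsetI)
      fix z assume "z \<in> (\<lambda>x. (p x, q x)) ` carrier (lat R')"
      then show "z \<in> fibre R T h g"
        using g(2) hom_in_carrier[OF ph] hom_in_carrier[OF qh] by (auto simp: mem_fibre)
    next
      fix z assume "z \<in> fibre R T h g"
      then obtain x t where xt: "z = (x, t)" "x \<in> carrier (lat R)" "t \<in> carrier (lat T)" "h x = g t"
        by (cases z) (auto simp: mem_fibre)
      \<comment> \<open>Lift \<open>t\<close> arbitrarily. The error in the first component lies in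
        the kernel of \<open>h\<close>, so it is \<open>p s\<close> with \<open>s\<close> in the
        kernel of \<open>q\<close>; correcting by \<open>s\<close> leaves the second component
        unchanged.\<close>
      obtain x' where x': "x' \<in> carrier (lat R')" "t = q x'" using q xt(3) by (auto simp: epi_def)
      have px': "p x' \<in> carrier (lat R)" using hom_in_carrier[OF ph x'(1)] .
      have "h (x \<otimes>\<^bsub>lat R\<^esub> inv\<^bsub>lat R\<^esub> p x') = \<one>"
        using xt x' px' g(2)[OF x'(1)] h_in[OF px']
        by (simp add: hom_mult[OF h_hom] hom_inv_eq[OF L.is_group A.is_group h_hom])
      then have "x \<otimes>\<^bsub>lat R\<^esub> inv\<^bsub>lat R\<^esub> p x' \<in> p ` ?S" unfolding pS using xt px' by simp
      then obtain s where s: "s \<in> ?S" "x \<otimes>\<^bsub>lat R\<^esub> inv\<^bsub>lat R\<^esub> p x' = p s" by blast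
      have sc: "s \<in> carrier (lat R')" using s(1) by (simp add: satur_def)
      have "p (s \<otimes>\<^bsub>lat R'\<^esub> x') = x"
        using s(2)[symmetric] sc x' px' xt by (simp add: hom_mult[OF ph] L.m_assoc)
      moreover have "q (s \<otimes>\<^bsub>lat R'\<^esub> x') = t"
        using qk[OF sc] s(1) sc x' xt by (simp add: hom_mult[OF qh])
      ultimately show "z \<in> (\<lambda>x. (p x, q x)) ` carrier (lat R')"
        using xt sc x' by (intro image_eqI[of _ _ "s \<otimes>\<^bsub>lat R'\<^esub> x'"]) auto
    qed
    have "p ` roots R' = \<phi> ` roots (rd_der R')" by (simp add: p_def[abs_def] rd_der_def image_image)
    then show "p ` roots R' = roots R" using lat by (simp add: lat_iso_def)
    show "q \<alpha> = \<one>\<^bsub>lat T\<^esub>" if "\<alpha> \<in> roots R'" for \<alpha>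
      using subset_satur[OF L'.is_group root_datum_bilinear(3)[OF R']] qk that root_datum_bilinear(3)[OF R'] by blast
    show "coroots_match R' R p"
      unfolding p_def[abs_def]
      by (rule coroots_match_comp[OF coroots_match_der[OF R']])
        (use lat prNc in \<open>simp_all add: lat_iso_def rd_der_def\<close>)
  qed
  then show ?thesis using ge by blast
qed

text \<open>Once \<open>u\<close> matches the kernels, \<open>f\<close> and
  \<open>g \<circ> u\<close> are surjections with the same kernel and hence differ by an
  automorphism of A.\<close>

lemma torus_epis_equivalent:
  assumes f: "f \<in> epi (lat T) A" and g: "g \<in> epi (lat T) A"
  shows "\<exists>u\<in>iso (lat T) (lat T). \<exists>\<psi>\<in>auto A. \<forall>t\<in>carrier (lat T). g (u t) = \<psi> (f t)"
proof -
  obtain n \<theta> where \<theta>: "\<theta> \<in> iso (lat T) (Zlat n)" using T by (auto simp: root_datum_def lattice_def)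
  obtain \<zeta> where \<zeta>: "\<zeta> \<in> iso (Zlat n) (lat T)" and \<zeta>\<theta>: "\<And>t. t \<in> carrier (lat T) \<Longrightarrow> \<zeta> (\<theta> t) = t"
    using iso_inverse[OF \<theta> T.is_group] by metis
  have \<zeta>e: "\<zeta> \<in> epi (Zlat n) (lat T)" using \<zeta> by (simp add: iso_iff_mon_epi)
  have "(\<lambda>x. f (\<zeta> x)) \<in> epi (Zlat n) A" "(\<lambda>x. g (\<zeta> x)) \<in> epi (Zlat n) A"
    using epi_compose[OF \<zeta>e f] epi_compose[OF \<zeta>e g] by (simp_all add: comp_def)
  then obtain u' where u': "u' \<in> iso (Zlat n) (Zlat n)"
    "\<And>x. x \<in> carrier (Zlat n) \<Longrightarrow> f (\<zeta> x) = \<one> \<longleftrightarrow> g (\<zeta> (u' x)) = \<one>"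
    using Zlat_epi_kernels_equivalent[OF A A_torsion] by blast
  define u where "u t = \<zeta> (u' (\<theta> t))" for t
  have u: "u \<in> iso (lat T) (lat T)" unfolding u_def using iso_comp[OF iso_comp[OF \<theta> u'(1)] \<zeta>] .
  then have "u \<in> epi (lat T) (lat T)" by (simp add: iso_iff_mon_epi)
  then have gu: "(\<lambda>t. g (u t)) \<in> epi (lat T) A" using epi_compose[OF _ g] by (simp add: comp_def)
  have "f t = \<one> \<longleftrightarrow> g (u t) = \<one>" if t: "t \<in> carrier (lat T)" for t
  proof -
    have "\<theta> t \<in> carrier (Zlat n)" using \<theta> t by (auto simp: iso_def hom_def)
    then show ?thesis using u'(2)[of "\<theta> t"] \<zeta>\<theta>[OF t] by (simp add: u_def)
  qed
  then obtain \<psi> where \<psi>: "\<psi> \<in> iso A A" "\<And>t. t \<in> carrier (lat T) \<Longrightarrow> \<psi> (f t) = g (u t)"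
    using iso_factor_epi[OF T.is_group A.is_group A.is_group f gu] by blast
  have fc: "f t \<in> carrier A" if "t \<in> carrier (lat T)" for t using f that by (auto simp: epi_def hom_def)
  show ?thesis
    by (rule bexI[OF _ u], rule bexI[OF _ autoI_iso[OF \<psi>(1) A.is_group]]) (simp add: \<psi>(2) fc)
qed

text \<open>Coordinates on the fibre product, which is free, transport the central product to Z^n
  with \<open>dot\<close> as pairing. This is where the root datum axioms are verified for a central
  product.\<close>

lemma fibre_pres_exists:
  assumes g: "g \<in> epi (lat T) A"
  shows "\<exists>S::crd. root_datum S \<and> (\<exists>p q. fibre_pres S R T h g p q)"
proof -
  have gh: "g \<in> hom (lat T) A" and gs: "g ` carrier (lat T) = carrier A" using g by (auto simp: epi_def)
  let ?M = "(lat R \<times>\<times> lat T)\<lparr>carrier := fibre R T h g\<rparr>"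
  have lM: "lattice ?M"
    using R T by (intro lattice_subgroup lattice_DirProd fibre_subgroup gh) (auto simp: root_datum_def)
  then obtain n \<theta> where \<theta>: "\<theta> \<in> iso ?M (Zlat n)" by (auto simp: lattice_def)
  interpret M: comm_group ?M using lM by (simp add: lattice_def)
  interpret Z: comm_group "Zlat n" by (rule comm_group_Zlat)
  define \<zeta> where "\<zeta> = inv_into (carrier ?M) \<theta>"
  have \<zeta>: "\<zeta> \<in> iso (Zlat n) ?M" unfolding \<zeta>_def by (rule M.iso_set_sym[OF \<theta>])
  have \<zeta>im: "\<zeta> ` carrier (Zlat n) = fibre R T h g" and \<zeta>inj: "inj_on \<zeta> (carrier (Zlat n))"
    using \<zeta> by (auto simp: iso_def bij_betw_def)
  have \<zeta>c: "\<zeta> v \<in> fibre R T h g" if "v \<in> carrier (Zlat n)" for v using \<zeta>im that by blast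
  have \<zeta>m: "\<zeta> (v \<otimes>\<^bsub>Zlat n\<^esub> w) = \<zeta> v \<otimes>\<^bsub>lat R \<times>\<times> lat T\<^esub> \<zeta> w"
    if "v \<in> carrier (Zlat n)" "w \<in> carrier (Zlat n)" for v w
    using \<zeta> that by (auto simp: iso_def hom_def)
  define p where "p v = fst (\<zeta> v)" for v
  define q where "q v = snd (\<zeta> v)" for v
  have pq: "\<zeta> v = (p v, q v)" for v by (simp add: p_def q_def)
  have ph: "p \<in> hom (Zlat n) (lat R)"
  proof (rule homI)
    fix v assume "v \<in> carrier (Zlat n)"
    from \<zeta>c[OF this] show "p v \<in> carrier (lat R)" unfolding pq by (simp add: mem_fibre)
  qed (simp add: p_def \<zeta>m mult_DirProd')
  have qh: "q \<in> hom (Zlat n) (lat T)"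
  proof (rule homI)
    fix v assume "v \<in> carrier (Zlat n)"
    from \<zeta>c[OF this] show "q v \<in> carrier (lat T)" unfolding pq by (simp add: mem_fibre)
  qed (simp add: q_def \<zeta>m mult_DirProd')
  have inj: "v = w" if "v \<in> carrier (Zlat n)" "w \<in> carrier (Zlat n)" "p v = p w" "q v = q w" for v w
    using inj_onD[OF \<zeta>inj, of v w] that by (simp add: pq)
  have surj: "\<exists>v\<in>carrier (Zlat n). p v = x \<and> q v = t"
    if "x \<in> carrier (lat R)" "t \<in> carrier (lat T)" "h x = g t" for x t
  proof -
    have "(x, t) \<in> \<zeta> ` carrier (Zlat n)" unfolding \<zeta>im using that by (simp add: mem_fibre)
    then show ?thesis by (auto simp: pq)
  qed
  have psurj: "\<exists>v\<in>carrier (Zlat n). p v = x" if x: "x \<in> carrier (lat R)" for x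
  proof -
    have "h x \<in> g ` carrier (lat T)" unfolding gs using h_in[OF x] .
    then obtain t where "t \<in> carrier (lat T)" "h x = g t" by blast
    then show ?thesis using surj[OF x] by blast
  qed
  note B = root_datum_bilinear[OF R]
  interpret D: comm_group "dlat R" by (rule B(2))
  have rtc: "\<alpha> \<in> carrier (lat R)" if "\<alpha> \<in> roots R" for \<alpha> using B(3) that by blast
  have crc: "y \<in> carrier (dlat R)" if "y \<in> coroots R" for y using B(4) that by blast
  have "\<exists>v. v \<in> carrier (Zlat n) \<and> p v = \<alpha> \<and> q v = \<one>\<^bsub>lat T\<^esub>" if "\<alpha> \<in> roots R" for \<alpha>
    using surj[OF rtc[OF that] T.one_closed] h_root[OF that] hom_one[OF gh T.is_group A.is_group] by auto
  \<comment> \<open>\<open>s\<close> lifts a root \<alpha> to the coordinates of (\<alpha>, 1), a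
    point of the fibre product because \<open>h\<close> and \<open>g\<close> send its entries to the
    identity.\<close>
  then obtain s where s: "\<And>\<alpha>. \<alpha> \<in> roots R \<Longrightarrow> s \<alpha> \<in> carrier (Zlat n)" "\<And>\<alpha>. \<alpha> \<in> roots R \<Longrightarrow> p (s \<alpha>) = \<alpha>"
    "\<And>\<alpha>. \<alpha> \<in> roots R \<Longrightarrow> q (s \<alpha>) = \<one>\<^bsub>lat T\<^esub>" by metis
  have "\<exists>w. w \<in> carrier (Zlat n) \<and> (\<forall>v\<in>carrier (Zlat n). dot n v w = pairing R (p v) y)" if "y \<in> carrier (dlat R)" for y
  proof -
    have "(\<lambda>v. pairing R (p v) y) \<in> hom (Zlat n) integer_group"
      using hom_compose[OF ph B(6)[OF that]] by (simp add: comp_def)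
    then show ?thesis using hom_Zlat_eq_dot by blast
  qed
  \<comment> \<open>\<kappa> is the transpose of \<open>p\<close>. Since \<open>p\<close> is
    surjective, which rests on the surjectivity of \<open>g\<close>, \<kappa> is injective and
    distinct coroots stay distinct.\<close>
  then obtain \<kappa> where \<kappa>: "\<And>y. y \<in> carrier (dlat R) \<Longrightarrow> \<kappa> y \<in> carrier (Zlat n)"
    and dot_\<kappa>: "\<And>y v. y \<in> carrier (dlat R) \<Longrightarrow> v \<in> carrier (Zlat n) \<Longrightarrow> dot n v (\<kappa> y) = pairing R (p v) y"
    by metis
  have dot_eq: "w = w'" if "w \<in> carrier (Zlat n)" "w' \<in> carrier (Zlat n)"
    "\<And>v. v \<in> carrier (Zlat n) \<Longrightarrow> dot n v w = dot n v w'" for w w'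
    using hom_Zlat_eq_dot[OF dot_hom[of n w]] that by metis
  have \<kappa>h: "\<kappa> \<in> hom (dlat R) (Zlat n)"
  proof (rule homI)
    fix y z assume y: "y \<in> carrier (dlat R)" and z: "z \<in> carrier (dlat R)"
    show "\<kappa> (y \<otimes>\<^bsub>dlat R\<^esub> z) = \<kappa> y \<otimes>\<^bsub>Zlat n\<^esub> \<kappa> z"
    proof (rule dot_eq)
      fix v assume v: "v \<in> carrier (Zlat n)"
      show "dot n v (\<kappa> (y \<otimes>\<^bsub>dlat R\<^esub> z)) = dot n v (\<kappa> y \<otimes>\<^bsub>Zlat n\<^esub> \<kappa> z)"
        using v y z \<kappa> hom_integer_groupD[OF B(5)[OF hom_in_carrier[OF ph v]] y z]
        by (simp add: dot_\<kappa> hom_integer_groupD[OF dot_hom_right])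
    qed (use y z \<kappa> in auto)
  qed (rule \<kappa>)
  have \<kappa>inj: "inj_on \<kappa> (carrier (dlat R))"
  proof (rule inj_onI)
    fix y z assume y: "y \<in> carrier (dlat R)" and z: "z \<in> carrier (dlat R)" and e: "\<kappa> y = \<kappa> z"
    show "y = z"
    proof (rule left_perfect_unique[OF root_datum_left_perfect[OF R] y z])
      fix x assume "x \<in> carrier (lat R)"
      then obtain v where "v \<in> carrier (Zlat n)" "p v = x" using psurj by blast
      then show "pairing R x y = pairing R x z" using dot_\<kappa>[OF y, of v] dot_\<kappa>[OF z, of v] e by simp
    qed
  qed
  define S :: crd where "S = \<lparr>lat = Zlat n, roots = s ` roots R, dlat = Zlat n, coroots = \<kappa> ` coroots R, pairing = dot n\<rparr>"
  have Ss: "lat S = Zlat n" "roots S = s ` roots R" "dlat S = Zlat n" "coroots S = \<kappa> ` coroots R" "pairing S = dot n"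
    by (simp_all add: S_def)
  obtain c where rp: "root_pairing (lat R) (dlat R) (pairing R) (roots R) c" and cim: "c ` roots R = coroots R"
    using root_datum_root_pairing[OF R] by blast
  interpret rp: root_pairing "lat R" "dlat R" "pairing R" "roots R" c by (rule rp)
  have cc: "c \<alpha> \<in> carrier (dlat R)" if "\<alpha> \<in> roots R" for \<alpha> using that by (rule rp.coroot_in)
  have "root_datum S"
    unfolding root_datum_def Ss
  proof (intro conjI ballI)
    show "lattice (Zlat n)" "lattice (Zlat n)" by (rule lattice_Zlat)+
    show "dot n v \<in> hom (Zlat n) integer_group" for v by (rule dot_hom_right)
    show "(\<lambda>v. dot n v w) \<in> hom (Zlat n) integer_group" for w by (rule dot_hom)
    show "\<exists>!w. w \<in> carrier (Zlat n) \<and> (\<forall>v\<in>carrier (Zlat n). dot n v w = \<phi> v)"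
      if "\<phi> \<in> hom (Zlat n) integer_group" for \<phi> using hom_Zlat_eq_dot[OF that] .
    show "\<exists>!w. w \<in> carrier (Zlat n) \<and> (\<forall>v\<in>carrier (Zlat n). dot n w v = \<phi> v)"
      if "\<phi> \<in> hom (Zlat n) integer_group" for \<phi> using hom_Zlat_eq_dot[OF that] by (simp add: dot_commute)
    show "s ` roots R \<subseteq> carrier (Zlat n)" using s by blast
    show "finite (s ` roots R)" using rp.roots by blast
    show "\<kappa> ` coroots R \<subseteq> carrier (Zlat n)" using \<kappa> crc by blast
    show "\<exists>c'. bij_betw c' (s ` roots R) (\<kappa> ` coroots R) \<and>
      (\<forall>a\<in>s ` roots R. dot n a (c' a) = 2 \<and>
        (\<lambda>x. x \<otimes>\<^bsub>Zlat n\<^esub> inv\<^bsub>Zlat n\<^esub> (a [^]\<^bsub>Zlat n\<^esub> dot n x (c' a))) ` s ` roots R = s ` roots R \<and>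
        (\<lambda>y. y \<otimes>\<^bsub>Zlat n\<^esub> inv\<^bsub>Zlat n\<^esub> (c' a [^]\<^bsub>Zlat n\<^esub> dot n a y)) ` \<kappa> ` coroots R = \<kappa> ` coroots R)"
    proof (intro exI[of _ "\<lambda>v. \<kappa> (c (p v))"] conjI ballI)
      have "bij_betw p (s ` roots R) (roots R)"
        by (rule bij_betw_byWitness[where f' = s]) (auto simp: s)
      moreover have "bij_betw c (roots R) (coroots R)" using rp.coroots cim by (simp add: bij_betw_def)
      moreover have "bij_betw \<kappa> (coroots R) (\<kappa> ` coroots R)"
        using inj_on_subset[OF \<kappa>inj B(4)] by (simp add: bij_betw_def)
      ultimately show "bij_betw (\<lambda>v. \<kappa> (c (p v))) (s ` roots R) (\<kappa> ` coroots R)"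
        using bij_betw_trans[OF bij_betw_trans] by (fastforce simp: comp_def)
      fix a assume "a \<in> s ` roots R"
      then obtain \<alpha> where \<alpha>: "\<alpha> \<in> roots R" "a = s \<alpha>" by blast
      have ca: "\<kappa> (c (p a)) = \<kappa> (c \<alpha>)" using \<alpha> s by simp
      have ac: "a \<in> carrier (Zlat n)" using \<alpha> s by simp
      show "dot n a (\<kappa> (c (p a))) = 2" using \<alpha> s rp.two[OF \<alpha>(1)] ac cc by (simp add: dot_\<kappa>)
      \<comment> \<open>\<open>p\<close> and \<open>q\<close> jointly separate points: under
        \<open>q\<close> both sides are trivial, under \<open>p\<close> the identity is the
        reflection in \<open>R\<close>.\<close>
      have "s \<beta> \<otimes>\<^bsub>Zlat n\<^esub> inv\<^bsub>Zlat n\<^esub> (a [^]\<^bsub>Zlat n\<^esub> dot n (s \<beta>) (\<kappa> (c \<alpha>)))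
          = s (\<beta> \<otimes>\<^bsub>lat R\<^esub> inv\<^bsub>lat R\<^esub> (\<alpha> [^]\<^bsub>lat R\<^esub> pairing R \<beta> (c \<alpha>)))" (is "?l = s ?r") if \<beta>: "\<beta> \<in> roots R" for \<beta>
      proof -
        have r: "?r \<in> roots R" using rp.reflection[OF \<alpha>(1)] \<beta> by blast
        have d: "dot n (s \<beta>) (\<kappa> (c \<alpha>)) = pairing R \<beta> (c \<alpha>)" using dot_\<kappa>[OF cc[OF \<alpha>(1)] s(1)[OF \<beta>]] s \<beta> by simp
        have pa: "p a = \<alpha>" "q a = \<one>\<^bsub>lat T\<^esub>" using \<alpha> s by simp_all
        show ?thesis
        proof (rule inj)
          show "?l \<in> carrier (Zlat n)" using s \<beta> ac by simp
          show "s ?r \<in> carrier (Zlat n)" using s r by simp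
          show "p ?l = p (s ?r)" unfolding s(2)[OF r] d
            using s \<beta> ac pa by (simp add: hom_mult[OF ph] hom_inv_eq[OF Z.is_group L.is_group ph]
                hom_int_pow_eq[OF Z.is_group L.is_group ph])
          show "q ?l = q (s ?r)" unfolding s(3)[OF r] d
            using s \<beta> ac pa by (simp add: hom_mult[OF qh] hom_inv_eq[OF Z.is_group T.is_group qh]
                hom_int_pow_eq[OF Z.is_group T.is_group qh])
        qed
      qed
      then have "(\<lambda>x. x \<otimes>\<^bsub>Zlat n\<^esub> inv\<^bsub>Zlat n\<^esub> (a [^]\<^bsub>Zlat n\<^esub> dot n x (\<kappa> (c \<alpha>)))) ` s ` roots R
        = s ` (\<lambda>\<beta>. \<beta> \<otimes>\<^bsub>lat R\<^esub> inv\<^bsub>lat R\<^esub> (\<alpha> [^]\<^bsub>lat R\<^esub> pairing R \<beta> (c \<alpha>))) ` roots R"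
        unfolding image_image by (intro image_cong refl)
      then show "(\<lambda>x. x \<otimes>\<^bsub>Zlat n\<^esub> inv\<^bsub>Zlat n\<^esub> (a [^]\<^bsub>Zlat n\<^esub> dot n x (\<kappa> (c (p a))))) ` s ` roots R = s ` roots R"
        unfolding ca rp.reflection[OF \<alpha>(1)] .
      have "\<kappa> y \<otimes>\<^bsub>Zlat n\<^esub> inv\<^bsub>Zlat n\<^esub> (\<kappa> (c \<alpha>) [^]\<^bsub>Zlat n\<^esub> dot n a (\<kappa> y))
          = \<kappa> (y \<otimes>\<^bsub>dlat R\<^esub> inv\<^bsub>dlat R\<^esub> (c \<alpha> [^]\<^bsub>dlat R\<^esub> pairing R \<alpha> y))" if y: "y \<in> coroots R" for y
      proof -
        have d: "dot n a (\<kappa> y) = pairing R \<alpha> y" using dot_\<kappa>[OF crc[OF y] ac] \<alpha> s by simp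
        show ?thesis unfolding d
          using crc[OF y] cc[OF \<alpha>(1)] by (simp add: hom_mult[OF \<kappa>h] hom_inv_eq[OF D.is_group Z.is_group \<kappa>h]
                hom_int_pow_eq[OF D.is_group Z.is_group \<kappa>h])
      qed
      then have "(\<lambda>y. y \<otimes>\<^bsub>Zlat n\<^esub> inv\<^bsub>Zlat n\<^esub> (\<kappa> (c \<alpha>) [^]\<^bsub>Zlat n\<^esub> dot n a y)) ` \<kappa> ` coroots R
        = \<kappa> ` (\<lambda>y. y \<otimes>\<^bsub>dlat R\<^esub> inv\<^bsub>dlat R\<^esub> (c \<alpha> [^]\<^bsub>dlat R\<^esub> pairing R \<alpha> y)) ` coroots R"
        unfolding image_image by (intro image_cong refl)
      then show "(\<lambda>y. y \<otimes>\<^bsub>Zlat n\<^esub> inv\<^bsub>Zlat n\<^esub> (\<kappa> (c (p a)) [^]\<^bsub>Zlat n\<^esub> dot n a y)) ` \<kappa> ` coroots R = \<kappa> ` coroots R"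
        unfolding ca rp.coreflection[OF \<alpha>(1), unfolded cim] .
    qed
    fix a assume "a \<in> s ` roots R"
    then obtain \<alpha> where \<alpha>: "\<alpha> \<in> roots R" "a = s \<alpha>" by blast
    show "a [^]\<^bsub>Zlat n\<^esub> (2::int) \<notin> s ` roots R"
    proof
      assume "a [^]\<^bsub>Zlat n\<^esub> (2::int) \<in> s ` roots R"
      then obtain \<beta> where \<beta>: "\<beta> \<in> roots R" "a [^]\<^bsub>Zlat n\<^esub> (2::int) = s \<beta>" by blast
      have "\<alpha> [^]\<^bsub>lat R\<^esub> (2::int) = \<beta>"
        using hom_int_pow_eq[OF Z.is_group L.is_group ph s(1)[OF \<alpha>(1)], of 2] \<alpha> \<beta> s by simp
      moreover have "\<alpha> [^]\<^bsub>lat R\<^esub> (2::int) \<notin> roots R" using R \<alpha>(1) by (simp add: root_datum_def)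
      ultimately show False using \<beta> by simp
    qed
  qed
  moreover have "fibre_pres S R T h g p q"
    unfolding fibre_pres_def Ss
  proof (intro conjI ballI ph qh)
    show "inj_on (\<lambda>x. (p x, q x)) (carrier (Zlat n))" using \<zeta>inj by (simp add: pq[symmetric])
    show "(\<lambda>x. (p x, q x)) ` carrier (Zlat n) = fibre R T h g" using \<zeta>im by (simp add: pq[symmetric])
    show "p ` s ` roots R = roots R" unfolding image_image using s by simp
    show "q a = \<one>\<^bsub>lat T\<^esub>" if "a \<in> s ` roots R" for a using that s by auto
    show "coroots_match S R p" using dot_\<kappa> crc by (simp add: coroots_match_def Ss) metis
  qed
  ultimately show ?thesis by blast
qed

section \<open>Isomorphism classes of central products\<close>

lemma auto_epi:
  assumes "f \<in> epi (lat T) A" "\<psi> \<in> auto A"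
  shows "(\<lambda>t. \<psi> (f t)) \<in> epi (lat T) A"
  using epi_compose[OF assms(1), of \<psi> A] auto_imp_iso[OF assms(2)] by (simp add: comp_def iso_iff_mon_epi)

lemma rd_class_cprod_eq:
  fixes S :: crd
  assumes S: "root_datum S" and g: "g \<in> epi (lat T) A" and pq: "fibre_pres S R T h g p q"
  shows "rd_class (cprod R T h g) = rd_class S"
proof (rule rd_class_eq[OF S])
  have "g \<in> hom (lat T) A" using g by (simp add: epi_def)
  then show "rd_isomorphic S (cprod R T h g)"
    using isomorphic_cprod_iff[OF root_datum_left_perfect[OF S]] pq by blast
qed

text \<open>In one direction the kernels of a presentation identify the derived datum, the radical
  and K. In the other, a datum is presented with some gluing map \<open>g\<close>, which is then
  normalised to \<open>\<psi> \<circ> f\<close>.\<close>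

lemma rd_class_cprod_image:
  assumes f: "f \<in> epi (lat T) A"
  shows "(\<lambda>\<psi>. rd_class (cprod R T h (\<lambda>t. \<psi> (f t)))) ` auto A = rd_RTK R T {x \<in> carrier (lat R). h x = \<one>}"
    (is "?F ` _ = rd_RTK R T ?K")
proof (intro equalityI subsetI)
  fix C assume "C \<in> ?F ` auto A"
  then obtain \<psi> where \<psi>: "\<psi> \<in> auto A" "C = ?F \<psi>" by blast
  note g = auto_epi[OF f \<psi>(1)]
  obtain S :: crd and p q where S: "root_datum S" and pq: "fibre_pres S R T h (\<lambda>t. \<psi> (f t)) p q"
    using fibre_pres_exists[OF g] by blast
  note k = fibre_pres_kernels[OF S g pq] and D = fibre_presD[OF pq]
  obtain \<phi> \<chi> where der: "rd_iso (rd_der S) R \<phi> \<chi>"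
    and \<phi>: "\<And>x. x \<in> carrier (lat S) \<Longrightarrow> \<phi> (perpD S (coroots S) #>\<^bsub>lat S\<^esub> x) = p x"
    using rd_der_iso_of_epi[OF S R k(1) k(3) D(3) D(5)] by blast
  note N = perpD_subgroup[OF S]
  have "\<phi> ` ((\<lambda>z. perpD S (coroots S) #>\<^bsub>lat S\<^esub> z) ` (satur (lat S) (roots S) <#>\<^bsub>lat S\<^esub> perpD S (coroots S)))
      = p ` satur (lat S) (roots S)"
  proof (rule image_coset_image_set_mult[OF root_datum_bilinear(1)[OF S] N _ L.is_group D(1)])
    show "satur (lat S) (roots S) \<subseteq> carrier (lat S)" by (auto simp: satur_def)
    show "p x = \<one>\<^bsub>lat R\<^esub>" if "x \<in> perpD S (coroots S)" for x
      using k(3)[OF subgroup.mem_carrier[OF N that]] that by simp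
  qed (rule \<phi>)
  then have "\<phi> ` ((\<lambda>z. perpD S (coroots S) #>\<^bsub>lat S\<^esub> z) `
      (satur (lat S) (roots S) <#>\<^bsub>lat S\<^esub> perpD S (coroots S))) = ?K" using k(5) by simp
  moreover have "rd_isomorphic (rd_rad S) T" by (rule rd_rad_iso_of_epi[OF S T roots_T coroots_T k(2) k(4)])
  moreover have "C = rd_class S" using \<psi>(2) rd_class_cprod_eq[OF S g pq] by simp
  ultimately show "C \<in> rd_RTK R T ?K" unfolding rd_RTK_def using S der by blast
next
  fix C assume "C \<in> rd_RTK R T ?K"
  then obtain R' :: crd and \<phi> \<chi> where C: "C = rd_class R'" and R': "root_datum R'" and der: "rd_iso (rd_der R') R \<phi> \<chi>"
    and K: "\<phi> ` ((\<lambda>z. perpD R' (coroots R') #>\<^bsub>lat R'\<^esub> z) `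
               (satur (lat R') (roots R') <#>\<^bsub>lat R'\<^esub> perpD R' (coroots R'))) = ?K"
    and rad: "rd_isomorphic (rd_rad R') T"
    unfolding rd_RTK_def by blast
  obtain g p q where g: "g \<in> epi (lat T) A" and pq: "fibre_pres R' R T h g p q"
    using fibre_pres_of_der_rad[OF R' der K rad] by blast
  obtain u \<psi> where u: "u \<in> iso (lat T) (lat T)" and \<psi>: "\<psi> \<in> auto A"
    and gu: "\<And>t. t \<in> carrier (lat T) \<Longrightarrow> g (u t) = \<psi> (f t)"
    using torus_epis_equivalent[OF f g] by blast
  \<comment> \<open>The inverse of \<open>u\<close> is the change to make: replacing
    \<open>q\<close> by \<open>w \<circ> q\<close> turns \<open>g\<close> into
    \<open>\<psi> \<circ> f\<close>, because \<open>g t = \<psi> (f (w t))\<close>.\<close>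
  obtain w where w: "w \<in> iso (lat T) (lat T)"
    and uw: "\<And>t. t \<in> carrier (lat T) \<Longrightarrow> w t \<in> carrier (lat T) \<and> u (w t) = t"
    using iso_inverse[OF u T.is_group] by metis
  have "lat_iso R R (\<lambda>x. x)" using iso_set_refl by (auto simp: lat_iso_def coroots_match_def)
  then have "fibre_pres R' R T h (\<lambda>t. \<psi> (f t)) (\<lambda>x. p x) (\<lambda>x. w (q x))"
  proof (rule fibre_pres_change[OF pq _ w])
    fix x t assume "t \<in> carrier (lat T)"
    then have "\<psi> (f (w t)) = g t" using gu[of "w t"] uw[of t] by simp
    then show "h x = g t \<longleftrightarrow> h x = \<psi> (f (w t))" by simp
  qed
  then have "C = ?F \<psi>" using C rd_class_cprod_eq[OF R' auto_epi[OF f \<psi>]] by simp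
  then show "C \<in> ?F ` auto A" using \<psi> by blast
qed

text \<open>One datum \<open>S\<close> carries both presentations, and their kernels coincide, so
  \<open>p' = u \<circ> p\<close> and \<open>q = w \<circ> q'\<close> on its lattice. The opposite
  directions are deliberate: \<open>u\<close> induces the outer factor \<open>a\<close>,
  \<open>w\<close> the inner factor \<open>b\<close>.\<close>

lemma rd_class_cprod_eq_imp_tame:
  assumes f: "f \<in> epi (lat T) A" and \<psi>: "\<psi> \<in> auto A" and \<psi>': "\<psi>' \<in> auto A"
    and eq: "rd_class (cprod R T h (\<lambda>t. \<psi> (f t))) = rd_class (cprod R T h (\<lambda>t. \<psi>' (f t)))"
  shows "\<exists>a\<in>tame_aut R h A. \<exists>b\<in>tame_aut T f A. \<forall>z\<in>carrier A. \<psi>' z = a (\<psi> (b z))"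
proof -
  note g = auto_epi[OF f \<psi>] and g' = auto_epi[OF f \<psi>']
  obtain S :: crd and p q where S: "root_datum S" and pq: "fibre_pres S R T h (\<lambda>t. \<psi> (f t)) p q"
    using fibre_pres_exists[OF g] by blast
  have "S \<in> rd_class S" using S rd_isomorphic_refl by (simp add: rd_class_def)
  then have "S \<in> rd_class (cprod R T h (\<lambda>t. \<psi>' (f t)))" using eq rd_class_cprod_eq[OF S g pq] by simp
  then have "rd_isomorphic S (cprod R T h (\<lambda>t. \<psi>' (f t)))" by (simp add: rd_class_def)
  moreover have "(\<lambda>t. \<psi>' (f t)) \<in> hom (lat T) A" using g' by (simp add: epi_def)
  ultimately obtain p' q' where pq': "fibre_pres S R T h (\<lambda>t. \<psi>' (f t)) p' q'"
    using isomorphic_cprod_iff[OF root_datum_left_perfect[OF S]] by blast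
  note k = fibre_pres_kernels[OF S g pq] and k' = fibre_pres_kernels[OF S g' pq']
  note D = fibre_presD[OF pq] and D' = fibre_presD[OF pq']
  note gS = group_root_datum(1)[OF S]
  obtain u where u: "u \<in> iso (lat R) (lat R)" and up: "\<And>x. x \<in> carrier (lat S) \<Longrightarrow> u (p x) = p' x"
    using iso_factor_epi[OF gS L.is_group L.is_group k(1) k'(1)] k(3) k'(3) by blast
  obtain w where w: "w \<in> iso (lat T) (lat T)" and wq: "\<And>x. x \<in> carrier (lat S) \<Longrightarrow> w (q' x) = q x"
    using iso_factor_epi[OF gS T.is_group T.is_group k'(2) k(2)] k(4) k'(4) by blast
  have qs: "\<exists>x'\<in>carrier (lat S). t = q' x'" if "t \<in> carrier (lat T)" for t
    using k'(2) that by (auto simp: epi_def)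
  have pc: "p x \<in> carrier (lat R)" "q x \<in> carrier (lat T)" "q' x \<in> carrier (lat T)" if "x \<in> carrier (lat S)" for x
    using that hom_in_carrier[OF D(1)] hom_in_carrier[OF D(2)] hom_in_carrier[OF D'(2)] by auto
  have "lat_iso R R u"
    unfolding lat_iso_def
  proof (intro conjI u)
    have "u ` p ` roots S = p' ` roots S"
      unfolding image_image using up root_datum_bilinear(3)[OF S] by (intro image_cong) auto
    then show "u ` roots R = roots R" using D(3) D'(3) by simp
    show "coroots_match R R u"
      by (rule coroots_match_cancel_right[OF D(5) D'(5) _ up]) (use k(1) in \<open>simp_all add: epi_def\<close>)
  qed
  then obtain v where uv: "rd_iso R R u v"
    using lat_iso_imp_rd_iso[OF root_datum_left_perfect[OF R] root_datum_left_perfect[OF R]] by blast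
  obtain w' where ww': "rd_iso T T w w'"
    using lat_iso_imp_rd_iso[OF root_datum_left_perfect[OF T] root_datum_left_perfect[OF T]
        lat_iso_torus[OF roots_T coroots_T roots_T coroots_T w]] by blast
  \<comment> \<open>The kernel of \<open>h\<close> is the image of the saturation of the roots under
    \<open>p\<close> and under \<open>p'\<close> alike; hence \<open>u\<close> preserves it and
    induces \<open>a\<close> on A.\<close>
  have uker: "h x = \<one> \<longleftrightarrow> h (u x) = \<one>" if x: "x \<in> carrier (lat R)" for x
  proof
    assume "h x = \<one>"
    then have "x \<in> p ` satur (lat S) (roots S)" unfolding k(5) using x by simp
    then obtain s where s: "s \<in> satur (lat S) (roots S)" "x = p s" by blast
    have "u x = p' s" using s up by (simp add: satur_def)
    then have "u x \<in> p' ` satur (lat S) (roots S)" using s by blast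
    then show "h (u x) = \<one>" unfolding k'(5) by simp
  next
    assume e: "h (u x) = \<one>"
    have uc: "u x \<in> carrier (lat R)" using u x by (auto simp: iso_def hom_def)
    have "u x \<in> p' ` satur (lat S) (roots S)" unfolding k'(5) using uc e by simp
    then obtain s where s: "s \<in> satur (lat S) (roots S)" "u x = p' s" by blast
    have sc: "s \<in> carrier (lat S)" using s by (simp add: satur_def)
    have inj: "inj_on u (carrier (lat R))" using u by (simp add: iso_def bij_betw_def)
    have "x = p s" by (rule inj_onD[OF inj]) (use s up[OF sc] x pc[OF sc] in auto)
    then have "x \<in> p ` satur (lat S) (roots S)" using s by blast
    then show "h x = \<one>" unfolding k(5) by simp
  qed
  have ue: "u \<in> epi (lat R) (lat R)" and we: "w \<in> epi (lat T) (lat T)" using u w by (simp_all add: iso_iff_mon_epi)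
  have "(\<lambda>x. h (u x)) \<in> epi (lat R) A" using epi_compose[OF ue h] by (simp add: comp_def)
  then obtain a where a: "a \<in> iso A A" "\<And>x. x \<in> carrier (lat R) \<Longrightarrow> a (h x) = h (u x)"
    using iso_factor_epi[OF L.is_group A.is_group A.is_group h, of "\<lambda>x. h (u x)"] uker by blast
  have fc: "f t \<in> carrier A" if "t \<in> carrier (lat T)" for t using f that by (auto simp: epi_def hom_def)
  \<comment> \<open>The kernel of \<open>f\<close> is reached by passing through both presentations
    to \<open>h\<close>, where \<open>uker\<close> is available; \<psi> and \<psi>' do not affect
    triviality.\<close>
  have wker: "f t = \<one> \<longleftrightarrow> f (w t) = \<one>" if t: "t \<in> carrier (lat T)" for t
  proof -
    obtain x where x: "x \<in> carrier (lat S)" "t = q' x" using qs[OF t] by blast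
    have "f t = \<one> \<longleftrightarrow> \<psi>' (f (q' x)) = \<one>"
      using iso_eq_one_iff[OF auto_imp_iso[OF \<psi>'] A.is_group A.is_group fc[OF t]] x by simp
    also have "\<dots> \<longleftrightarrow> h (u (p x)) = \<one>" using D'(7)[OF x(1)] up[OF x(1)] by simp
    also have "\<dots> \<longleftrightarrow> h (p x) = \<one>" using uker[OF pc(1)[OF x(1)]] by simp
    also have "\<dots> \<longleftrightarrow> \<psi> (f (q x)) = \<one>" using D(7)[OF x(1)] by simp
    also have "\<dots> \<longleftrightarrow> f (q x) = \<one>"
      using iso_eq_one_iff[OF auto_imp_iso[OF \<psi>] A.is_group A.is_group fc[OF pc(2)[OF x(1)]]] .
    finally show ?thesis using wq[OF x(1)] x(2) by simp
  qed
  have "(\<lambda>x. f (w x)) \<in> epi (lat T) A" using epi_compose[OF we f] by (simp add: comp_def)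
  then obtain b where b: "b \<in> iso A A" "\<And>t. t \<in> carrier (lat T) \<Longrightarrow> b (f t) = f (w t)"
    using iso_factor_epi[OF T.is_group A.is_group A.is_group f, of "\<lambda>x. f (w x)"] wker by blast
  define a' where "a' = restrict a (carrier A)"
  define b' where "b' = restrict b (carrier A)"
  have "a' \<in> tame_aut R h A"
    unfolding tame_aut_def mem_Collect_eq
  proof (intro conjI exI[of _ u] exI[of _ v] uv ballI)
    show "a' \<in> auto A" unfolding a'_def by (rule autoI_iso[OF a(1) A.is_group])
    show "a' (h y) = h (u y)" if "y \<in> carrier (lat R)" for y using a(2)[OF that] h_in[OF that] by (simp add: a'_def)
  qed
  moreover have "b' \<in> tame_aut T f A"
    unfolding tame_aut_def mem_Collect_eq
  proof (intro conjI exI[of _ w] exI[of _ w'] ww' ballI)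
    show "b' \<in> auto A" unfolding b'_def by (rule autoI_iso[OF b(1) A.is_group])
    show "b' (f y) = f (w y)" if "y \<in> carrier (lat T)" for y using b(2)[OF that] fc[OF that] by (simp add: b'_def)
  qed
  moreover have "\<psi>' z = a' (\<psi> (b' z))" if z: "z \<in> carrier A" for z
  proof -
    have "z \<in> f ` carrier (lat T)" using f z by (simp add: epi_def)
    then obtain t where "t \<in> carrier (lat T)" "z = f t" by blast
    then obtain x where x: "x \<in> carrier (lat S)" "z = f (q' x)" using qs by blast
    have "\<psi>' z = h (u (p x))" using x D'(7)[OF x(1)] up[OF x(1)] by simp
    also have "\<dots> = a' (h (p x))" using a(2)[OF pc(1)[OF x(1)]] h_in[OF pc(1)[OF x(1)]] by (simp add: a'_def)
    also have "h (p x) = \<psi> (f (q x))" using D(7)[OF x(1)] .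
    also have "f (q x) = b' z" using b(2)[OF pc(3)[OF x(1)]] wq[OF x(1)] x z by (simp add: b'_def)
    finally show ?thesis .
  qed
  ultimately show ?thesis by blast
qed

text \<open>A presentation for \<psi> becomes one for \<psi>' by applying \<open>u\<close> to the
  first component and the inverse of \<open>w0\<close> to the second. The inverse occurs because
  \<open>b\<close> stands inside: \<open>\<psi>' (f (w t))\<close> is
  \<open>a (\<psi> (f t))\<close> when \<open>w0 (w t) = t\<close>.\<close>

lemma tame_imp_rd_class_cprod_eq:
  assumes f: "f \<in> epi (lat T) A" and \<psi>: "\<psi> \<in> auto A" and \<psi>': "\<psi>' \<in> auto A"
    and a: "a \<in> tame_aut R h A" and b: "b \<in> tame_aut T f A"
    and eq: "\<And>z. z \<in> carrier A \<Longrightarrow> \<psi>' z = a (\<psi> (b z))"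
  shows "rd_class (cprod R T h (\<lambda>t. \<psi> (f t))) = rd_class (cprod R T h (\<lambda>t. \<psi>' (f t)))"
proof -
  note g = auto_epi[OF f \<psi>] and g' = auto_epi[OF f \<psi>']
  obtain u u' where u: "rd_iso R R u u'" and au: "\<And>x. x \<in> carrier (lat R) \<Longrightarrow> a (h x) = h (u x)" and aa: "a \<in> auto A"
    using a by (auto simp: tame_aut_def)
  obtain w0 w' where w0': "rd_iso T T w0 w'" and bw: "\<And>t. t \<in> carrier (lat T) \<Longrightarrow> b (f t) = f (w0 t)"
    using b by (auto simp: tame_aut_def)
  have w0: "w0 \<in> iso (lat T) (lat T)" using w0' by (simp add: rd_iso_def)
  obtain w where w: "w \<in> iso (lat T) (lat T)"
    and ww: "\<And>t. t \<in> carrier (lat T) \<Longrightarrow> w t \<in> carrier (lat T) \<and> w0 (w t) = t"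
    using iso_inverse[OF w0 T.is_group] by metis
  obtain S :: crd and p q where S: "root_datum S" and pq: "fibre_pres S R T h (\<lambda>t. \<psi> (f t)) p q"
    using fibre_pres_exists[OF g] by blast
  have lu: "lat_iso R R u" by (rule rd_iso_imp_lat_iso[OF u root_datum_bilinear(4)[OF R]])
  have fc: "f t \<in> carrier A" if "t \<in> carrier (lat T)" for t using f that by (auto simp: epi_def hom_def)
  have gc: "\<psi> (f t) \<in> carrier A" if "t \<in> carrier (lat T)" for t using g that by (auto simp: epi_def hom_def)
  have ai: "inj_on a (carrier A)" using auto_imp_iso[OF aa] by (simp add: iso_def bij_betw_def)
  have "fibre_pres S R T h (\<lambda>t. \<psi>' (f t)) (\<lambda>x. u (p x)) (\<lambda>x. w (q x))"
  proof (rule fibre_pres_change[OF pq lu w])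
    fix x t assume x: "x \<in> carrier (lat R)" and t: "t \<in> carrier (lat T)"
    have "\<psi>' (f (w t)) = a (\<psi> (f t))" using eq[OF fc, of "w t"] bw[of "w t"] ww[OF t] by simp
    then show "h x = \<psi> (f t) \<longleftrightarrow> h (u x) = \<psi>' (f (w t))"
      using au[OF x] inj_on_eq_iff[OF ai h_in[OF x] gc[OF t]] by simp
  qed
  then show ?thesis using rd_class_cprod_eq[OF S g pq] rd_class_cprod_eq[OF S g'] by simp
qed

end

text \<open>The bijection is expressed on representatives, by its image and its fibres, without
  forming the double coset space. The double coset relation is tested on the carrier, since members
  of \<open>auto\<close> are extensional but a composite of such functions need not be.\<close>

theorem mainTheorem9:
  fixes R :: "('a, 'b) rdatum" and T :: "('c, 'd) rdatum" and K :: "'a set"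
    and h :: "'a \<Rightarrow> 'a set" and f :: "'c \<Rightarrow> 'a set"
  assumes "root_datum R" and "semisimple R"
    and "subgroup K (lat R)" and "roots R \<subseteq> K"
    and "root_datum T" and "roots T = {}" and "coroots T = {}"
    and "\<exists>f0. f0 \<in> epi (lat T) (lat R Mod K)"
    and "h \<in> epi (lat R) (lat R Mod K)" and "kernel (lat R) (lat R Mod K) h = K"
    and "f \<in> epi (lat T) (lat R Mod K)"
  shows "(\<lambda>\<psi>. rd_class (cprod R T h (\<lambda>t. \<psi> (f t)))) ` auto (lat R Mod K) = rd_RTK R T K
    \<and> (\<forall>\<psi>\<in>auto (lat R Mod K). \<forall>\<psi>'\<in>auto (lat R Mod K).
         rd_class (cprod R T h (\<lambda>t. \<psi> (f t))) = rd_class (cprod R T h (\<lambda>t. \<psi>' (f t)))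
         \<longleftrightarrow> (\<exists>a\<in>tame_aut R h (lat R Mod K). \<exists>b\<in>tame_aut T f (lat R Mod K).
                \<forall>z\<in>carrier (lat R Mod K). \<psi>' z = a (\<psi> (b z))))"
proof -
  let ?A = "lat R Mod K"
  have K: "{x \<in> carrier (lat R). h x = \<one>\<^bsub>?A\<^esub>} = K" using assms(10) by (simp add: kernel_def)
  interpret central_product R T ?A h
  proof (rule central_product.intro)
    show "root_datum R" "semisimple R" "root_datum T" "roots T = {}" "coroots T = {}" "h \<in> epi (lat R) ?A"
      by (fact assms)+
    show "comm_group ?A"
      using comm_group.abelian_FactGroup[OF root_datum_bilinear(1)[OF assms(1)] assms(3)] .
    show "h \<alpha> = \<one>\<^bsub>?A\<^esub>" if "\<alpha> \<in> roots R" for \<alpha> using that assms(4) K by blast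
  qed
  show ?thesis
  proof (intro conjI ballI iffI)
    show "(\<lambda>\<psi>. rd_class (cprod R T h (\<lambda>t. \<psi> (f t)))) ` auto ?A = rd_RTK R T K"
      using rd_class_cprod_image[OF assms(11)] unfolding K .
    fix \<psi> \<psi>' assume \<psi>: "\<psi> \<in> auto ?A" and \<psi>': "\<psi>' \<in> auto ?A"
    {
      assume "rd_class (cprod R T h (\<lambda>t. \<psi> (f t))) = rd_class (cprod R T h (\<lambda>t. \<psi>' (f t)))"
      then show "\<exists>a\<in>tame_aut R h ?A. \<exists>b\<in>tame_aut T f ?A. \<forall>z\<in>carrier ?A. \<psi>' z = a (\<psi> (b z))"
        by (rule rd_class_cprod_eq_imp_tame[OF assms(11) \<psi> \<psi>'])
    next
      assume "\<exists>a\<in>tame_aut R h ?A. \<exists>b\<in>tame_aut T f ?A. \<forall>z\<in>carrier ?A. \<psi>' z = a (\<psi> (b z))"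
      then obtain a b where "a \<in> tame_aut R h ?A" "b \<in> tame_aut T f ?A"
        and "\<And>z. z \<in> carrier ?A \<Longrightarrow> \<psi>' z = a (\<psi> (b z))" by blast
      then show "rd_class (cprod R T h (\<lambda>t. \<psi> (f t))) = rd_class (cprod R T h (\<lambda>t. \<psi>' (f t)))"
        by (rule tame_imp_rd_class_cprod_eq[OF assms(11) \<psi> \<psi>'])
    }
  qed
qed

end
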